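(* Let $G$ be a graph such that either $|V(G)| \leq 8$, or else $|V(G)| \leq 10$ and $|E(G)| \leq 21$. If $G$ is not $2$-apex (N2A) and a $\mathrm{Y}\nabla$ move takes $G$ to $G'$, then $G'$ is also N2A.
   Context: Graphs are finite and simple. A graph is $2$-apex if it can be made planar by deleting two or fewer vertices (and their incident edges); it is N2A if it is not $2$-apex. A $\mathrm{Y}\nabla$ move on a graph consists of deleting a degree three vertex (and its edges) and adding edges, where not already present, so that its three neighbors become mutually adjacent. *)

theory Defs
  imports "HOL-Analysis.Analysis"
begin

record 'a graph =
  verts :: "'a set"
  edges :: "'a set set"

definition finite_simple_graph :: "'a graph \<Rightarrow> bool" where
  "finite_simple_graph G \<longleftrightarrow>
     finite (verts G) \<and> edges G \<subseteq> {e. e \<subseteq> verts G \<and> card e = 2}"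

definition neighbors :: "'a graph \<Rightarrow> 'a \<Rightarrow> 'a set" where
  "neighbors G v = {w. {v, w} \<in> edges G}"

definition degree :: "'a graph \<Rightarrow> 'a \<Rightarrow> nat" where
  "degree G v = card {e \<in> edges G. v \<in> e}"

definition delete_vertices :: "'a graph \<Rightarrow> 'a set \<Rightarrow> 'a graph" where
  "delete_vertices G S =
     \<lparr> verts = verts G - S, edges = {e \<in> edges G. e \<inter> S = {}} \<rparr>"

text \<open>
  The plane is the type of complex numbers, as in the library's Jordan curve theorem. The vertex
  \<open>v\<close> is drawn as the point \<open>p v\<close> and the edge \<open>e\<close> as the arc \<open>\<gamma> e\<close>. An arc meets the drawn
  vertices only in its own ends, and two arcs meet only in the images of common ends of their edges.
\<close>

definition plane_drawing ::
    "'a graph \<Rightarrow> ('a \<Rightarrow> complex) \<Rightarrow> ('a set \<Rightarrow> real \<Rightarrow> complex) \<Rightarrow> bool" where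
  "plane_drawing G p \<gamma> \<longleftrightarrow>
     inj_on p (verts G) \<and>
     (\<forall>e \<in> edges G. arc (\<gamma> e) \<and>
        {pathstart (\<gamma> e), pathfinish (\<gamma> e)} = p ` e \<and>
        path_image (\<gamma> e) \<inter> p ` verts G = p ` e) \<and>
     (\<forall>e \<in> edges G. \<forall>f \<in> edges G. e \<noteq> f \<longrightarrow>
        path_image (\<gamma> e) \<inter> path_image (\<gamma> f) = p ` (e \<inter> f))"

definition planar :: "'a graph \<Rightarrow> bool" where
  "planar G \<longleftrightarrow> (\<exists>p \<gamma>. plane_drawing G p \<gamma>)"

definition two_apex :: "'a graph \<Rightarrow> bool" where
  "two_apex G \<longleftrightarrow>
     (\<exists>S. S \<subseteq> verts G \<and> finite S \<and> card S \<le> 2 \<and> planar (delete_vertices G S))"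

definition N2A :: "'a graph \<Rightarrow> bool" where
  "N2A G \<longleftrightarrow> \<not> two_apex G"

text \<open>
  Since \<open>edges\<close> is a set, the union adds a triangle edge only where it is not already present.
\<close>

definition Y_nabla_at :: "'a graph \<Rightarrow> 'a \<Rightarrow> 'a graph" where
  "Y_nabla_at G v =
     \<lparr> verts = verts G - {v},
       edges = edges (delete_vertices G {v}) \<union>
         {{x, y} | x y. x \<in> neighbors G v \<and> y \<in> neighbors G v \<and> x \<noteq> y} \<rparr>"

definition Y_nabla_move :: "'a graph \<Rightarrow> 'a graph \<Rightarrow> bool" where
  "Y_nabla_move G G' \<longleftrightarrow> (\<exists>v \<in> verts G. degree G v = 3 \<and> G' = Y_nabla_at G v)"

end

theory Submission
  imports Defs
begin

text \<open>
  Let \<open>v\<close> have the neighbours \<open>X = {x, y, z}\<close> and suppose that \<open>G' - S\<close> is planar with \<open>card S \<le> 2\<close>. If \<open>S\<close>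
  meets \<open>X\<close>, then \<open>v\<close> has at most two remaining neighbours and can be drawn at the end of a new pendant edge
  or parallel to an edge of the triangle, so \<open>G - S\<close> is planar. Otherwise let \<open>S = {a, b}\<close> and let \<open>W\<close> be the
  set of the at most four remaining vertices. If one side of the triangle \<open>X\<close> in a drawing of \<open>G' - S\<close> is
  empty, then \<open>v\<close> is drawn there; this happens if \<open>W\<close> is connected, and then vertices that see at most
  two vertices of \<open>X\<close> can be added along the edges of the triangle. In all remaining cases another pair of
  vertices is deleted, consisting of one vertex of \<open>X\<close> and one of \<open>S\<close>: then \<open>v\<close> becomes a path parallel to an
  edge between the other two vertices of \<open>X\<close>, and the rest is a subgraph of a stacked triangulation, or
  of a relabelled copy of \<open>G' - S\<close>. That \<open>G' - S\<close> contains no subdivision of \<open>K\<^sub>3\<^sub>,\<^sub>3\<close> or \<open>K\<^sub>5\<close> supplies the missing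
  edges that this needs. The bound of 21 edges matters for one configuration with ten vertices only, whose
  edge set it determines completely.

  The drawings are topological. Straightening the arcs near their ends makes every vertex on the boundary
  of a face accessible from that face.
\<close>

subsection \<open>Drawings and their straightening\<close>

text \<open>The obstacle is that both sides of the triangle \<open>X\<close> may be occupied, so
  that \<open>v\<close> fits on neither. When \<open>z\<close> in \<open>X\<close> and
  \<open>b\<close> in \<open>S\<close> are deleted instead, the other vertex \<open>a\<close> of
  \<open>S\<close> has to be drawn, and nothing is known about its edges. It is therefore treated as
  joined to everything: apart from \<open>v\<close>, the graph to be drawn is the complete graph on
  two vertices of \<open>X\<close>, \<open>a\<close> and \<open>W\<close>, minus edges known to be
  absent from \<open>G\<close>. If \<open>W\<close> has four vertices, there are seven vertices and
  21 possible edges, while a planar graph on seven vertices has at most 15, so at least six absent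
  edges in the right position must be found. They come from pairs in different components of
  \<open>W\<close>, from the exclusion of K33 and K5, and from comparing \<open>a\<close> with a
  vertex \<open>u\<close> of \<open>X\<close>: if \<open>u\<close> sees all that \<open>a\<close>
  sees in \<open>W\<close>, then \<open>a\<close> can take the place of \<open>u\<close> in the
  drawing of \<open>G' - S\<close>. Of Kuratowski's theorem only the easy direction occurs: K33 is
  excluded by means of the Jordan curve theorem and Janiszewski's theorem, and K5 is reduced to
  K33.\<close>

definition drawn :: "'a graph \<Rightarrow> ('a \<Rightarrow> complex) \<Rightarrow> ('a set \<Rightarrow> real \<Rightarrow> complex) \<Rightarrow> complex set" where
  "drawn G p \<gamma> = p ` verts G \<union> (\<Union>e \<in> edges G. path_image (\<gamma> e))"

definition add_vertex :: "'a graph \<Rightarrow> 'a \<Rightarrow> 'a set \<Rightarrow> 'a graph" where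
  "add_vertex G v N =
     \<lparr> verts = insert v (verts G), edges = edges G \<union> (\<lambda>u. {v, u}) ` N \<rparr>"

lemma fsg_edge:
  assumes "finite_simple_graph G" "e \<in> edges G"
  shows "e \<subseteq> verts G" "card e = 2" "finite e"
proof -
  show "e \<subseteq> verts G" and c: "card e = 2"
    using assms by (auto simp: finite_simple_graph_def)
  show "finite e"
    using c by (metis card.infinite zero_neq_numeral)
qed

lemma fsg_edge_obtain:
  assumes "finite_simple_graph G" "e \<in> edges G" "u \<in> e"
  obtains w where "e = {u, w}" "w \<noteq> u" "w \<in> verts G"
  using fsg_edge[OF assms(1,2)] assms(3) by (auto simp: card_2_iff)

lemma fsg_pair:
  assumes "finite_simple_graph G" "{u, w} \<in> edges G"
  shows "u \<noteq> w" "u \<in> verts G" "w \<in> verts G"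
  using fsg_edge[OF assms] by auto

lemma fsg_finite_edges:
  assumes "finite_simple_graph G"
  shows "finite (edges G)"
proof (rule finite_subset)
  show "edges G \<subseteq> Pow (verts G)"
    using fsg_edge(1)[OF assms] by blast
  show "finite (Pow (verts G))"
    using assms by (simp add: finite_simple_graph_def)
qed

lemma drawing_edge:
  assumes "plane_drawing G p \<gamma>" "e \<in> edges G"
  shows "arc (\<gamma> e)" "{pathstart (\<gamma> e), pathfinish (\<gamma> e)} = p ` e"
    "path_image (\<gamma> e) \<inter> p ` verts G = p ` e"
  using assms by (auto simp: plane_drawing_def)

lemma drawing_edges_Int:
  assumes "plane_drawing G p \<gamma>" "e \<in> edges G" "f \<in> edges G" "e \<noteq> f"
  shows "path_image (\<gamma> e) \<inter> path_image (\<gamma> f) = p ` (e \<inter> f)"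
  using assms by (auto simp: plane_drawing_def)

lemma drawing_ends_in:
  assumes "plane_drawing G p \<gamma>" "e \<in> edges G" "u \<in> e"
  shows "p u \<in> path_image (\<gamma> e)"
  using drawing_edge(3)[OF assms(1,2)] assms(3) by blast

lemma compact_drawn:
  assumes "finite_simple_graph G" "plane_drawing G p \<gamma>"
  shows "compact (drawn G p \<gamma>)"
  unfolding drawn_def
  using assms fsg_finite_edges[OF assms(1)] drawing_edge(1)[OF assms(2)]
  by (intro compact_Un compact_UN finite_imp_compact compact_arc_image)
     (auto simp: finite_simple_graph_def)

lemma Int_eq_restrict: "A \<inter> C = E \<Longrightarrow> E \<subseteq> B \<Longrightarrow> B \<subseteq> C \<Longrightarrow> A \<inter> B = E"
  by blast

lemma planar_subgraph:
  assumes "planar H" "finite_simple_graph G" "verts G \<subseteq> verts H" "edges G \<subseteq> edges H"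
  shows "planar G"
proof -
  obtain p \<gamma> where d: "plane_drawing H p \<gamma>"
    using assms(1) by (auto simp: planar_def)
  have "path_image (\<gamma> e) \<inter> p ` verts G = p ` e" if "e \<in> edges G" for e
  proof -
    have "path_image (\<gamma> e) \<inter> p ` verts H = p ` e"
      using drawing_edge(3)[OF d] that assms(4) by (meson subsetD)
    moreover have "p ` e \<subseteq> p ` verts G"
      using fsg_edge(1)[OF assms(2) that] by (rule image_mono)
    moreover have "p ` verts G \<subseteq> p ` verts H"
      using assms(3) by (rule image_mono)
    ultimately show ?thesis by (rule Int_eq_restrict)
  qed
  moreover have "inj_on p (verts G)"
    using d assms(3) inj_on_subset unfolding plane_drawing_def by metis
  moreover have "e \<in> edges H" if "e \<in> edges G" for e
    using assms(4) that by (rule subsetD)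
  ultimately have "plane_drawing G p \<gamma>"
    using d unfolding plane_drawing_def by simp
  then show ?thesis
    by (auto simp: planar_def)
qed

lemma fsg_add_vertex:
  assumes "finite_simple_graph G" "v \<notin> verts G" "N \<subseteq> verts G"
  shows "finite_simple_graph (add_vertex G v N)"
proof -
  have "e \<subseteq> insert v (verts G) \<and> card e = 2" if "e \<in> edges G \<union> (\<lambda>u. {v, u}) ` N" for e
    using that
  proof
    assume "e \<in> edges G"
    then show ?thesis using fsg_edge[OF assms(1)] by blast
  next
    assume "e \<in> (\<lambda>u. {v, u}) ` N"
    then obtain u where "u \<in> N" "e = {v, u}" by blast
    moreover have "v \<noteq> u" using \<open>u \<in> N\<close> assms by blast
    ultimately show ?thesis using assms(3) by auto
  qed
  moreover have "finite (verts G)" using assms by (simp add: finite_simple_graph_def)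
  ultimately show ?thesis
    unfolding finite_simple_graph_def add_vertex_def by auto
qed

text \<open>The bookkeeping behind every later placement of a vertex: \<open>q\<close> is the point
  for \<open>v\<close>, and \<open>g u\<close> is the arc from it to the neighbour
  \<open>u\<close>.\<close>

lemma planar_add_vertex_arcs:
  assumes fsg: "finite_simple_graph G" and d: "plane_drawing G p \<gamma>"
    and v: "v \<notin> verts G" and N: "N \<subseteq> verts G" and q: "q \<notin> drawn G p \<gamma>"
    and g: "\<And>u. u \<in> N \<Longrightarrow> arc (g u) \<and> pathstart (g u) = q \<and> pathfinish (g u) = p u \<and>
              path_image (g u) \<inter> drawn G p \<gamma> \<subseteq> {p u}"
    and gg: "\<And>u w. \<lbrakk>u \<in> N; w \<in> N; u \<noteq> w\<rbrakk> \<Longrightarrow> path_image (g u) \<inter> path_image (g w) \<subseteq> {q}"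
  shows "planar (add_vertex G v N)"
proof -
  define p' where "p' = p(v := q)"
  \<comment> \<open>Arcs are indexed by edges, which are sets, so \<open>THE\<close> recovers the
    end of a new edge other than \<open>v\<close>.\<close>
  define \<gamma>' where "\<gamma>' e = (if v \<in> e then g (THE u. u \<in> e \<and> u \<noteq> v) else \<gamma> e)" for e
  have old: "v \<notin> e" "e \<subseteq> verts G" if "e \<in> edges G" for e
    using fsg_edge(1)[OF fsg that] v by auto
  have p'V: "p' u = p u" if "u \<in> verts G" for u
    using that v by (auto simp: p'_def)
  have p'e: "p' ` e = p ` e" if "e \<in> edges G" for e
    using old[OF that] p'V by (intro image_cong) auto
  have p'v: "p' v = q"
    by (simp add: p'_def)
  have p'im: "p' ` verts G = p ` verts G"
    using p'V by (intro image_cong) auto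
  have \<gamma>'old: "\<gamma>' e = \<gamma> e" if "e \<in> edges G" for e
    using old[OF that] by (simp add: \<gamma>'_def)
  have \<gamma>'new: "\<gamma>' {v, u} = g u" if "u \<in> N" for u
  proof -
    have "u \<noteq> v" using that N v by auto
    then have "(THE w. w \<in> {v, u} \<and> w \<noteq> v) = u" by (intro the_equality) auto
    then show ?thesis by (simp add: \<gamma>'_def)
  qed
  have q': "q \<notin> p ` verts G" "\<And>e. e \<in> edges G \<Longrightarrow> q \<notin> path_image (\<gamma> e)"
    using q by (auto simp: drawn_def)
  have gends: "q \<in> path_image (g u)" "p u \<in> path_image (g u)" if "u \<in> N" for u
    using g[OF that] pathstart_in_path_image pathfinish_in_path_image by metis+
  have gV: "path_image (g u) \<inter> p ` verts G = {p u}" if "u \<in> N" for u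
    using g[OF that] gends[OF that] that N by (auto simp: drawn_def)
  have gE: "path_image (g u) \<inter> path_image (\<gamma> e) = p ` ({v,u} \<inter> e)" if "u \<in> N" "e \<in> edges G" for u e
  proof -
    have "path_image (g u) \<inter> path_image (\<gamma> e) \<subseteq> {p u}"
      using g[OF that(1)] that by (auto simp: drawn_def)
    moreover have "p u \<in> path_image (\<gamma> e) \<longleftrightarrow> u \<in> e"
    proof
      assume "p u \<in> path_image (\<gamma> e)"
      then have "p u \<in> p ` e" using drawing_edge(3)[OF d that(2)] that N by blast
      moreover have "inj_on p (verts G)" using d by (auto simp: plane_drawing_def)
      ultimately show "u \<in> e" using that N old(2)[OF that(2)] by (meson inj_on_image_mem_iff subsetD)
    qed (use drawing_ends_in[OF d that(2)] in auto)
    ultimately show ?thesis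
      using gends[OF that(1)] old(1)[OF that(2)] by auto
  qed
  have "plane_drawing (add_vertex G v N) p' \<gamma>'"
    unfolding plane_drawing_def
  proof (intro conjI ballI impI)
    have "inj_on p (verts G)" using d by (auto simp: plane_drawing_def)
    then have "inj_on p' (verts G)" using p'V by (simp add: inj_on_def)
    then show "inj_on p' (verts (add_vertex G v N))"
      using q' p'v v p'im by (auto simp: add_vertex_def)
  next
    fix e assume e: "e \<in> edges (add_vertex G v N)"
    consider "e \<in> edges G" | u where "u \<in> N" "e = {v, u}"
      using e by (auto simp: add_vertex_def)
    then have "arc (\<gamma>' e) \<and> {pathstart (\<gamma>' e), pathfinish (\<gamma>' e)} = p' ` e \<and>
       path_image (\<gamma>' e) \<inter> p' ` verts (add_vertex G v N) = p' ` e"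
    proof cases
      case 1
      then show ?thesis
        using drawing_edge[OF d 1] q'(2)[OF 1] by (simp add: \<gamma>'old p'e add_vertex_def p'im p'v)
    next
      case 2
      then show ?thesis
        using g[OF 2(1)] gV[OF 2(1)] gends[OF 2(1)] N p'V[of u]
        by (auto simp: \<gamma>'new p'v add_vertex_def p'im)
    qed
    then show "arc (\<gamma>' e)" "{pathstart (\<gamma>' e), pathfinish (\<gamma>' e)} = p' ` e"
       "path_image (\<gamma>' e) \<inter> p' ` verts (add_vertex G v N) = p' ` e" by auto
  next
    fix e f assume e: "e \<in> edges (add_vertex G v N)" and f: "f \<in> edges (add_vertex G v N)" and ne: "e \<noteq> f"
    have old_Int: "p' ` (e \<inter> f) = p ` (e \<inter> f)" if "e \<in> edges G \<or> f \<in> edges G"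
      using that old p'V by (intro image_cong) auto
    consider "e \<in> edges G" "f \<in> edges G" | u where "u \<in> N" "e = {v, u}" "f \<in> edges G"
      | u where "u \<in> N" "f = {v, u}" "e \<in> edges G"
      | u w where "u \<in> N" "w \<in> N" "e = {v,u}" "f = {v,w}"
      using e f by (auto simp: add_vertex_def)
    then show "path_image (\<gamma>' e) \<inter> path_image (\<gamma>' f) = p' ` (e \<inter> f)"
    proof cases
      case 1
      then show ?thesis using drawing_edges_Int[OF d 1 ne] old_Int by (simp add: \<gamma>'old)
    next
      case 2
      then show ?thesis using gE[OF 2(1,3)] old_Int by (simp add: \<gamma>'old \<gamma>'new)
    next
      case 3
      then show ?thesis using gE[OF 3(1,3)] old_Int by (simp add: \<gamma>'old \<gamma>'new Int_commute)
    next
      case 4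
      then have "u \<noteq> w" using ne by auto
      moreover have "e \<inter> f = {v}" using 4 \<open>u \<noteq> w\<close> N v by auto
      ultimately show ?thesis
        using 4 gg[OF 4(1,2)] gends[OF 4(1)] gends[OF 4(2)] by (auto simp: \<gamma>'new p'v)
    qed
  qed
  then show ?thesis by (auto simp: planar_def)
qed

text \<open>Only an inclusion is required, so that the property survives when arcs are shortened.\<close>

definition straight_at :: "complex set \<Rightarrow> complex \<Rightarrow> bool" where
  "straight_at K c \<longleftrightarrow> (\<exists>r>0. \<exists>Q. finite Q \<and> K \<inter> ball c r \<subseteq> (\<Union>q\<in>Q. closed_segment c q))"

text \<open>The arc is followed until it first reaches the disc and is continued along the radius
  from that point \<open>s\<close>. Everything after the first entry, including later excursions, is
  dropped.\<close>

lemma straighten_arc: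
  fixes h :: "real \<Rightarrow> complex"
  assumes "arc h" "pathfinish h = c" "pathstart h \<notin> cball c r" "r > 0"
  obtains h' s where "s \<in> path_image h" "s \<in> sphere c r" "arc h'" "pathstart h' = pathstart h"
    "pathfinish h' = c" "path_image h' \<subseteq> (path_image h - cball c r) \<union> closed_segment s c"
proof -
  obtain u where u: "0 \<le> u" "u \<le> 1" "\<And>x. 0 \<le> x \<and> x < u \<Longrightarrow> h x \<in> interior (- cball c r)"
     "h u \<notin> interior (- cball c r)" "u = 0 \<or> h u \<in> closure (- cball c r)"
  proof (rule subpath_to_frontier_explicit[of h "- cball c r"])
    show "path h" using assms by (simp add: arc_imp_path)
    show "pathfinish h \<notin> - cball c r" using assms by auto
  qed blast
  have int: "interior (- cball c r) = - cball c r" by (metis closed_cball interior_open open_Compl)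
  have u0: "u \<noteq> 0" using u(4) assms by (auto simp: int pathstart_def)
  then have "h u \<in> closure (- cball c r)" using u(5) by auto
  then have "h u \<notin> ball c r"
    using assms(4) by (simp add: closure_complement interior_cball)
  then have sph: "h u \<in> sphere c r" using u(4) by (auto simp: int)
  have ne: "h u \<noteq> c" using sph assms(4) by auto
  define h' where "h' = subpath 0 u h +++ linepath (h u) c"
  have sub: "path_image (subpath 0 u h) \<subseteq> insert (h u) (path_image h - cball c r)"
  proof
    fix w assume "w \<in> path_image (subpath 0 u h)"
    then obtain x where x: "0 \<le> x" "x \<le> u" "w = h x"
      using u(1) by (auto simp: path_image_subpath)
    then show "w \<in> insert (h u) (path_image h - cball c r)"
      using u(3)[of x] u(2) int by (cases "x = u") (auto simp: path_image_def)
  qed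
  have seg: "closed_segment (h u) c \<subseteq> cball c r"
    using sph by (intro closed_segment_subset) (auto simp: assms less_imp_le)
  show ?thesis
  proof
    show "h u \<in> path_image h" using u by (auto simp: path_image_def)
    show "h u \<in> sphere c r" by fact
    show "arc h'" unfolding h'_def
    proof (rule arc_join)
      show "arc (subpath 0 u h)" using assms u u0 by (intro arc_subpath_arc) auto
      show "arc (linepath (h u) c)" using ne by simp
      show "pathfinish (subpath 0 u h) = pathstart (linepath (h u) c)" by simp
      show "path_image (subpath 0 u h) \<inter> path_image (linepath (h u) c) \<subseteq> {pathstart (linepath (h u) c)}"
        using sub seg by auto
    qed
    show "pathstart h' = pathstart h" by (simp add: h'_def pathstart_def subpath_def joinpaths_def)
    show "pathfinish h' = c" by (simp add: h'_def)
    have "path_image h' \<subseteq> path_image (subpath 0 u h) \<union> closed_segment (h u) c"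
      unfolding h'_def using path_image_join_subset by fastforce
    then show "path_image h' \<subseteq> (path_image h - cball c r) \<union> closed_segment (h u) c"
      using sub by auto
  qed
qed

lemma closed_segments_sphere_Int:
  fixes c :: complex
  assumes "s \<in> sphere c r" "t \<in> sphere c r" "s \<noteq> t" "r > 0"
  shows "closed_segment s c \<inter> closed_segment t c \<subseteq> {c}"
proof
  fix w assume "w \<in> closed_segment s c \<inter> closed_segment t c"
  then obtain a b where ab: "0 \<le> a" "w = c + a *\<^sub>R (s - c)" "0 \<le> b" "w = c + b *\<^sub>R (t - c)"
    by (fastforce simp: in_segment closed_segment_commute[of _ c] algebra_simps)
  have "norm (s - c) = r" "norm (t - c) = r"
    using assms by (auto simp: dist_norm norm_minus_commute)
  moreover have "norm (a *\<^sub>R (s - c)) = norm (b *\<^sub>R (t - c))" using ab by auto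
  ultimately have "a * r = b * r" using ab by simp
  then have "a = b" using assms by simp
  then have "a *\<^sub>R (s - c) = a *\<^sub>R (t - c)" using ab by (metis add_left_cancel)
  then have "a *\<^sub>R (s - t) = 0" by (simp add: scaleR_diff_right)
  then show "w \<in> {c}" using assms(3) ab by (metis add.right_neutral right_minus_eq scaleR_eq_0_iff scaleR_zero_left singletonI)
qed

text \<open>The disc around \<open>p u\<close> is so small that it meets no other vertex and no edge
  that avoids \<open>u\<close>. The edges at \<open>u\<close> enter it at distinct points, because
  they share \<open>p u\<close> only, so the radii that replace them are disjoint up to the centre.
  Outside the disc the drawing only shrinks, which preserves straightness at the other
  vertices.\<close>

lemma straighten_at_vertex:
  assumes fsg: "finite_simple_graph G" and d: "plane_drawing G p \<gamma>" and u: "u \<in> verts G"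
  obtains \<gamma>' where "plane_drawing G p \<gamma>'" "straight_at (drawn G p \<gamma>') (p u)"
    "\<And>w. \<lbrakk>w \<in> verts G; w \<noteq> u; straight_at (drawn G p \<gamma>) (p w)\<rbrakk> \<Longrightarrow> straight_at (drawn G p \<gamma>') (p w)"
proof -
  define K0 where "K0 = p ` (verts G - {u}) \<union> (\<Union>e \<in> {e \<in> edges G. u \<notin> e}. path_image (\<gamma> e))"
  have fin: "finite (verts G)" "finite (edges G)"
    using fsg fsg_finite_edges by (auto simp: finite_simple_graph_def)
  have inj: "inj_on p (verts G)" using d by (auto simp: plane_drawing_def)
  have pe: "p x \<in> path_image (\<gamma> e) \<longleftrightarrow> x \<in> e" if "e \<in> edges G" "x \<in> verts G" for e x
    using drawing_edge(3)[OF d that(1)] that fsg_edge(1)[OF fsg that(1)] inj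
    by (metis IntD1 IntI drawing_ends_in[OF d] imageI inj_on_image_mem_iff)
  have "closed K0" unfolding K0_def
    using fin drawing_edge(1)[OF d]
    by (intro closed_Un closed_UN ballI) (auto intro: finite_imp_closed closed_arc_image)
  moreover have "p u \<notin> K0" unfolding K0_def using inj u pe by (auto simp: inj_on_def)
  ultimately obtain r where r: "r > 0" "cball (p u) r \<inter> K0 = {}"
    by (meson ComplI disjoint_eq_subset_Compl open_Compl open_contains_cball)
  define P where "P e h' s \<longleftrightarrow> s \<in> path_image (\<gamma> e) \<and> s \<in> sphere (p u) r \<and> arc h' \<and>
     {pathstart h', pathfinish h'} = p ` e \<and>
     path_image h' \<subseteq> (path_image (\<gamma> e) - cball (p u) r) \<union> closed_segment s (p u)" for e h' s
  have "\<exists>h' s. P e h' s" if e: "e \<in> edges G" "u \<in> e" for e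
  proof -
    obtain w where w: "e = {u, w}" "w \<noteq> u" "w \<in> verts G"
      using fsg_edge_obtain[OF fsg e] .
    obtain h where h: "arc h" "path_image h = path_image (\<gamma> e)" "pathfinish h = p u" "pathstart h = p w"
    proof (cases "pathfinish (\<gamma> e) = p u")
      case True
      then show ?thesis using that[of "\<gamma> e"] drawing_edge[OF d e(1)] w u inj
        by (metis (no_types) doubleton_eq_iff image_empty image_insert)
    next
      case False
      then have "pathstart (\<gamma> e) = p u" "pathfinish (\<gamma> e) = p w"
        using drawing_edge(2)[OF d e(1)] w by (auto simp: doubleton_eq_iff)
      then show ?thesis using that[of "reversepath (\<gamma> e)"] drawing_edge[OF d e(1)]
        by (simp add: arc_reversepath)
    qed
    have "pathstart h \<notin> cball (p u) r"
      using r(2) w h by (auto simp: K0_def)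
    from straighten_arc[OF h(1,3) this r(1)] obtain h' s where
      "s \<in> path_image h" "s \<in> sphere (p u) r" "arc h'" "pathstart h' = pathstart h"
      "pathfinish h' = p u" "path_image h' \<subseteq> (path_image h - cball (p u) r) \<union> closed_segment s (p u)" .
    then have "P e h' s" using h w by (auto simp: P_def)
    then show ?thesis by blast
  qed
  then obtain h s where "\<And>e. \<lbrakk>e \<in> edges G; u \<in> e\<rbrakk> \<Longrightarrow> P e (h e) (s e)"
    by metis
  then have hs: "s e \<in> path_image (\<gamma> e) \<and> s e \<in> sphere (p u) r \<and>
     arc (h e) \<and> {pathstart (h e), pathfinish (h e)} = p ` e \<and>
     path_image (h e) \<subseteq> (path_image (\<gamma> e) - cball (p u) r) \<union> closed_segment (s e) (p u)"
    if "e \<in> edges G" "u \<in> e" for e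
    using that unfolding P_def by blast
  define \<gamma>' where "\<gamma>' e = (if u \<in> e then h e else \<gamma> e)" for e
  have seg: "closed_segment (s e) (p u) \<subseteq> cball (p u) r" if "e \<in> edges G" "u \<in> e" for e
    using hs[OF that] r by (intro closed_segment_subset) auto
  have hends: "p ` e \<subseteq> path_image (h e)" if "e \<in> edges G" "u \<in> e" for e
    using hs[OF that] pathstart_in_path_image pathfinish_in_path_image by (metis empty_subsetI insert_subset)
  have pV: "p ` verts G \<subseteq> insert (p u) K0" by (auto simp: K0_def)
  have cb: "p u \<in> cball (p u) r" using r by simp
  have mixed: "path_image (h e) \<inter> path_image (\<gamma> f) = p ` (e \<inter> f)"
    if "e \<in> edges G" "u \<in> e" "f \<in> edges G" "u \<notin> f" for e f
  proof
    have "path_image (\<gamma> f) \<inter> cball (p u) r = {}" using r(2) that by (auto simp: K0_def)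
    then show "path_image (h e) \<inter> path_image (\<gamma> f) \<subseteq> p ` (e \<inter> f)"
      using hs[OF that(1,2)] seg[OF that(1,2)] drawing_edges_Int[OF d that(1,3)] that by blast
    show "p ` (e \<inter> f) \<subseteq> path_image (h e) \<inter> path_image (\<gamma> f)"
      using hends[OF that(1,2)] drawing_ends_in[OF d that(3)] by auto
  qed
  have d': "plane_drawing G p \<gamma>'"
    unfolding plane_drawing_def
  proof (intro conjI ballI impI inj)
    fix e assume e: "e \<in> edges G"
    show "arc (\<gamma>' e)" "{pathstart (\<gamma>' e), pathfinish (\<gamma>' e)} = p ` e"
      using hs[OF e] drawing_edge[OF d e] by (auto simp: \<gamma>'_def)
    show "path_image (\<gamma>' e) \<inter> p ` verts G = p ` e"
    proof (cases "u \<in> e")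
      case True
      have "path_image (h e) \<inter> p ` verts G \<subseteq> p ` e"
      proof
        fix w assume w: "w \<in> path_image (h e) \<inter> p ` verts G"
        show "w \<in> p ` e"
        proof (cases "w \<in> cball (p u) r")
          case True
          then have "w = p u" using w pV r(2) by blast
          then show ?thesis using \<open>u \<in> e\<close> by simp
        next
          case False
          then show ?thesis using w hs[OF e \<open>u \<in> e\<close>] seg[OF e \<open>u \<in> e\<close>] drawing_edge(3)[OF d e] by blast
        qed
      qed
      then show ?thesis using True hends[OF e True] fsg_edge(1)[OF fsg e] by (auto simp: \<gamma>'_def)
    qed (use drawing_edge(3)[OF d e] in \<open>simp add: \<gamma>'_def\<close>)
  next
    fix e f assume e: "e \<in> edges G" and f: "f \<in> edges G" and ne: "e \<noteq> f"
    consider "u \<in> e" "u \<in> f" | "u \<in> e" "u \<notin> f" | "u \<notin> e" "u \<in> f" | "u \<notin> e" "u \<notin> f" by blast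
    then show "path_image (\<gamma>' e) \<inter> path_image (\<gamma>' f) = p ` (e \<inter> f)"
    proof cases
      case 1
      have ef: "e \<inter> f = {u}"
      proof -
        obtain x y where "e = {u, x}" "f = {u, y}"
          using fsg_edge_obtain[OF fsg e 1(1)] fsg_edge_obtain[OF fsg f 1(2)] by metis
        then show ?thesis using ne by auto
      qed
      then have I: "path_image (\<gamma> e) \<inter> path_image (\<gamma> f) = {p u}"
        using drawing_edges_Int[OF d e f ne] by simp
      note he = hs[OF e 1(1)] and hf = hs[OF f 1(2)]
      have sph: "s e \<in> sphere (p u) r" "s f \<in> sphere (p u) r" using he hf by blast+
      have "s e \<noteq> s f"
      proof
        assume "s e = s f"
        then have "s e \<in> path_image (\<gamma> e) \<inter> path_image (\<gamma> f)" using he hf by (metis IntI)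
        then have "s e = p u" unfolding I by simp
        then show False using sph r(1) by simp
      qed
      then have "closed_segment (s e) (p u) \<inter> closed_segment (s f) (p u) \<subseteq> {p u}"
        using closed_segments_sphere_Int[OF sph _ r(1)] by blast
      moreover have "path_image (h e) \<subseteq> (path_image (\<gamma> e) - cball (p u) r) \<union> closed_segment (s e) (p u)"
        "path_image (h f) \<subseteq> (path_image (\<gamma> f) - cball (p u) r) \<union> closed_segment (s f) (p u)"
        using he hf by blast+
      moreover note seg[OF e 1(1)] seg[OF f 1(2)] I cb
      ultimately have "path_image (h e) \<inter> path_image (h f) \<subseteq> {p u}"
        by blast
      then show ?thesis using hends[OF e 1(1)] hends[OF f 1(2)] 1 ef by (auto simp: \<gamma>'_def)
    next
      case 2
      then show ?thesis using mixed[OF e _ f] by (simp add: \<gamma>'_def)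
    next
      case 3
      then show ?thesis using mixed[OF f _ e] by (simp add: \<gamma>'_def Int_commute)
    next
      case 4
      then show ?thesis using drawing_edges_Int[OF d e f ne] by (simp add: \<gamma>'_def)
    qed
  qed
  have sub: "drawn G p \<gamma>' \<subseteq> (drawn G p \<gamma> - cball (p u) r) \<union> insert (p u) (\<Union>e \<in> {e \<in> edges G. u \<in> e}. closed_segment (s e) (p u))"
  proof
    fix w assume "w \<in> drawn G p \<gamma>'"
    then consider "w \<in> p ` verts G" | e where "e \<in> edges G" "w \<in> path_image (\<gamma>' e)"
      by (auto simp: drawn_def)
    then show "w \<in> (drawn G p \<gamma> - cball (p u) r) \<union> insert (p u) (\<Union>e \<in> {e \<in> edges G. u \<in> e}. closed_segment (s e) (p u))"
    proof cases
      case 1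
      then have "w \<in> drawn G p \<gamma>" by (simp add: drawn_def)
      moreover have "w = p u \<or> w \<notin> cball (p u) r" using 1 pV r(2) by blast
      ultimately show ?thesis by blast
    next
      case 2
      show ?thesis
      proof (cases "u \<in> e")
        case True
        then have "w \<in> (path_image (\<gamma> e) - cball (p u) r) \<union> closed_segment (s e) (p u)"
          using 2 hs[OF 2(1) True] by (simp add: \<gamma>'_def subset_iff)
        then show ?thesis using 2(1) True by (auto simp: drawn_def)
      next
        case False
        then have "w \<in> path_image (\<gamma> e)" "w \<in> K0" using 2 by (auto simp: \<gamma>'_def K0_def)
        then show ?thesis using 2(1) r(2) by (auto simp: drawn_def)
      qed
    qed
  qed
  have su: "straight_at (drawn G p \<gamma>') (p u)"
    unfolding straight_at_def
  proof (intro exI conjI)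
    show "r > 0" by fact
    show "finite (insert (p u) (s ` {e \<in> edges G. u \<in> e}))" using fin by auto
    show "drawn G p \<gamma>' \<inter> ball (p u) r \<subseteq> (\<Union>q\<in>insert (p u) (s ` {e \<in> edges G. u \<in> e}). closed_segment (p u) q)"
      using sub by (auto simp: closed_segment_commute[of "p u"])
  qed
  have "straight_at (drawn G p \<gamma>') (p w)"
    if w: "w \<in> verts G" "w \<noteq> u" "straight_at (drawn G p \<gamma>) (p w)" for w
  proof -
    obtain r' Q where r': "r' > 0" "finite Q" "drawn G p \<gamma> \<inter> ball (p w) r' \<subseteq> (\<Union>q\<in>Q. closed_segment (p w) q)"
      using w(3) by (auto simp: straight_at_def)
    \<comment> \<open>All new points lie in the closed disc around \<open>p u\<close>; a ball around
      \<open>p w\<close> that avoids this disc sees only old ones.\<close>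
    have "p w \<in> - cball (p u) r" using w r(2) by (auto simp: K0_def)
    then obtain r2 where r2: "r2 > 0" "ball (p w) r2 \<subseteq> - cball (p u) r"
      by (meson closed_cball open_Compl open_contains_ball)
    have "insert (p u) (\<Union>e \<in> {e \<in> edges G. u \<in> e}. closed_segment (s e) (p u)) \<subseteq> cball (p u) r"
      using seg cb by blast
    moreover have "ball (p w) (min r' r2) \<subseteq> ball (p w) r'" "ball (p w) (min r' r2) \<subseteq> ball (p w) r2"
      by auto
    ultimately have "drawn G p \<gamma>' \<inter> ball (p w) (min r' r2) \<subseteq> drawn G p \<gamma> \<inter> ball (p w) r'"
      using sub r2(2) by blast
    then have "drawn G p \<gamma>' \<inter> ball (p w) (min r' r2) \<subseteq> (\<Union>q\<in>Q. closed_segment (p w) q)"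
      using r'(3) by (rule order_trans)
    then show ?thesis unfolding straight_at_def
      using r' r2 by (intro exI[of _ "min r' r2"] conjI exI[of _ Q]) auto
  qed
  then show ?thesis using that[OF d' su] by blast
qed

lemma straight_drawing:
  assumes fsg: "finite_simple_graph G" and "planar G"
  obtains p \<gamma> where "plane_drawing G p \<gamma>" "\<And>u. u \<in> verts G \<Longrightarrow> straight_at (drawn G p \<gamma>) (p u)"
proof -
  obtain p \<gamma>0 where d0: "plane_drawing G p \<gamma>0" using assms by (auto simp: planar_def)
  have "\<exists>\<gamma>. plane_drawing G p \<gamma> \<and> (\<forall>u\<in>U. straight_at (drawn G p \<gamma>) (p u))" if "finite U" "U \<subseteq> verts G" for U
    using that
  proof (induction U)
    case empty
    then show ?case using d0 by auto
  next
    case (insert u U)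
    then obtain \<gamma> where \<gamma>: "plane_drawing G p \<gamma>" "\<forall>u\<in>U. straight_at (drawn G p \<gamma>) (p u)" by auto
    obtain \<gamma>' where "plane_drawing G p \<gamma>'" "straight_at (drawn G p \<gamma>') (p u)"
      "\<And>w. \<lbrakk>w \<in> verts G; w \<noteq> u; straight_at (drawn G p \<gamma>) (p w)\<rbrakk> \<Longrightarrow> straight_at (drawn G p \<gamma>') (p w)"
      using straighten_at_vertex[OF fsg \<gamma>(1), of u] insert by auto
    then show ?case using \<gamma> insert by (intro exI[of _ \<gamma>']) auto
  qed
  from this[of "verts G"] show ?thesis using that fsg by (auto simp: finite_simple_graph_def)
qed

subsection \<open>Placing a new vertex in a face\<close>

text \<open>Near \<open>c\<close> the set \<open>K\<close> lies on finitely many lines through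
  \<open>c\<close>. They are negligible, so the open set \<open>U\<close> contains a point
  \<open>q\<close> near \<open>c\<close> off all of them, and the segment from \<open>c\<close> to
  \<open>q\<close> meets each line in \<open>c\<close> only.\<close>

lemma straight_access:
  fixes c :: complex
  assumes "straight_at K c" "open U" "c \<in> closure U"
  obtains q where "q \<in> U" "q \<noteq> c" "(closed_segment c q - {c}) \<inter> K = {}"
proof -
  obtain r Q where r: "r > 0" "finite Q" "K \<inter> ball c r \<subseteq> (\<Union>q\<in>Q. closed_segment c q)"
    using assms(1) by (auto simp: straight_at_def)
  \<comment> \<open>The line through \<open>c\<close> and \<open>q\<close>, given by its normal, a
    quarter turn of \<open>q - c\<close>.\<close>
  define H where "H q = {z. (\<i> * (q - c)) \<bullet> z = (\<i> * (q - c)) \<bullet> c}" for q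
  have "negligible (\<Union>(H ` (Q - {c})))"
  proof (rule negligible_Union)
    show "finite (H ` (Q - {c}))" using r(2) by simp
    show "negligible T" if "T \<in> H ` (Q - {c})" for T
      using that by (auto simp: H_def intro!: negligible_hyperplane)
  qed
  moreover have "open (U \<inter> ball c r - {c})"
    using assms(2) by (intro open_Diff open_Int) auto
  moreover have "U \<inter> ball c r - {c} \<noteq> {}"
  proof
    assume e: "U \<inter> ball c r - {c} = {}"
    have "U \<inter> ball c r \<noteq> {}"
      using assms(3) r(1) unfolding closure_approachable by (metis IntI dist_commute empty_iff mem_ball)
    then have "U \<inter> ball c r = {c}" using e by blast
    moreover have "open (U \<inter> ball c r)" using assms(2) by (intro open_Int) auto
    ultimately show False by (metis not_open_singleton)
  qed
  ultimately have "\<not> U \<inter> ball c r - {c} \<subseteq> (\<Union>(H ` (Q - {c})))"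
    using open_not_negligible negligible_subset by blast
  then obtain q where q: "q \<in> U" "q \<in> ball c r" "q \<noteq> c" "\<And>t. t \<in> Q \<Longrightarrow> t \<noteq> c \<Longrightarrow> q \<notin> H t"
    by blast
  have "(closed_segment c q - {c}) \<inter> K = {}"
  proof (rule ccontr)
    assume "(closed_segment c q - {c}) \<inter> K \<noteq> {}"
    then obtain w where w: "w \<in> closed_segment c q" "w \<noteq> c" "w \<in> K" by blast
    have "closed_segment c q \<subseteq> ball c r"
      using q(2) r(1) by (intro closed_segment_subset) auto
    then obtain t where t: "t \<in> Q" "w \<in> closed_segment c t" using w r(3) by blast
    then have tc: "t \<noteq> c" using w(2) by auto
    obtain a where a: "w = c + a *\<^sub>R (q - c)"
      using w(1) by (auto simp: in_segment algebra_simps)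
    obtain b where b: "w = c + b *\<^sub>R (t - c)"
      using t(2) by (auto simp: in_segment algebra_simps)
    have "a \<noteq> 0" using a w(2) by auto
    have "a *\<^sub>R (q - c) = b *\<^sub>R (t - c)" using a b by (metis add_left_cancel)
    then have "a * ((\<i> * (t - c)) \<bullet> (q - c)) = b * ((\<i> * (t - c)) \<bullet> (t - c))"
      by (metis inner_scaleR_right)
    also have "(\<i> * (t - c)) \<bullet> (t - c) = 0" by (simp add: inner_complex_def algebra_simps)
    finally have "(\<i> * (t - c)) \<bullet> (q - c) = 0" using \<open>a \<noteq> 0\<close> by simp
    then have "q \<in> H t" by (simp add: H_def inner_diff_right)
    then show False using q(4) t(1) tc by blast
  qed
  then show ?thesis using that q by blast
qed

text \<open>Both pieces are oriented away from \<open>q\<close>, because \<open>q\<close> becomes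
  the centre of a star.\<close>

lemma arc_split:
  fixes \<alpha> :: "real \<Rightarrow> complex"
  assumes "arc \<alpha>" "q \<in> path_image \<alpha>" "q \<noteq> pathstart \<alpha>" "q \<noteq> pathfinish \<alpha>"
  obtains \<alpha>1 \<alpha>2 where "arc \<alpha>1" "arc \<alpha>2" "pathstart \<alpha>1 = q" "pathstart \<alpha>2 = q"
    "pathfinish \<alpha>1 = pathstart \<alpha>" "pathfinish \<alpha>2 = pathfinish \<alpha>"
    "path_image \<alpha>1 \<union> path_image \<alpha>2 = path_image \<alpha>" "path_image \<alpha>1 \<inter> path_image \<alpha>2 = {q}"
    "pathfinish \<alpha> \<notin> path_image \<alpha>1" "pathstart \<alpha> \<notin> path_image \<alpha>2"
proof -
  obtain t where t: "0 \<le> t" "t \<le> 1" "q = \<alpha> t" using assms by (auto simp: path_image_def)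
  have t': "t \<noteq> 0" "t \<noteq> 1" using assms t by (auto simp: pathstart_def pathfinish_def)
  have inj: "inj_on \<alpha> {0..1}" using assms by (simp add: arc_def)
  have im1: "path_image (subpath t 0 \<alpha>) = \<alpha> ` {0..t}"
    using t by (simp add: path_image_subpath)
  have im2: "path_image (subpath t 1 \<alpha>) = \<alpha> ` {t..1}"
    using t by (simp add: path_image_subpath)
  show ?thesis
  proof
    show "arc (subpath t 0 \<alpha>)" "arc (subpath t 1 \<alpha>)"
      using t t' assms by (auto intro!: arc_subpath_arc)
    show "pathstart (subpath t 0 \<alpha>) = q" "pathstart (subpath t 1 \<alpha>) = q"
      "pathfinish (subpath t 0 \<alpha>) = pathstart \<alpha>" "pathfinish (subpath t 1 \<alpha>) = pathfinish \<alpha>"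
      using t by (auto simp: pathstart_def pathfinish_def subpath_def)
    have "{0..t} \<union> {t..1} = {0..1}" "{0..t} \<inter> {t..1} = {t}" "{0..t} \<subseteq> {0..1}" "{t..1} \<subseteq> {0..1}"
      using t by auto
    then show "path_image (subpath t 0 \<alpha>) \<union> path_image (subpath t 1 \<alpha>) = path_image \<alpha>"
      "path_image (subpath t 0 \<alpha>) \<inter> path_image (subpath t 1 \<alpha>) = {q}"
      unfolding im1 im2
      by (auto simp: path_image_def image_Un[symmetric] inj_on_image_Int[OF inj, symmetric] t(3))
    show "pathfinish \<alpha> \<notin> path_image (subpath t 0 \<alpha>)"
    proof
      assume "pathfinish \<alpha> \<in> path_image (subpath t 0 \<alpha>)"
      then obtain x where "x \<in> {0..t}" "\<alpha> 1 = \<alpha> x" unfolding im1 pathfinish_def by blast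
      then show False using inj_onD[OF inj, of 1 x] t t' by auto
    qed
    show "pathstart \<alpha> \<notin> path_image (subpath t 1 \<alpha>)"
    proof
      assume "pathstart \<alpha> \<in> path_image (subpath t 1 \<alpha>)"
      then obtain x where "x \<in> {t..1}" "\<alpha> 0 = \<alpha> x" unfolding im2 pathstart_def by blast
      then show False using inj_onD[OF inj, of 0 x] t t' by auto
    qed
  qed
qed

text \<open>Injectivity makes the preimage of \<open>E\<close> consist of ends of the unit interval,
  so what remains is the image of an interval.\<close>

lemma connected_arc_minus_ends:
  fixes g :: "real \<Rightarrow> complex"
  assumes "arc g" "E \<subseteq> {pathstart g, pathfinish g}"
  shows "connected (path_image g - E)"
proof -
  have inj: "inj_on g {0..1}" and cont: "continuous_on {0..1} g"
    using assms by (auto simp: arc_def path_def)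
  have ends: "g t \<in> E \<longleftrightarrow> (t = 0 \<and> g 0 \<in> E) \<or> (t = 1 \<and> g 1 \<in> E)" if "t \<in> {0..1}" for t
    using assms(2) inj_onD[OF inj, of t 0] inj_onD[OF inj, of t 1] that
    by (auto simp: pathstart_def pathfinish_def)
  define J where "J = {0..1} - {t. g t \<in> E}"
  have "path_image g - E = g ` J"
    by (auto simp: path_image_def J_def)
  moreover have "is_interval J"
    unfolding is_interval_1
  proof (intro ballI allI impI)
    fix a b x assume "a \<in> J" "b \<in> J" and x: "a \<le> x \<and> x \<le> b"
    then have ab: "a \<in> {0..1}" "b \<in> {0..1}" "g a \<notin> E" "g b \<notin> E" by (auto simp: J_def)
    then have "x \<in> {0..1}" using x by auto
    moreover have "g x \<notin> E"
      using ends[OF \<open>x \<in> {0..1}\<close>] ab x by (metis atLeastAtMost_iff order_antisym)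
    ultimately show "x \<in> J" by (simp add: J_def)
  qed
  moreover have "continuous_on J g" using cont by (rule continuous_on_subset) (auto simp: J_def)
  ultimately show ?thesis by (simp add: connected_continuous_image is_interval_connected_1)
qed

text \<open>The segment starts at \<open>c\<close>, avoids \<open>K\<close> after that and ends in
  the component \<open>F\<close>; connectedness keeps it there.\<close>

lemma straight_face_segment:
  fixes c :: complex
  assumes "straight_at K c" "closed K" "F \<in> components (- K)" "c \<in> closure F"
  obtains q where "q \<in> F" "closed_segment c q - {c} \<subseteq> F"
proof -
  have oF: "open F" using assms by (meson open_Compl open_components)
  obtain q where q: "q \<in> F" "q \<noteq> c" "(closed_segment c q - {c}) \<inter> K = {}"
    using straight_access[OF assms(1) oF assms(4)] .
  have "connected (closed_segment c q - {c})"
    using connected_arc_minus_ends[of "linepath c q" "{c}"] q(2) by simp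
  moreover have "(closed_segment c q - {c}) \<inter> F \<noteq> {}"
    using q by auto
  ultimately have "closed_segment c q - {c} \<subseteq> F"
    using components_maximal[OF assms(3)] q(3) by (metis disjoint_eq_subset_Compl inf_commute)
  then show ?thesis using that q by blast
qed

text \<open>A boundary point of a component of the complement of an arbitrary closed set need not be
  the end of a path inside the component. Straightness at \<open>c\<close> supplies such a
  path.\<close>

lemma straight_face_path_connected:
  fixes c :: complex
  assumes "straight_at K c" "closed K" "F \<in> components (- K)" "c \<in> closure F"
  shows "path_connected (insert c F)"
proof -
  obtain q where q: "q \<in> F" "closed_segment c q - {c} \<subseteq> F"
    using straight_face_segment[OF assms] .
  have "path_connected F"
    using assms by (meson in_components_connected open_Compl open_components connected_open_path_connected)
  then have "path_connected (F \<union> closed_segment c q)"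
    using q by (intro path_connected_Un) auto
  moreover have "F \<union> closed_segment c q = insert c F" using q by auto
  ultimately show ?thesis by simp
qed

text \<open>Two of the points are joined by an arc \<open>\<alpha>\<close> inside the face. If they
  are the only ones, the midpoint of \<open>\<alpha>\<close> is the centre. A third point is joined
  to that midpoint by an arc \<open>\<beta>\<close>, and the centre is the point where
  \<open>\<beta>\<close> first meets \<open>\<alpha>\<close>.\<close>

lemma face_star:
  fixes p :: "'a \<Rightarrow> complex"
  assumes K: "closed K" "F \<in> components (- K)"
    and N: "N \<noteq> {}" "finite N" "card N \<le> 3" "inj_on p N" "p ` N \<subseteq> K"
    and s: "\<And>u. u \<in> N \<Longrightarrow> straight_at K (p u)" and cl: "\<And>u. u \<in> N \<Longrightarrow> p u \<in> closure F"
  obtains q g where "q \<in> F"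
    "\<And>u. u \<in> N \<Longrightarrow> arc (g u) \<and> pathstart (g u) = q \<and> pathfinish (g u) = p u \<and> path_image (g u) \<subseteq> insert (p u) F"
    "\<And>u w. \<lbrakk>u \<in> N; w \<in> N; u \<noteq> w\<rbrakk> \<Longrightarrow> path_image (g u) \<inter> path_image (g w) \<subseteq> {q}"
proof -
  note star = that
  have FK: "F \<inter> K = {}" using in_components_subset[OF K(2)] by blast
  obtain m where m: "m \<in> F" using in_components_nonempty[OF K(2)] by blast
  have pc: "path_connected (insert (p u) F)" if "u \<in> N" for u
    using straight_face_path_connected[OF s[OF that] K cl[OF that]] .
  have pF: "p u \<notin> F" if "u \<in> N" for u using that N(5) FK by blast
  have arcs: "\<exists>h. arc h \<and> path_image h \<subseteq> S \<and> pathstart h = a \<and> pathfinish h = b"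
    if "path_connected S" "a \<in> S" "b \<in> S" "a \<noteq> b" for S and a b :: complex
    using that unfolding path_connected_arcwise by blast
  \<comment> \<open>This covers two and three points at once: \<open>u3\<close> may be outside
    \<open>N\<close> or equal to one of the others.\<close>
  have two: thesis if u: "u1 \<in> N" "u2 \<in> N" "u1 \<noteq> u2" and N': "N \<subseteq> {u1, u2, u3}" for u1 u2 u3
  proof -
    have ne: "p u1 \<noteq> p u2" using N(4) u by (auto simp: inj_on_def)
    have "path_connected (insert (p u1) F \<union> insert (p u2) F)"
      using pc u m by (intro path_connected_Un) auto
    then obtain \<alpha> where \<alpha>: "arc \<alpha>" "path_image \<alpha> \<subseteq> insert (p u1) F \<union> insert (p u2) F"
      "pathstart \<alpha> = p u1" "pathfinish \<alpha> = p u2"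
      using arcs[of "insert (p u1) F \<union> insert (p u2) F" "p u1" "p u2"] ne by auto
    have "inj_on \<alpha> {0..1}" using \<alpha>(1) by (simp add: arc_def)
    then have mid: "\<alpha> (1/2) \<in> path_image \<alpha>" "\<alpha> (1/2) \<noteq> p u1" "\<alpha> (1/2) \<noteq> p u2"
      using inj_onD[of \<alpha> "{0..1}" "1/2" 0] inj_onD[of \<alpha> "{0..1}" "1/2" 1] \<alpha>(3,4)
      by (auto simp: path_image_def pathstart_def pathfinish_def)
    have split: "\<exists>\<alpha>1 \<alpha>2. arc \<alpha>1 \<and> arc \<alpha>2 \<and> pathstart \<alpha>1 = q \<and> pathstart \<alpha>2 = q \<and>
      pathfinish \<alpha>1 = p u1 \<and> pathfinish \<alpha>2 = p u2 \<and> path_image \<alpha>1 \<subseteq> path_image \<alpha> \<and> path_image \<alpha>2 \<subseteq> path_image \<alpha> \<and>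
      path_image \<alpha>1 \<subseteq> insert (p u1) F \<and> path_image \<alpha>2 \<subseteq> insert (p u2) F \<and> path_image \<alpha>1 \<inter> path_image \<alpha>2 \<subseteq> {q}"
      if q: "q \<in> path_image \<alpha>" "q \<noteq> p u1" "q \<noteq> p u2" for q
    proof -
      obtain \<alpha>1 \<alpha>2 where *: "arc \<alpha>1" "arc \<alpha>2" "pathstart \<alpha>1 = q" "pathstart \<alpha>2 = q"
        "pathfinish \<alpha>1 = p u1" "pathfinish \<alpha>2 = p u2"
        "path_image \<alpha>1 \<union> path_image \<alpha>2 = path_image \<alpha>" "path_image \<alpha>1 \<inter> path_image \<alpha>2 = {q}"
        "p u2 \<notin> path_image \<alpha>1" "p u1 \<notin> path_image \<alpha>2"
        using arc_split[OF \<alpha>(1) q(1)] q(2,3) \<alpha>(3,4) by metis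
      have "path_image \<alpha>1 \<subseteq> insert (p u1) F" "path_image \<alpha>2 \<subseteq> insert (p u2) F"
        using *(7,9,10) \<alpha>(2) by blast+
      then show ?thesis using * by blast
    qed
    show thesis
    proof (cases "u3 \<in> N \<and> u3 \<noteq> u1 \<and> u3 \<noteq> u2")
      case False
      then have N2: "N = {u1, u2}" using N' u by blast
      obtain \<alpha>1 \<alpha>2 where *: "arc \<alpha>1" "arc \<alpha>2" "pathstart \<alpha>1 = \<alpha> (1/2)" "pathstart \<alpha>2 = \<alpha> (1/2)"
        "pathfinish \<alpha>1 = p u1" "pathfinish \<alpha>2 = p u2"
        "path_image \<alpha>1 \<subseteq> insert (p u1) F" "path_image \<alpha>2 \<subseteq> insert (p u2) F"
        "path_image \<alpha>1 \<inter> path_image \<alpha>2 \<subseteq> {\<alpha> (1/2)}"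
        using split[OF mid] by blast
      show thesis
      proof (rule star[of "\<alpha> (1/2)" "\<lambda>u. if u = u1 then \<alpha>1 else \<alpha>2"])
        show "\<alpha> (1/2) \<in> F" using mid \<alpha>(2) by auto
      qed (use * N2 u in \<open>auto\<close>)
    next
      case True
      then have N3: "N = {u1, u2, u3}" using N' u by blast
      have ne3: "p u3 \<noteq> p u1" "p u3 \<noteq> p u2" using N(4) u True by (auto simp: inj_on_def)
      then have p3: "p u3 \<notin> path_image \<alpha>" using \<alpha>(2) pF[of u3] True by auto
      have midF: "\<alpha> (1/2) \<in> F" using mid \<alpha>(2) by auto
      have "p u3 \<noteq> \<alpha> (1/2)" using midF pF[of u3] True by auto
      then obtain \<beta> where \<beta>: "arc \<beta>" "path_image \<beta> \<subseteq> insert (p u3) F" "pathstart \<beta> = p u3" "pathfinish \<beta> = \<alpha> (1/2)"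
        using arcs[OF pc[of u3], of "p u3" "\<alpha> (1/2)"] True midF by blast
      have op: "open (- path_image \<alpha>)" using \<alpha>(1) closed_arc_image by blast
      \<comment> \<open>The first parameter at which \<open>\<beta>\<close> meets
        \<open>\<alpha>\<close>.\<close>
      obtain t where t: "0 \<le> t" "t \<le> 1" "\<And>x. 0 \<le> x \<and> x < t \<Longrightarrow> \<beta> x \<in> interior (- path_image \<alpha>)"
         "\<beta> t \<notin> interior (- path_image \<alpha>)"
        using subpath_to_frontier_explicit[of \<beta> "- path_image \<alpha>"] \<beta> mid(1) arc_imp_path by (metis ComplD)
      have tin: "\<beta> t \<in> path_image \<alpha>" using t(4) op by (simp add: interior_open)
      have t0: "t \<noteq> 0" using tin p3 \<beta>(3) by (auto simp: pathstart_def)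
      have "\<beta> t \<in> path_image \<beta>" using t(1,2) by (auto simp: path_image_def)
      then have "\<beta> t \<in> insert (p u3) F" using \<beta>(2) by blast
      then have tF: "\<beta> t \<in> F" using tin p3 by auto
      have tne: "\<beta> t \<noteq> p u1" "\<beta> t \<noteq> p u2" using tF pF u by auto
      obtain \<alpha>1 \<alpha>2 where *: "arc \<alpha>1" "arc \<alpha>2" "pathstart \<alpha>1 = \<beta> t" "pathstart \<alpha>2 = \<beta> t"
        "pathfinish \<alpha>1 = p u1" "pathfinish \<alpha>2 = p u2"
        "path_image \<alpha>1 \<subseteq> path_image \<alpha>" "path_image \<alpha>2 \<subseteq> path_image \<alpha>"
        "path_image \<alpha>1 \<subseteq> insert (p u1) F" "path_image \<alpha>2 \<subseteq> insert (p u2) F"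
        "path_image \<alpha>1 \<inter> path_image \<alpha>2 \<subseteq> {\<beta> t}"
        using split[OF tin tne] by blast
      define \<beta>' where "\<beta>' = subpath t 0 \<beta>"
      have b1: "arc \<beta>'" "pathstart \<beta>' = \<beta> t" "pathfinish \<beta>' = p u3"
        using \<beta>(1) \<beta>(3)[unfolded pathstart_def] t(1,2) t0 unfolding \<beta>'_def
        by (auto intro: arc_subpath_arc)
      have b2: "path_image \<beta>' \<subseteq> insert (p u3) F"
        using \<beta>(2) t(1,2) path_image_subpath_subset[of t 0 \<beta>] unfolding \<beta>'_def by auto
      have b3: "path_image \<beta>' \<inter> path_image \<alpha> \<subseteq> {\<beta> t}"
      proof
        fix w assume w: "w \<in> path_image \<beta>' \<inter> path_image \<alpha>"
        then obtain x where x: "0 \<le> x" "x \<le> t" "w = \<beta> x"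
          using t(1) t0 unfolding \<beta>'_def by (auto simp: path_image_subpath)
        have "\<not> x < t"
        proof
          assume "x < t"
          then have "\<beta> x \<in> - path_image \<alpha>" using t(3)[of x] x(1) interior_subset by blast
          then show False using w x(3) by simp
        qed
        then show "w \<in> {\<beta> t}" using x by simp
      qed
      have b4: "path_image \<beta>' \<inter> path_image \<alpha>1 \<subseteq> {\<beta> t}" "path_image \<beta>' \<inter> path_image \<alpha>2 \<subseteq> {\<beta> t}"
        using b3 * by blast+
      show thesis
      proof (rule star[of "\<beta> t" "\<lambda>u. if u = u1 then \<alpha>1 else if u = u2 then \<alpha>2 else \<beta>'"])
        show "\<beta> t \<in> F" by fact
        let ?g = "\<lambda>u. if u = u1 then \<alpha>1 else if u = u2 then \<alpha>2 else \<beta>'"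
        have g: "?g u1 = \<alpha>1" "?g u2 = \<alpha>2" "?g u3 = \<beta>'" using u True by auto
        show "arc (?g w) \<and> pathstart (?g w) = \<beta> t \<and> pathfinish (?g w) = p w \<and> path_image (?g w) \<subseteq> insert (p w) F"
          if "w \<in> N" for w
        proof -
          consider "w = u1" | "w = u2" | "w = u3" using \<open>w \<in> N\<close> N3 by blast
          then show ?thesis
          proof cases
            case 1
            show ?thesis unfolding 1 g(1) by (intro conjI *)
          next
            case 2
            show ?thesis unfolding 2 g(2) by (intro conjI *)
          next
            case 3
            show ?thesis unfolding 3 g(3) by (intro conjI b1 b2)
          qed
        qed
        show "path_image (?g w) \<inter> path_image (?g w') \<subseteq> {\<beta> t}" if w: "w \<in> N" "w' \<in> N" "w \<noteq> w'" for w w'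
        proof -
          have D: "path_image (?g w) \<inter> path_image (?g w') \<subseteq> {\<beta> t}"
            if ww: "(w, w') \<in> {(u1, u2), (u3, u1), (u3, u2)}" for w w'
          proof -
            consider "w = u1" "w' = u2" | "w = u3" "w' = u1" | "w = u3" "w' = u2" using ww by blast
            then show ?thesis
            proof cases
              case 1
              show ?thesis unfolding 1 g by (rule *)
            next
              case 2
              show ?thesis unfolding 2 g by (rule b4)
            next
              case 3
              show ?thesis unfolding 3 g by (rule b4)
            qed
          qed
          have "(w, w') \<in> {(u1, u2), (u3, u1), (u3, u2)} \<or> (w', w) \<in> {(u1, u2), (u3, u1), (u3, u2)}"
            using w unfolding N3 by auto
          then show ?thesis using D[of w w'] D[of w' w] by (metis Int_commute)
        qed
      qed
    qed
  qed
  obtain u1 where u1: "u1 \<in> N" using N by blast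
  show thesis
  proof (cases "N = {u1}")
    case True
    obtain \<alpha> where \<alpha>: "arc \<alpha>" "path_image \<alpha> \<subseteq> insert (p u1) F" "pathstart \<alpha> = m" "pathfinish \<alpha> = p u1"
      using arcs[OF pc[OF u1], of m "p u1"] m pF[OF u1] by auto
    show thesis by (rule star[of m "\<lambda>_. \<alpha>"]) (use \<alpha> True m in auto)
  next
    case False
    then obtain u2 where u2: "u2 \<in> N" "u2 \<noteq> u1" using u1 by blast
    have "card (N - {u1, u2}) \<le> 1"
      using N(2,3) u1 u2 by (simp add: card_Diff_insert card_Diff_subset)
    then obtain u3 where "N - {u1, u2} \<subseteq> {u3}"
      using N(2) by (metis card_le_Suc0_iff_eq One_nat_def finite_Diff insertI1 subsetI singleton_iff)
    then show thesis using two[OF u1 u2(1) u2(2)[symmetric], of u3] by blast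
  qed
qed

text \<open>\<open>F\<close> can be any connected set off the drawing, such as a segment or a side
  of a curve; it is enlarged to the face that contains it.\<close>

lemma planar_add_vertex_face:
  assumes fsg: "finite_simple_graph G" and d: "plane_drawing G p \<gamma>"
    and st: "\<And>u. u \<in> verts G \<Longrightarrow> straight_at (drawn G p \<gamma>) (p u)"
    and v: "v \<notin> verts G" and N: "N \<subseteq> verts G" "N \<noteq> {}" "card N \<le> 3"
    and F: "connected F" "F \<noteq> {}" "F \<inter> drawn G p \<gamma> = {}" and cl: "\<And>u. u \<in> N \<Longrightarrow> p u \<in> closure F"
  shows "planar (add_vertex G v N)"
proof -
  have "finite N" using fsg N(1) finite_subset by (auto simp: finite_simple_graph_def)
  have cK: "closed (drawn G p \<gamma>)" using compact_drawn[OF fsg d] compact_imp_closed by blast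
  obtain F' where F': "F' \<in> components (- drawn G p \<gamma>)" "F \<subseteq> F'"
    using exists_component_superset[of F "- drawn G p \<gamma>"] F by (metis Compl_empty_eq F(3) closed_UNIV compact_drawn[OF fsg d] disjoint_eq_subset_Compl double_complement inf_top_left subset_empty)
  have FK: "F' \<inter> drawn G p \<gamma> = {}" using in_components_subset[OF F'(1)] by blast
  have inj: "inj_on p N" using d N(1) inj_on_subset by (auto simp: plane_drawing_def)
  have pN: "p ` N \<subseteq> drawn G p \<gamma>" using N(1) by (auto simp: drawn_def)
  have s1: "straight_at (drawn G p \<gamma>) (p u)" if "u \<in> N" for u using st that N(1) by auto
  have s2: "p u \<in> closure F'" if "u \<in> N" for u using cl[OF that] closure_mono[OF F'(2)] by blast
  obtain q g where qg: "q \<in> F'"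
    "\<And>u. u \<in> N \<Longrightarrow> arc (g u) \<and> pathstart (g u) = q \<and> pathfinish (g u) = p u \<and> path_image (g u) \<subseteq> insert (p u) F'"
    "\<And>u w. \<lbrakk>u \<in> N; w \<in> N; u \<noteq> w\<rbrakk> \<Longrightarrow> path_image (g u) \<inter> path_image (g w) \<subseteq> {q}"
    by (rule face_star[OF cK F'(1) N(2) \<open>finite N\<close> N(3) inj pN s1 s2]) blast+
  show ?thesis
  proof (rule planar_add_vertex_arcs[OF fsg d v N(1)])
    show "q \<notin> drawn G p \<gamma>" using qg(1) FK by blast
    show "arc (g u) \<and> pathstart (g u) = q \<and> pathfinish (g u) = p u \<and> path_image (g u) \<inter> drawn G p \<gamma> \<subseteq> {p u}"
      if "u \<in> N" for u using qg(2)[OF that] FK by blast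
  qed (rule qg(3))
qed

subsection \<open>Pendant vertices, parallel paths and empty triangles\<close>

lemma oriented_arc:
  assumes "finite_simple_graph G" "plane_drawing G p \<gamma>" "{a, b} \<in> edges G"
  obtains h where "arc h" "pathstart h = p a" "pathfinish h = p b" "path_image h = path_image (\<gamma> {a, b})"
proof (cases "pathstart (\<gamma> {a, b}) = p a \<and> pathfinish (\<gamma> {a, b}) = p b")
  case True
  then show ?thesis using that drawing_edge(1)[OF assms(2,3)] by blast
next
  case False
  then have "pathstart (\<gamma> {a, b}) = p b" "pathfinish (\<gamma> {a, b}) = p a"
    using drawing_edge(2)[OF assms(2,3)] by (auto simp: doubleton_eq_iff)
  then show ?thesis
    using that[of "reversepath (\<gamma> {a, b})"] drawing_edge(1)[OF assms(2,3)] by (simp add: arc_reversepath)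
qed

text \<open>
  If the end of the arc were not in the closure of \<open>F\<close>, then neither would be a short initial piece of the arc.
  By Janiszewski's theorem \<open>K\<close> and the rest of the arc do not separate \<open>F\<close> from that piece, so \<open>F\<close> reaches it.
\<close>

lemma face_closure_end:
  fixes h :: "real \<Rightarrow> complex"
  assumes K: "compact K" and h: "arc h" and Kh: "path_image h \<inter> K = {pathstart h, pathfinish h}"
    and F: "F \<in> components (- (K \<union> path_image h))" and q: "q \<in> F"
    and m: "m \<in> path_image h" "m \<notin> K" and qm: "connected_component (- K) q m"
  shows "pathstart h \<in> closure F"
proof (rule ccontr)
  assume "pathstart h \<notin> closure F"
  then obtain \<epsilon> where e: "\<epsilon> > 0" "ball (pathstart h) \<epsilon> \<subseteq> - closure F"
    by (meson ComplI closed_closure open_Compl open_contains_ball)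
  have inj: "inj_on h {0..1}" and cont: "continuous_on {0..1} h"
    using h by (auto simp: arc_def path_def)
  obtain d where d: "d > 0" "\<And>t. t \<in> {0..1} \<Longrightarrow> dist t 0 < d \<Longrightarrow> dist (h t) (h 0) < \<epsilon>"
    using cont e(1) unfolding continuous_on_iff by (metis atLeastAtMost_iff order_refl zero_le_one)
  define s where "s = min (d/2) (1/2)"
  have s: "0 < s" "s < 1" "s < d" using d(1) by (auto simp: s_def)
  have near: "h t \<in> ball (pathstart h) \<epsilon>" if "0 \<le> t" "t \<le> s" for t
    using d(2)[of t] that s by (auto simp: pathstart_def dist_commute)
  define B where "B = h ` {s..1}"
  have arcB: "arc (subpath s 1 h)" using h s by (intro arc_subpath_arc) auto
  have imB: "path_image (subpath s 1 h) = B" using s by (simp add: path_image_subpath B_def)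
  have hB: "h t \<notin> B" if "0 \<le> t" "t < s" for t
    using inj_onD[OF inj, of t] that s unfolding B_def by fastforce
  have Bsub: "B \<subseteq> path_image h" using s by (auto simp: B_def path_image_def)
  have Fsub: "F \<inter> (K \<union> path_image h) = {}" using in_components_subset[OF F] by blast
  \<comment> \<open>The point \<open>h (s/2)\<close> stands for the short initial piece;
    \<open>B\<close> is the rest of the arc.\<close>
  have r: "h (s/2) \<in> path_image h" "h (s/2) \<notin> B" using s hB by (auto simp: path_image_def)
  have rends: "h (s/2) \<noteq> pathstart h" "h (s/2) \<noteq> pathfinish h"
    using inj_onD[OF inj, of "s/2"] s by (force simp: pathstart_def pathfinish_def)+
  have "connected (path_image h - {pathstart h, pathfinish h})"
    using connected_arc_minus_ends[OF h] by blast
  moreover have "path_image h - {pathstart h, pathfinish h} \<subseteq> - K" using Kh by blast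
  moreover have "m \<in> path_image h - {pathstart h, pathfinish h}" using m Kh by blast
  ultimately have "connected_component (- K) m (h (s/2))"
    unfolding connected_component_def using r rends by blast
  then have 1: "connected_component (- K) q (h (s/2))"
    using qm connected_component_trans by blast
  have "connected (- B)" using connected_arc_complement[OF arcB] imB by simp
  moreover have "q \<in> - B" using q Fsub Bsub by blast
  ultimately have 2: "connected_component (- B) q (h (s/2))"
    using r unfolding connected_component_def by blast
  have "pathstart h \<notin> B" using hB[of 0] s by (simp add: pathstart_def)
  moreover have "pathfinish h \<in> B" using s by (auto simp: B_def pathfinish_def)
  moreover have "pathfinish h \<in> K" "K \<inter> B \<subseteq> {pathstart h, pathfinish h}" using Kh Bsub by blast+
  \<comment> \<open>Janiszewski's theorem asks for a connected intersection; here it is the single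
    far end of the arc.\<close>
  ultimately have "K \<inter> B = {pathfinish h}" by auto
  then have "connected_component (- (K \<union> B)) q (h (s/2))"
    using arcB imB closed_arc_image by (intro Janiszewski K 1 2) auto
  then obtain Q where Q: "connected Q" "Q \<subseteq> - (K \<union> B)" "q \<in> Q" "h (s/2) \<in> Q"
    unfolding connected_component_def by blast
  have "h (s/2) \<notin> F" using r Fsub by blast
  \<comment> \<open>Since \<open>Q\<close> leaves \<open>F\<close>, it meets the frontier of
    \<open>F\<close>, which lies in \<open>K\<close> and the arc. As \<open>Q\<close> avoids
    \<open>K\<close> and \<open>B\<close>, the meeting point is on the initial piece, which the
    choice of \<open>\<epsilon>\<close> keeps away from the closure of \<open>F\<close>.\<close>
  then have "Q \<inter> frontier F \<noteq> {}" using Q q by (intro connected_Int_frontier) auto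
  then obtain w where w: "w \<in> Q" "w \<in> frontier F" by blast
  have "closed (K \<union> path_image h)" using K h closed_arc_image compact_imp_closed by blast
  then have "frontier F \<subseteq> K \<union> path_image h"
    using F frontier_of_components_closed_complement by blast
  then have "w \<in> path_image h" using w Q(2) by blast
  then obtain t where t: "0 \<le> t" "t \<le> 1" "w = h t" by (auto simp: path_image_def)
  have "\<not> s \<le> t" using t w(1) Q(2) by (auto simp: B_def)
  then have "w \<in> ball (pathstart h) \<epsilon>" using near t by auto
  then show False using e(2) w(2) by (auto simp: frontier_def)
qed

text \<open>The inverse \<open>k\<close> of the arc would embed the disc into the line. Of three
  points of the disc one has the middle value; without that point the disc stays connected, but its
  image does not. So there are points off an edge next to each of its points.\<close>

lemma arc_image_no_ball:
  fixes h :: "real \<Rightarrow> complex"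
  assumes "arc h" "\<delta> > 0"
  shows "\<not> ball m \<delta> \<subseteq> path_image h"
proof
  assume sub: "ball m \<delta> \<subseteq> path_image h"
  obtain k where k: "homeomorphism {0..1} (path_image h) h k"
    using homeomorphism_arc[OF assms(1)] .
  have kc: "continuous_on (path_image h) k" and hk: "\<And>w. w \<in> path_image h \<Longrightarrow> h (k w) = w"
    using k by (auto simp: homeomorphism_def)
  have "is_interval (k ` ball m \<delta>)"
    using connected_continuous_image[OF continuous_on_subset[OF kc sub] connected_ball]
    by (simp add: is_interval_connected_1)
  have inj: "inj_on k (ball m \<delta>)" using hk sub by (metis inj_onI subsetD)
  define a where "a = k (m - of_real (\<delta>/2))"
  define b where "b = k m"
  define c where "c = k (m + of_real (\<delta>/2))"
  have in3: "m - of_real (\<delta>/2) \<in> ball m \<delta>" "m \<in> ball m \<delta>" "m + of_real (\<delta>/2) \<in> ball m \<delta>"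
    using assms(2) by (auto simp: dist_norm)
  have ne: "a \<noteq> b" "b \<noteq> c" "a \<noteq> c"
    using inj_onD[OF inj _ in3(1,2)] inj_onD[OF inj _ in3(2,3)] inj_onD[OF inj _ in3(1,3)] assms(2)
    unfolding a_def b_def c_def by auto
  have step: False if w: "u \<in> ball m \<delta>" "v \<in> ball m \<delta>" "w \<in> ball m \<delta>" "k u < k v" "k v < k w" for u v w
  proof -
    have uv: "u \<noteq> v" "w \<noteq> v" using w by auto
    have "connected (ball m \<delta> - {v})"
      by (intro connected_open_delete) auto
    then have "connected (k ` (ball m \<delta> - {v}))"
      using connected_continuous_image continuous_on_subset[OF kc] sub by (metis Diff_subset order_trans)
    then have "is_interval (k ` (ball m \<delta> - {v}))" by (simp add: is_interval_connected_1)
    moreover have "k u \<in> k ` (ball m \<delta> - {v})" "k w \<in> k ` (ball m \<delta> - {v})" using w uv by auto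
    ultimately have "k v \<in> k ` (ball m \<delta> - {v})"
      using w(4,5) unfolding is_interval_1 by (meson less_imp_le)
    then show False using inj w(2) by (auto simp: inj_on_def)
  qed
  show False
    using step[OF in3(1,2,3)] step[OF in3(1,3,2)] step[OF in3(2,1,3)] step[OF in3(2,3,1)] step[OF in3(3,1,2)]
      step[OF in3(3,2,1)] ne
    unfolding a_def b_def c_def by linarith
qed

text \<open>A segment that leaves \<open>p u\<close> and avoids the drawing determines a face with
  \<open>p u\<close> on its boundary.\<close>

lemma planar_add_pendant:
  assumes fsg: "finite_simple_graph G" and "planar G" and u: "u \<in> verts G" and v: "v \<notin> verts G"
  shows "planar (add_vertex G v {u})"
proof -
  obtain p \<gamma> where d: "plane_drawing G p \<gamma>" and st: "\<And>u. u \<in> verts G \<Longrightarrow> straight_at (drawn G p \<gamma>) (p u)"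
    using straight_drawing[OF fsg assms(2)] by blast
  obtain q where q: "q \<noteq> p u" "(closed_segment (p u) q - {p u}) \<inter> drawn G p \<gamma> = {}"
    using straight_access[OF st[OF u], of UNIV] by auto
  show ?thesis
  proof (rule planar_add_vertex_face[OF fsg d st v])
    show "connected (closed_segment (p u) q - {p u})"
      using connected_arc_minus_ends[of "linepath (p u) q" "{p u}"] q(1) by simp
    show "closed_segment (p u) q - {p u} \<noteq> {}" using q(1) by auto
    have "open_segment (p u) q \<subseteq> closed_segment (p u) q - {p u}" by (auto simp: open_segment_def)
    then have "closure (open_segment (p u) q) \<subseteq> closure (closed_segment (p u) q - {p u})" by (rule closure_mono)
    then show "p w \<in> closure (closed_segment (p u) q - {p u})" if "w \<in> {u}" for w
      using that q(1) by auto
  qed (use u q in auto)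
qed

text \<open>A face that runs along the edge has both ends of the edge on its boundary. This is
  \<open>face_closure_end\<close> for the arc and for its reverse.\<close>

lemma planar_add_parallel:
  assumes fsg: "finite_simple_graph G" and "planar G" and xy: "{x, y} \<in> edges G" and v: "v \<notin> verts G"
  shows "planar (add_vertex G v {x, y})"
proof -
  obtain p \<gamma> where d: "plane_drawing G p \<gamma>" and st: "\<And>u. u \<in> verts G \<Longrightarrow> straight_at (drawn G p \<gamma>) (p u)"
    using straight_drawing[OF fsg assms(2)] by blast
  have xyV: "x \<noteq> y" "x \<in> verts G" "y \<in> verts G" using fsg_pair[OF fsg xy] by auto
  obtain h where h: "arc h" "pathstart h = p x" "pathfinish h = p y" "path_image h = path_image (\<gamma> {x, y})"
    using oriented_arc[OF fsg d xy] .
  define K where "K = p ` verts G \<union> (\<Union>e \<in> edges G - {{x, y}}. path_image (\<gamma> e))"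
  have KE: "drawn G p \<gamma> = K \<union> path_image h" using xy by (auto simp: drawn_def K_def h(4))
  have cK: "compact K" unfolding K_def
    using fsg fsg_finite_edges[OF fsg] drawing_edge(1)[OF d]
    by (intro compact_Un compact_UN finite_imp_compact compact_arc_image) (auto simp: finite_simple_graph_def)
  have hV: "path_image h \<inter> p ` verts G = {p x, p y}" using drawing_edge(3)[OF d xy] h(4) by simp
  have hE: "path_image h \<inter> path_image (\<gamma> e) \<subseteq> {p x, p y}" if "e \<in> edges G - {{x, y}}" for e
    using drawing_edges_Int[OF d xy, of e] that h(4) by auto
  have hK: "path_image h \<inter> K = {pathstart h, pathfinish h}"
    using hV hE unfolding K_def h(2,3) by blast
  have pxy: "p x \<noteq> p y" using h(1-3) arc_distinct_ends by metis
  have "inj_on h {0..1}" using h(1) by (simp add: arc_def)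
  then have "h (1/2) \<noteq> pathstart h" "h (1/2) \<noteq> pathfinish h"
    using inj_onD[of h "{0..1}" "1/2" 0] inj_onD[of h "{0..1}" "1/2" 1]
    by (auto simp: pathstart_def pathfinish_def)
  moreover have "h (1/2) \<in> path_image h" by (auto simp: path_image_def)
  ultimately have m: "h (1/2) \<in> path_image h" "h (1/2) \<notin> K" using hK by blast+
  obtain \<delta> where del: "\<delta> > 0" "ball (h (1/2)) \<delta> \<subseteq> - K"
    using m(2) cK by (meson ComplI compact_imp_closed open_Compl open_contains_ball)
  \<comment> \<open>A point beside the midpoint of the edge; the disc joins it to the midpoint
    without touching the rest of the drawing.\<close>
  obtain q where q: "q \<in> ball (h (1/2)) \<delta>" "q \<notin> path_image h"
    using arc_image_no_ball[OF h(1) del(1)] by blast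
  have qm: "connected_component (- K) q (h (1/2))"
    unfolding connected_component_def using q(1) del by (intro exI[of _ "ball (h (1/2)) \<delta>"]) auto
  have qK: "q \<in> - (K \<union> path_image h)" using q del(2) by blast
  define F where "F = connected_component_set (- (K \<union> path_image h)) q"
  have F: "F \<in> components (- (K \<union> path_image h))" "q \<in> F"
    using qK by (auto simp: F_def components_def)
  have "p x \<in> closure F" using face_closure_end[OF cK h(1) hK F m qm] h(2) by simp
  moreover have "p y \<in> closure F"
    using face_closure_end[of K "reversepath h" F q "h (1/2)"] cK h hK F m qm
    by (simp add: arc_reversepath insert_commute)
  moreover have "connected F" "F \<noteq> {}" "F \<inter> drawn G p \<gamma> = {}"
    using F in_components_connected in_components_subset[OF F(1)] KE by auto
  ultimately show ?thesis
    using xyV by (intro planar_add_vertex_face[OF fsg d st v, of "{x, y}" F]) auto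
qed

text \<open>The last assumption says that the graph without \<open>x, y, z\<close> is connected, so one side of the triangle is empty.\<close>

lemma planar_add_in_triangle:
  assumes fsg: "finite_simple_graph G" and "planar G"
    and e: "{x, y} \<in> edges G" "{y, z} \<in> edges G" "{z, x} \<in> edges G" and v: "v \<notin> verts G"
    and conn: "\<And>A. \<lbrakk>A \<subseteq> verts G - {x, y, z}; A \<noteq> {}; A \<noteq> verts G - {x, y, z}\<rbrakk>
      \<Longrightarrow> \<exists>u\<in>A. \<exists>w\<in>verts G - {x, y, z} - A. {u, w} \<in> edges G"
  shows "planar (add_vertex G v {x, y, z})"
proof -
  obtain p \<gamma> where d: "plane_drawing G p \<gamma>" and st: "\<And>u. u \<in> verts G \<Longrightarrow> straight_at (drawn G p \<gamma>) (p u)"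
    using straight_drawing[OF fsg assms(2)] by blast
  have V: "x \<noteq> y" "y \<noteq> z" "z \<noteq> x" "x \<in> verts G" "y \<in> verts G" "z \<in> verts G"
    using fsg_pair[OF fsg e(1)] fsg_pair[OF fsg e(2)] fsg_pair[OF fsg e(3)] by auto
  obtain h1 where h1: "arc h1" "pathstart h1 = p x" "pathfinish h1 = p y" "path_image h1 = path_image (\<gamma> {x, y})"
    using oriented_arc[OF fsg d e(1)] .
  obtain h2 where h2: "arc h2" "pathstart h2 = p y" "pathfinish h2 = p z" "path_image h2 = path_image (\<gamma> {y, z})"
    using oriented_arc[OF fsg d e(2)] .
  obtain h3 where h3: "arc h3" "pathstart h3 = p z" "pathfinish h3 = p x" "path_image h3 = path_image (\<gamma> {z, x})"
    using oriented_arc[OF fsg d e(3)] .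
  have "{x, y} \<inter> {y, z} = {y}" "{x, y} \<inter> {z, x} = {x}" "{y, z} \<inter> {z, x} = {z}" using V by auto
  then have I: "path_image h1 \<inter> path_image h2 = {p y}" "path_image h1 \<inter> path_image h3 = {p x}"
    "path_image h2 \<inter> path_image h3 = {p z}"
    using drawing_edges_Int[OF d e(1,2)] drawing_edges_Int[OF d e(1,3)] drawing_edges_Int[OF d e(2,3)] V h1(4) h2(4) h3(4)
    by (auto simp: doubleton_eq_iff)
  define J where "J = path_image h1 \<union> path_image h2 \<union> path_image h3"
  have a23: "arc (h2 +++ h3)" using h2 h3 I by (intro arc_join) auto
  have im23: "path_image (h2 +++ h3) = path_image h2 \<union> path_image h3" using h2 h3 by (simp add: path_image_join)
  have sp: "simple_path (h1 +++ (h2 +++ h3))"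
    using h1 h2 h3 a23 I by (intro simple_path_join_loop) (auto simp: im23)
  have imJ: "path_image (h1 +++ (h2 +++ h3)) = J"
    using h1 h2 by (simp add: path_image_join im23 J_def Un_assoc)
  obtain inner outer where s: "inner \<noteq> {}" "open inner" "connected inner" "outer \<noteq> {}" "open outer" "connected outer"
     "inner \<inter> outer = {}" "inner \<union> outer = - J" "frontier inner = J" "frontier outer = J"
  proof (rule Jordan_curve[OF sp])
    show "pathfinish (h1 +++ h2 +++ h3) = pathstart (h1 +++ h2 +++ h3)" using h1 h3 by simp
  qed (use that imJ in auto)
  define R where "R = verts G - {x, y, z}"
  have fJ: "path_image (\<gamma> f) \<inter> J = p ` (f \<inter> {x, y, z})" if "f \<in> edges G" "\<not> f \<subseteq> {x, y, z}" for f
  proof -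
    have "path_image (\<gamma> f) \<inter> path_image (\<gamma> {x, y}) = p ` (f \<inter> {x, y})"
      "path_image (\<gamma> f) \<inter> path_image (\<gamma> {y, z}) = p ` (f \<inter> {y, z})"
      "path_image (\<gamma> f) \<inter> path_image (\<gamma> {z, x}) = p ` (f \<inter> {z, x})"
      using that by (auto intro!: drawing_edges_Int[OF d that(1)] e)
    then have "path_image (\<gamma> f) \<inter> J = p ` (f \<inter> {x, y}) \<union> p ` (f \<inter> {y, z}) \<union> p ` (f \<inter> {z, x})"
      unfolding J_def h1(4) h2(4) h3(4) by (simp add: Int_Un_distrib)
    also have "\<dots> = p ` (f \<inter> {x, y} \<union> f \<inter> {y, z} \<union> f \<inter> {z, x})" by (simp add: image_Un)
    also have "f \<inter> {x, y} \<union> f \<inter> {y, z} \<union> f \<inter> {z, x} = f \<inter> {x, y, z}" by blast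
    finally show ?thesis .
  qed
  have xyzJ: "p x \<in> J" "p y \<in> J" "p z \<in> J" using I unfolding J_def by auto
  have wJ: "p w \<notin> J" if "w \<in> R" for w
  proof
    assume "p w \<in> J"
    then have "\<exists>f. f \<in> {{x, y}, {y, z}, {z, x}} \<and> p w \<in> path_image (\<gamma> f)"
      by (auto simp: J_def h1(4) h2(4) h3(4))
    then obtain f where f: "f \<in> {{x, y}, {y, z}, {z, x}}" "p w \<in> path_image (\<gamma> f)" by blast
    then have "f \<in> edges G" "f \<subseteq> {x, y, z}" using e by auto
    then have "p w \<in> p ` f" using drawing_edge(3)[OF d, of f] f(2) that by (auto simp: R_def)
    moreover have "inj_on p (verts G)" using d by (auto simp: plane_drawing_def)
    moreover have "f \<subseteq> verts G" using fsg_edge(1)[OF fsg \<open>f \<in> edges G\<close>] .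
    ultimately have "w \<in> f" using that by (metis DiffD1 R_def inj_on_image_mem_iff)
    then show False using \<open>f \<subseteq> {x, y, z}\<close> that by (auto simp: R_def)
  qed
  \<comment> \<open>If vertices lay on both sides, \<open>conn\<close> would give an edge from
    \<open>inner\<close> to \<open>outer\<close>, and this edge would have to cross
    \<open>J\<close>.\<close>
  have side: "\<exists>F. connected F \<and> F \<noteq> {} \<and> frontier F = J \<and> F \<inter> J = {} \<and> (\<forall>w\<in>R. p w \<notin> F)"
  proof (cases "(\<forall>w\<in>R. p w \<notin> inner) \<or> (\<forall>w\<in>R. p w \<notin> outer)")
    case True
    then show ?thesis using s by blast
  next
    case False
    define A where "A = {w \<in> R. p w \<in> inner}"
    have "A \<subseteq> R" "A \<noteq> {}" "A \<noteq> R" using False s(7) by (auto simp: A_def)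
    then obtain u w where uw: "u \<in> A" "w \<in> R - A" "{u, w} \<in> edges G" using conn[of A] unfolding R_def by blast
    then have nuw: "\<not> {u, w} \<subseteq> {x, y, z}" "{u, w} \<inter> {x, y, z} = {}" using \<open>A \<subseteq> R\<close> by (auto simp: R_def)
    have "path_image (\<gamma> {u, w}) \<inter> J = {}" using fJ[OF uw(3) nuw(1)] nuw(2) by simp
    moreover have "connected (path_image (\<gamma> {u, w}))" using drawing_edge(1)[OF d uw(3)] connected_arc_image by blast
    moreover have "p u \<in> path_image (\<gamma> {u, w})" "p w \<in> path_image (\<gamma> {u, w})"
      using drawing_ends_in[OF d uw(3)] by auto
    moreover have "p u \<in> inner" "p w \<notin> inner" using uw by (auto simp: A_def)
    ultimately show ?thesis using connected_Int_frontier[of "path_image (\<gamma> {u, w})" inner] s(9) by blast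
  qed
  then obtain F where F: "connected F" "F \<noteq> {}" "frontier F = J" "F \<inter> J = {}" "\<And>w. w \<in> R \<Longrightarrow> p w \<notin> F" by blast
  \<comment> \<open>Edges stay out of \<open>F\<close> too: an edge without its ends on the triangle
    is connected, avoids \<open>J\<close> and contains a vertex that is not in
    \<open>F\<close>.\<close>
  have "F \<inter> path_image (\<gamma> f) = {}" if f: "f \<in> edges G" for f
  proof (cases "f \<subseteq> {x, y, z}")
    case True
    then have "f = {x, y} \<or> f = {y, z} \<or> f = {z, x}" using fsg_edge(2)[OF fsg f] by (auto simp: card_2_iff)
    then have "path_image (\<gamma> f) \<subseteq> J" by (auto simp: J_def h1(4) h2(4) h3(4))
    then show ?thesis using F(4) by blast
  next
    case False
    then obtain w where w: "w \<in> f" "w \<in> R" using fsg_edge(1)[OF fsg f] by (auto simp: R_def)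
    define P where "P = path_image (\<gamma> f) - p ` (f \<inter> {x, y, z})"
    have "p ` (f \<inter> {x, y, z}) \<subseteq> {pathstart (\<gamma> f), pathfinish (\<gamma> f)}" using drawing_edge(2)[OF d f] by blast
    then have "connected P" unfolding P_def using connected_arc_minus_ends drawing_edge(1)[OF d f] by blast
    moreover have PJ: "P \<inter> J = {}" using fJ[OF f False] by (auto simp: P_def)
    moreover have "p w \<in> P" using drawing_ends_in[OF d f w(1)] wJ[OF w(2)] xyzJ by (auto simp: P_def)
    moreover have "p w \<notin> F" using F(5)[OF w(2)] .
    ultimately have "P \<inter> F = {}" using connected_Int_frontier[of P F] F(3) by blast
    moreover have "p ` (f \<inter> {x, y, z}) \<subseteq> J" using xyzJ by auto
    ultimately show ?thesis using F(4) by (auto simp: P_def)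
  qed
  moreover have "p w \<notin> F" if "w \<in> verts G" for w
    using F(4,5) xyzJ that by (auto simp: R_def)
  ultimately have "F \<inter> drawn G p \<gamma> = {}" unfolding drawn_def by blast
  moreover have "p u \<in> closure F" if "u \<in> {x, y, z}" for u
    using that xyzJ F(3) by (auto simp: frontier_def)
  moreover have "card {x, y, z} \<le> 3" using V by simp
  ultimately show ?thesis
    using F(1,2) V by (intro planar_add_vertex_face[OF fsg d st v, of "{x, y, z}" F]) auto
qed

subsection \<open>Suppression, relabelling and nonplanar graphs\<close>

lemma two_path_arc:
  assumes fsg: "finite_simple_graph G" and d: "plane_drawing G p \<gamma>"
    and e: "{s, u} \<in> edges G" "{u, t} \<in> edges G" "s \<noteq> t"
  obtains h where "arc h" "pathstart h = p s" "pathfinish h = p t"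
    "path_image h = path_image (\<gamma> {s, u}) \<union> path_image (\<gamma> {u, t})"
proof -
  obtain h1 where h1: "arc h1" "pathstart h1 = p s" "pathfinish h1 = p u" "path_image h1 = path_image (\<gamma> {s, u})"
    using oriented_arc[OF fsg d e(1)] .
  obtain h2 where h2: "arc h2" "pathstart h2 = p u" "pathfinish h2 = p t" "path_image h2 = path_image (\<gamma> {u, t})"
    using oriented_arc[OF fsg d e(2)] .
  have V: "s \<noteq> u" "u \<noteq> t" using fsg_pair[OF fsg e(1)] fsg_pair[OF fsg e(2)] by auto
  have "path_image h1 \<inter> path_image h2 = p ` ({s, u} \<inter> {u, t})"
    unfolding h1(4) h2(4) using e V by (intro drawing_edges_Int[OF d]) (auto simp: doubleton_eq_iff)
  also have "{s, u} \<inter> {u, t} = {u}" using e V by auto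
  finally have "arc (h1 +++ h2)" using h1 h2 by (intro arc_join) auto
  then show ?thesis
    using that[of "h1 +++ h2"] h1 h2 by (simp add: path_image_join)
qed

text \<open>The new edge is drawn along the path through \<open>u\<close>. This turns a subdivision
  of K33 into K33.\<close>

lemma planar_suppress:
  assumes fsg: "finite_simple_graph G" and "planar G"
    and e: "{s, u} \<in> edges G" "{u, t} \<in> edges G" "s \<noteq> t"
  shows "planar \<lparr>verts = verts G - {u}, edges = insert {s, t} {e \<in> edges G. u \<notin> e}\<rparr>" (is "planar ?H")
proof (cases "{s, t} \<in> edges G")
  case True
  have V: "s \<noteq> u" "u \<noteq> t" using fsg_pair[OF fsg e(1)] fsg_pair[OF fsg e(2)] by auto
  show ?thesis
  proof (rule planar_subgraph[OF assms(2)])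
    have "f \<subseteq> verts G - {u} \<and> card f = 2" if "f \<in> insert {s, t} {e \<in> edges G. u \<notin> e}" for f
      using that True V fsg_edge[OF fsg, of f] by auto
    then show "finite_simple_graph ?H" using fsg by (auto simp: finite_simple_graph_def)
  qed (use True in auto)
next
  case False
  obtain p \<gamma> where d: "plane_drawing G p \<gamma>" using assms(2) by (auto simp: planar_def)
  obtain h where h: "arc h" "pathstart h = p s" "pathfinish h = p t"
    "path_image h = path_image (\<gamma> {s, u}) \<union> path_image (\<gamma> {u, t})"
    using two_path_arc[OF fsg d e] .
  have V: "s \<noteq> u" "u \<noteq> t" "s \<in> verts G" "t \<in> verts G" "u \<in> verts G"
    using fsg_pair[OF fsg e(1)] fsg_pair[OF fsg e(2)] by auto
  have inj: "inj_on p (verts G)" using d by (auto simp: plane_drawing_def)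
  define \<gamma>' where "\<gamma>' = \<gamma>({s, t} := h)"
  have g: "\<gamma>' {s, t} = h" "\<And>f. f \<in> edges G \<Longrightarrow> \<gamma>' f = \<gamma> f"
    using False by (auto simp: \<gamma>'_def)
  have hf: "path_image h \<inter> path_image (\<gamma> f) = p ` ({s, t} \<inter> f)" if f: "f \<in> edges G" "u \<notin> f" for f
  proof -
    have "path_image (\<gamma> {s, u}) \<inter> path_image (\<gamma> f) = p ` ({s, u} \<inter> f)"
      "path_image (\<gamma> {u, t}) \<inter> path_image (\<gamma> f) = p ` ({u, t} \<inter> f)"
      using f by (intro drawing_edges_Int[OF d e(1) f(1)] drawing_edges_Int[OF d e(2) f(1)]; blast)+
    then have "path_image h \<inter> path_image (\<gamma> f) = p ` (({s, u} \<inter> f) \<union> ({u, t} \<inter> f))"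
      unfolding h(4) image_Un Int_Un_distrib2 by simp
    also have "({s, u} \<inter> f) \<union> ({u, t} \<inter> f) = {s, t} \<inter> f" using f by auto
    finally show ?thesis .
  qed
  have V2: "p ` (verts G - {u}) = p ` verts G - {p u}" using inj V(5) by (auto simp: inj_on_def)
  have "plane_drawing ?H p \<gamma>'"
    unfolding plane_drawing_def
  proof (intro conjI ballI impI)
    show "inj_on p (verts ?H)" using inj by (auto simp: inj_on_def)
  next
    fix f assume "f \<in> edges ?H"
    then consider "f = {s, t}" | "f \<in> edges G" "u \<notin> f" by auto
    then have "arc (\<gamma>' f) \<and> {pathstart (\<gamma>' f), pathfinish (\<gamma>' f)} = p ` f \<and> path_image (\<gamma>' f) \<inter> p ` verts ?H = p ` f"
    proof cases
      case 1
      have "path_image h \<inter> p ` verts G = p ` {s, u} \<union> p ` {u, t}"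
        unfolding h(4) Int_Un_distrib2 drawing_edge(3)[OF d e(1)] drawing_edge(3)[OF d e(2)] ..
      moreover have "p s \<noteq> p u" "p t \<noteq> p u" using inj V by (auto simp: inj_on_def)
      ultimately have "path_image h \<inter> (p ` verts G - {p u}) = {p s, p t}" by auto
      then show ?thesis using 1 h by (simp add: g V2)
    next
      case 2
      have "p u \<notin> p ` f" using inj V(5) 2 fsg_edge(1)[OF fsg 2(1)] by (meson inj_on_image_mem_iff)
      then have "path_image (\<gamma> f) \<inter> (p ` verts G - {p u}) = p ` f"
        using drawing_edge(3)[OF d 2(1)] by (metis Diff_empty Diff_insert0 Int_Diff)
      then show ?thesis using drawing_edge(1,2)[OF d 2(1)] 2 by (simp add: g V2)
    qed
    then show "arc (\<gamma>' f)" "{pathstart (\<gamma>' f), pathfinish (\<gamma>' f)} = p ` f"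
      "path_image (\<gamma>' f) \<inter> p ` verts ?H = p ` f" by blast+
  next
    fix f k assume f: "f \<in> edges ?H" and k: "k \<in> edges ?H" and ne: "f \<noteq> k"
    consider "f = {s, t}" "k \<in> edges G" "u \<notin> k" | "k = {s, t}" "f \<in> edges G" "u \<notin> f" | "f \<in> edges G" "k \<in> edges G"
      using f k ne by auto
    then show "path_image (\<gamma>' f) \<inter> path_image (\<gamma>' k) = p ` (f \<inter> k)"
    proof cases
      case 1
      then show ?thesis using hf[OF 1(2,3)] by (simp add: g)
    next
      case 2
      then show ?thesis using hf[OF 2(2,3)] by (simp add: g Int_commute)
    next
      case 3
      then show ?thesis using drawing_edges_Int[OF d 3 ne] by (simp add: g)
    qed
  qed
  then show ?thesis by (auto simp: planar_def)
qed

text \<open>Needed to let a vertex outside a drawing take over the place of one inside it.\<close>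

lemma planar_relabel:
  assumes fsg: "finite_simple_graph G" and "planar G" and f: "inj_on f (verts G)"
  shows "planar \<lparr>verts = f ` verts G, edges = (`) f ` edges G\<rparr>" (is "planar ?H")
proof -
  obtain p \<gamma> where d: "plane_drawing G p \<gamma>" using assms(2) by (auto simp: planar_def)
  define k where "k = inv_into (verts G) f"
  have kf: "k (f u) = u" if "u \<in> verts G" for u using that f by (simp add: k_def)
  have kfe: "k ` (f ` e) = e" if "e \<subseteq> verts G" for e
    using that kf by (force simp: image_image)
  have E: "k ` (f ` e) = e" if "e \<in> edges G" for e using kfe fsg_edge(1)[OF fsg that] by blast
  have pk: "(p \<circ> k) ` (f ` e) = p ` e" if "e \<subseteq> verts G" for e using kfe[OF that] by (metis image_comp)
  have "plane_drawing ?H (p \<circ> k) (\<lambda>e. \<gamma> (k ` e))"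
    unfolding plane_drawing_def
  proof (intro conjI ballI impI)
    have "inj_on k (f ` verts G)" using kf by (auto simp: inj_on_def)
    moreover have "inj_on p (k ` f ` verts G)" using d kfe[of "verts G"] by (auto simp: plane_drawing_def)
    ultimately show "inj_on (p \<circ> k) (verts ?H)" by (simp add: comp_inj_on)
  next
    fix e assume "e \<in> edges ?H"
    then obtain e0 where e0: "e0 \<in> edges G" "e = f ` e0" by auto
    show "arc (\<gamma> (k ` e))" "{pathstart (\<gamma> (k ` e)), pathfinish (\<gamma> (k ` e))} = (p \<circ> k) ` e"
      "path_image (\<gamma> (k ` e)) \<inter> (p \<circ> k) ` verts ?H = (p \<circ> k) ` e"
      using drawing_edge[OF d e0(1)] E[OF e0(1)] pk[OF fsg_edge(1)[OF fsg e0(1)]] pk[of "verts G"] e0(2) by auto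
  next
    fix e e' assume "e \<in> edges ?H" "e' \<in> edges ?H" and ne: "e \<noteq> e'"
    then obtain e0 e1 where e0: "e0 \<in> edges G" "e = f ` e0" and e1: "e1 \<in> edges G" "e' = f ` e1" by auto
    have sub: "e0 \<subseteq> verts G" "e1 \<subseteq> verts G" using fsg_edge(1)[OF fsg] e0 e1 by auto
    have "e \<inter> e' = f ` (e0 \<inter> e1)" using inj_on_image_Int[OF f sub] e0 e1 by simp
    moreover have "e0 \<inter> e1 \<subseteq> verts G" using sub by auto
    ultimately have "(p \<circ> k) ` (e \<inter> e') = p ` (e0 \<inter> e1)" using pk by metis
    moreover have "k ` e = e0" "k ` e' = e1" using E[OF e0(1)] E[OF e1(1)] e0(2) e1(2) by auto
    moreover have "e0 \<noteq> e1" using ne e0(2) e1(2) by auto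
    ultimately show "path_image (\<gamma> (k ` e)) \<inter> path_image (\<gamma> (k ` e')) = (p \<circ> k) ` (e \<inter> e')"
      using drawing_edges_Int[OF d e0(1) e1(1)] by simp
  qed
  then show ?thesis by (auto simp: planar_def)
qed

section \<open>Nonplanarity of K33 and K5\<close>

lemma connected_avoid_frontier:
  assumes "connected Z" "Z \<inter> frontier O' = {}" "w \<in> Z" "w \<notin> O'"
  shows "Z \<inter> O' = {}"
  using connected_Int_frontier[OF assms(1)] assms(2-4) by blast

text \<open>
  Let \<open>J\<close> be the closed curve through \<open>x, c, y, d\<close> and \<open>O'\<close> the side of \<open>J\<close> that does not contain \<open>z\<close>. The path
  through \<open>x, e, y\<close> lies on the side of \<open>z\<close>. The edge from \<open>z\<close> to \<open>d\<close> connects \<open>z\<close> with \<open>O'\<close> outside the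
  paths through \<open>c\<close> and \<open>e\<close>, and the edge from \<open>z\<close> to \<open>c\<close> does so outside the paths through \<open>d\<close> and \<open>e\<close>. By
  Janiszewski's theorem the three paths together do not separate \<open>z\<close> from \<open>O'\<close>, although \<open>J\<close> does.
\<close>

lemma K33_nonplanar:
  assumes fsg: "finite_simple_graph G" and pl: "planar G"
    and dist: "distinct [c, d, e, x, y, z]"
    and E: "\<And>u w. \<lbrakk>u \<in> {c, d, e}; w \<in> {x, y, z}\<rbrakk> \<Longrightarrow> {u, w} \<in> edges G"
  shows False
proof -
  obtain p \<gamma> where dr: "plane_drawing G p \<gamma>" using pl by (auto simp: planar_def)
  define I where "I u w = path_image (\<gamma> {u, w})" for u w
  have Icomm: "I u w = I w u" for u w by (simp add: I_def insert_commute)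
  have II: "I u w \<inter> I u' w' = p ` ({u, w} \<inter> {u', w'})"
    if "u \<in> {c, d, e}" "w \<in> {x, y, z}" "u' \<in> {c, d, e}" "w' \<in> {x, y, z}" "u \<noteq> u' \<or> w \<noteq> w'" for u w u' w'
  proof -
    have "{u, w} \<noteq> {u', w'}" using that dist by (auto simp: doubleton_eq_iff)
    then show ?thesis unfolding I_def by (intro drawing_edges_Int[OF dr] E that)
  qed
  have cI: "connected (I u w)" if "u \<in> {c, d, e}" "w \<in> {x, y, z}" for u w
    unfolding I_def using drawing_edge(1)[OF dr E[OF that]] connected_arc_image by blast
  have pI: "p u \<in> I u w" "p w \<in> I u w" if "u \<in> {c, d, e}" "w \<in> {x, y, z}" for u w
    unfolding I_def using drawing_ends_in[OF dr E[OF that]] by auto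
  have V: "{c, d, e, x, y, z} \<subseteq> verts G"
    using fsg_edge(1)[OF fsg E, of c x] fsg_edge(1)[OF fsg E, of d y] fsg_edge(1)[OF fsg E, of e z] by auto
  have inj: "inj_on p {c, d, e, x, y, z}"
    using dr V unfolding plane_drawing_def by (metis inj_on_subset)
  define A where "A u = I u x \<union> I u y" for u
  have arcA: "\<exists>h. arc h \<and> pathstart h = p x \<and> pathfinish h = p y \<and> path_image h = A u" if "u \<in> {c, d, e}" for u
  proof -
    have "{x, u} \<in> edges G" "{u, y} \<in> edges G" "x \<noteq> y"
      using E[OF that, of x] E[OF that, of y] dist by (auto simp: insert_commute)
    from two_path_arc[OF fsg dr this] show ?thesis by (metis A_def I_def Icomm)
  qed
  have AA: "A u \<inter> A u' = {p x, p y}" if "u \<in> {c, d, e}" "u' \<in> {c, d, e}" "u \<noteq> u'" for u u'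
  proof -
    have "{u, x} \<inter> {u', x} = {x}" "{u, x} \<inter> {u', y} = {}" "{u, y} \<inter> {u', x} = {}" "{u, y} \<inter> {u', y} = {y}"
      using that dist by auto
    then have "I u x \<inter> I u' x = {p x}" "I u x \<inter> I u' y = {}" "I u y \<inter> I u' x = {}" "I u y \<inter> I u' y = {p y}"
      using II[of u x u' x] II[of u x u' y] II[of u y u' x] II[of u y u' y] that by auto
    then show ?thesis unfolding A_def by blast
  qed
  have Az: "A u \<inter> I u' z = {}" if "u \<in> {c, d, e}" "u' \<in> {c, d, e}" "u \<noteq> u'" for u u'
  proof -
    have "{u, x} \<inter> {u', z} = {}" "{u, y} \<inter> {u', z} = {}" using that dist by auto
    then have "I u x \<inter> I u' z = {}" "I u y \<inter> I u' z = {}"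
      using II[of u x u' z] II[of u y u' z] that by auto
    then show ?thesis unfolding A_def by blast
  qed
  obtain ha where ha: "arc ha" "pathstart ha = p x" "pathfinish ha = p y" "path_image ha = A c" using arcA[of c] by auto
  obtain hb where hb: "arc hb" "pathstart hb = p x" "pathfinish hb = p y" "path_image hb = A d" using arcA[of d] by auto
  obtain hc where hc: "arc hc" "pathstart hc = p x" "pathfinish hc = p y" "path_image hc = A e" using arcA[of e] by auto
  have ne: "c \<noteq> d" "d \<noteq> e" "c \<noteq> e" using dist by auto
  have A3: "A c \<inter> A e = {p x, p y}" "A d \<inter> A e = {p x, p y}" "A c \<inter> A d = {p x, p y}"
    using AA[of c e] AA[of d e] AA[of c d] ne by auto
  define J where "J = A c \<union> A d"
  have sp: "simple_path (ha +++ reversepath hb)"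
    using ha hb AA[of c d] ne by (intro simple_path_join_loop) (auto simp: arc_reversepath)
  have imJ: "path_image (ha +++ reversepath hb) = J"
    using ha hb by (simp add: path_image_join J_def)
  obtain inner outer where s: "inner \<noteq> {}" "connected inner" "outer \<noteq> {}" "connected outer"
     "inner \<inter> outer = {}" "inner \<union> outer = - J" "frontier inner = J" "frontier outer = J"
  proof (rule Jordan_curve[OF sp])
    show "pathfinish (ha +++ reversepath hb) = pathstart (ha +++ reversepath hb)" using ha hb by simp
  qed (use that imJ in auto)
  have zJ: "I e z \<inter> J = {}" using Az[of c e] Az[of d e] ne unfolding J_def by blast
  then have "p z \<notin> J" using pI(2)[of e z] by auto
  then have "p z \<notin> inner \<or> p z \<notin> outer" using s(5) by blast
  then obtain O' where O': "connected O'" "O' \<noteq> {}" "frontier O' = J" "O' \<inter> J = {}" "p z \<notin> O'"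
    using s by (metis Compl_disjoint2 Un_Int_eq(1) Int_Un_distrib2 Un_empty)
  have xyJ: "p x \<in> J" "p y \<in> J" "p c \<in> J" "p d \<in> J" using pI unfolding J_def A_def by auto
  \<comment> \<open>Why the path through \<open>e\<close> lies on the side of \<open>z\<close>:
    without its ends, but with the edge from \<open>e\<close> to \<open>z\<close>, it is connected
    and avoids \<open>J\<close>.\<close>
  define Z where "Z = I e z \<union> (A e - {p x, p y})"
  have "connected Z" unfolding Z_def
  proof (rule connected_Un)
    show "connected (I e z)" using cI by auto
    show "connected (A e - {p x, p y})" using connected_arc_minus_ends[OF hc(1), of "{p x, p y}"] hc by auto
    have "p e \<noteq> p x" "p e \<noteq> p y" using inj dist by (auto simp: inj_on_def)
    then show "I e z \<inter> (A e - {p x, p y}) \<noteq> {}" using pI(1)[of e z] pI(1)[of e x] by (auto simp: A_def)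
  qed
  moreover have "Z \<inter> frontier O' = {}"
    using zJ A3 unfolding O'(3) Z_def J_def by blast
  moreover have "p z \<in> Z" using pI(2)[of e z] by (auto simp: Z_def)
  ultimately have "Z \<inter> O' = {}" using O'(5) connected_avoid_frontier by blast
  then have AeO: "A e \<inter> O' = {}" using xyJ O'(4) unfolding Z_def by blast
  obtain w where w: "w \<in> O'" using O'(2) by blast
  have star: "connected_component (- (A u \<union> A e)) w (p z)"
    if "{u, u'} = {c, d}" for u u'
  proof -
    have u: "u \<in> {c, d, e}" "u' \<in> {c, d, e}" "u \<noteq> u'" "u' \<noteq> e" "A u \<subseteq> J" "p u' \<in> J"
      using that ne xyJ by (auto simp: doubleton_eq_iff J_def)
    \<comment> \<open>The vertex \<open>u'\<close> is on \<open>J\<close>, the frontier of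
      \<open>O'\<close>, so its edge to \<open>z\<close> can be attached to
      \<open>O'\<close>.\<close>
    have "connected (insert (p u') O')"
      using u(6) O'(3) by (intro connected_intermediate_closure[OF O'(1)]) (auto simp: frontier_def closure_subset[THEN subsetD])
    then have "connected (insert (p u') O' \<union> I u' z)"
      using cI[OF u(2), of z] pI(1)[OF u(2), of z] by (intro connected_Un) auto
    moreover have "insert (p u') O' \<union> I u' z = O' \<union> I u' z" using pI(1)[OF u(2), of z] by auto
    ultimately have "connected (O' \<union> I u' z)" by simp
    moreover have "O' \<union> I u' z \<subseteq> - (A u \<union> A e)"
      using O'(4) AeO u(5) Az[OF u(1,2,3)] Az[of e u'] u(2,4) by blast
    moreover have "p z \<in> I u' z" using pI(2)[OF u(2)] by simp
    ultimately show ?thesis unfolding connected_component_def using w by blast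
  qed
  have "connected_component (- ((A c \<union> A e) \<union> (A d \<union> A e))) w (p z)"
  proof (rule Janiszewski)
    show "compact (A c \<union> A e)" "closed (A d \<union> A e)"
      using ha hb hc by (metis compact_Un compact_arc_image compact_imp_closed)+
    \<comment> \<open>The paths meet in \<open>x\<close> and \<open>y\<close> only, so the
      intersection is the path through \<open>e\<close>, which is connected as Janiszewski's theorem
      demands.\<close>
    have "(A c \<union> A e) \<inter> (A d \<union> A e) = A e"
      using A3 by blast
    then show "connected ((A c \<union> A e) \<inter> (A d \<union> A e))" using hc connected_arc_image by metis
  qed (use star[of c d] star[of d c] in auto)
  then obtain Q where Q: "connected Q" "Q \<subseteq> - J" "w \<in> Q" "p z \<in> Q"
    unfolding connected_component_def J_def by blast
  then have "Q \<inter> O' = {}" using O'(3,5) by (intro connected_avoid_frontier[of Q O' "p z"]) auto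
  then show False using w Q(3) by blast
qed

definition induced :: "'a graph \<Rightarrow> 'a set \<Rightarrow> 'a graph" where
  "induced G U = \<lparr>verts = U, edges = {e \<in> edges G. e \<subseteq> U}\<rparr>"

lemma fsg_induced:
  assumes "finite_simple_graph G" "U \<subseteq> verts G"
  shows "finite_simple_graph (induced G U)"
  using assms fsg_edge[OF assms(1)] finite_subset unfolding finite_simple_graph_def induced_def by auto

lemma planar_induced:
  assumes "finite_simple_graph G" "planar G" "U \<subseteq> verts G"
  shows "planar (induced G U)"
  using assms by (intro planar_subgraph[OF assms(2) fsg_induced]) (auto simp: induced_def)

text \<open>In a drawing of K5 the two vertices \<open>c\<close> and \<open>d\<close> outside the
  triangle \<open>x, y, z\<close> are adjacent, so one side of the triangle is empty. A new vertex
  \<open>v\<close> placed there forms K33 with the others, the parts being \<open>c, d, v\<close>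
  and \<open>x, y, z\<close>.\<close>

lemma K5_nonplanar:
  assumes fsg: "finite_simple_graph G" and pl: "planar G" and v: "v \<notin> verts G"
    and dist: "distinct [c, d, x, y, z]"
    and E: "\<And>u w. \<lbrakk>u \<in> {c, d, x, y, z}; w \<in> {c, d, x, y, z}; u \<noteq> w\<rbrakk> \<Longrightarrow> {u, w} \<in> edges G"
  shows False
proof -
  let ?U = "{c, d, x, y, z}"
  let ?H = "induced G ?U"
  have U: "?U \<subseteq> verts G"
    using fsg_edge(1)[OF fsg E, of c d] fsg_edge(1)[OF fsg E, of x y] fsg_edge(1)[OF fsg E, of y z] dist by auto
  have H: "finite_simple_graph ?H" "planar ?H" using fsg_induced[OF fsg U] planar_induced[OF fsg pl U] by auto
  have EH: "{u, w} \<in> edges ?H" if "u \<in> ?U" "w \<in> ?U" "u \<noteq> w" for u w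
    using E[OF that] that by (simp add: induced_def)
  have vU: "v \<notin> verts ?H" using v U by (auto simp: induced_def)
  have P: "planar (add_vertex ?H v {x, y, z})"
  proof (rule planar_add_in_triangle[OF H EH EH EH vU])
    fix A assume A: "A \<subseteq> verts ?H - {x, y, z}" "A \<noteq> {}" "A \<noteq> verts ?H - {x, y, z}"
    then obtain u w where "u \<in> A" "w \<in> verts ?H - {x, y, z} - A" by blast
    moreover have "{u, w} \<in> edges ?H" using calculation A(1) by (intro EH) (auto simp: induced_def)
    ultimately show "\<exists>u\<in>A. \<exists>w\<in>verts ?H - {x, y, z} - A. {u, w} \<in> edges ?H" by blast
  qed (use dist in auto)
  have "finite_simple_graph (add_vertex ?H v {x, y, z})"
    by (rule fsg_add_vertex[OF H(1) vU]) (auto simp: induced_def)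
  then show False
  proof (rule K33_nonplanar[OF _ P, of c d v x y z])
    show "distinct [c, d, v, x, y, z]" using dist v U by auto
    show "{u, w} \<in> edges (add_vertex ?H v {x, y, z})" if "u \<in> {c, d, v}" "w \<in> {x, y, z}" for u w
    proof (cases "u = v")
      case True
      then show ?thesis using that(2) by (auto simp: add_vertex_def)
    next
      case False
      then have "{u, w} \<in> edges ?H" using that dist by (intro EH) auto
      then show ?thesis by (simp add: add_vertex_def)
    qed
  qed
qed

subsection \<open>Stacked triangulations\<close>

text \<open>Triangulations are given by their missing edges because the hypotheses on
  \<open>G\<close> have this form: a graph on \<open>V\<close> without the edges in \<open>M\<close>
  is a subgraph, whatever its other edges are.\<close>

definition complete_minus :: "'a set \<Rightarrow> 'a set set \<Rightarrow> 'a graph" where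
  "complete_minus V M = \<lparr>verts = V, edges = {e. e \<subseteq> V \<and> card e = 2} - M\<rparr>"

lemma fsg_complete_minus: "finite V \<Longrightarrow> finite_simple_graph (complete_minus V M)"
  by (auto simp: finite_simple_graph_def complete_minus_def)

lemma verts_complete_minus: "verts (complete_minus V M) = V"
  by (simp add: complete_minus_def)

lemma complete_minus_edge: "{u, w} \<in> edges (complete_minus V M) \<longleftrightarrow> u \<in> V \<and> w \<in> V \<and> u \<noteq> w \<and> {u, w} \<notin> M"
  by (auto simp: complete_minus_def card_2_iff doubleton_eq_iff)

text \<open>\<open>V'\<close> and \<open>M'\<close> are variables bound by side conditions, so that
  each stacking step can state its vertices and missing edges as explicit lists.\<close>

lemma complete_minus_add_vertex:
  assumes pl: "planar (add_vertex (complete_minus V M) v N)" and fin: "finite V"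
    and V': "V' = insert v V" and M: "M \<subseteq> M'" "\<And>w. w \<in> V - N \<Longrightarrow> {v, w} \<in> M'"
  shows "planar (complete_minus V' M')"
proof (rule planar_subgraph[OF pl])
  show "finite_simple_graph (complete_minus V' M')" using fin V' by (simp add: fsg_complete_minus)
  show "verts (complete_minus V' M') \<subseteq> verts (add_vertex (complete_minus V M) v N)" by (simp add: complete_minus_def add_vertex_def V')
  show "edges (complete_minus V' M') \<subseteq> edges (add_vertex (complete_minus V M) v N)"
  proof
    fix e assume "e \<in> edges (complete_minus V' M')"
    then obtain s t where e: "e = {s, t}" "s \<in> insert v V" "t \<in> insert v V" "s \<noteq> t" "e \<notin> M'"
      by (auto simp: complete_minus_def V' card_2_iff)
    consider "s = v" "t \<in> V" | "t = v" "s \<in> V" | "s \<in> V" "t \<in> V" using e by auto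
    then show "e \<in> edges (add_vertex (complete_minus V M) v N)"
    proof cases
      case 1
      then have "t \<in> N" using M(2) e by blast
      then show ?thesis using 1 e by (auto simp: add_vertex_def)
    next
      case 2
      then have "s \<in> N" using M(2) e by (metis DiffI insert_commute)
      then show ?thesis using 2 e by (auto simp: add_vertex_def insert_commute)
    next
      case 3
      then have "{s, t} \<in> edges (complete_minus V M)" using e M(1) by (auto simp: complete_minus_edge)
      then show ?thesis using e by (simp add: add_vertex_def)
    qed
  qed
qed

lemma planar_complete_minus_parallel:
  assumes pl: "planar (complete_minus V M)" and fin: "finite V"
    and "x \<in> V" "y \<in> V" "x \<noteq> y" "{x, y} \<notin> M" "v \<notin> V"
    and V': "V' = insert v V" and M: "M \<subseteq> M'" "\<And>w. w \<in> V - {x, y} \<Longrightarrow> {v, w} \<in> M'"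
  shows "planar (complete_minus V' M')"
proof (rule complete_minus_add_vertex[OF _ fin V' M])
  show "planar (add_vertex (complete_minus V M) v {x, y})"
    using assms by (intro planar_add_parallel fsg_complete_minus) (auto simp: complete_minus_edge verts_complete_minus)
qed

text \<open>One stacking step. The triangle bounds a face if the remaining vertices are connected,
  and \<open>hub\<close> ensures this by a vertex \<open>h\<close> joined to all the others among
  them.\<close>

lemma planar_complete_minus_triangle:
  assumes pl: "planar (complete_minus V M)" and fin: "finite V"
    and V: "{x, y, z} \<subseteq> V" "distinct [x, y, z]" "v \<notin> V"
    and e: "{x, y} \<notin> M" "{y, z} \<notin> M" "{z, x} \<notin> M"
    and hub: "V - {x, y, z} \<noteq> {} \<Longrightarrow> \<exists>h\<in>V - {x, y, z}. \<forall>w\<in>V - {x, y, z} - {h}. {h, w} \<notin> M"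
    and V': "V' = insert v V" and M: "M \<subseteq> M'" "\<And>w. w \<in> V - {x, y, z} \<Longrightarrow> {v, w} \<in> M'"
  shows "planar (complete_minus V' M')"
proof (rule complete_minus_add_vertex[OF _ fin V' M])
  show "planar (add_vertex (complete_minus V M) v {x, y, z})"
  proof (rule planar_add_in_triangle[OF fsg_complete_minus[OF fin] pl])
    fix A assume A: "A \<subseteq> verts (complete_minus V M) - {x, y, z}" "A \<noteq> {}" "A \<noteq> verts (complete_minus V M) - {x, y, z}"
    define R where "R = V - {x, y, z}"
    have A': "A \<subseteq> R" "A \<noteq> {}" "A \<noteq> R" using A by (auto simp: R_def complete_minus_def)
    then have "\<exists>h\<in>R. \<forall>w\<in>R - {h}. {h, w} \<notin> M" using hub unfolding R_def by blast
    then obtain h where h: "h \<in> R" "\<And>w. w \<in> R \<Longrightarrow> w \<noteq> h \<Longrightarrow> {h, w} \<notin> M" by blast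
    have RV: "R \<subseteq> V" by (auto simp: R_def)
    show "\<exists>u\<in>A. \<exists>w\<in>verts (complete_minus V M) - {x, y, z} - A. {u, w} \<in> edges (complete_minus V M)"
    proof (cases "h \<in> A")
      case True
      obtain w where w: "w \<in> R" "w \<notin> A" using A' by blast
      then have "{h, w} \<in> edges (complete_minus V M)" using h RV True by (auto simp: complete_minus_edge)
      then show ?thesis using True w by (auto simp: complete_minus_def R_def)
    next
      case False
      obtain u where u: "u \<in> A" using A' by blast
      then have u': "u \<in> R" "u \<noteq> h" using A'(1) False by auto
      then have "{h, u} \<in> edges (complete_minus V M)" using h RV by (auto simp: complete_minus_edge)
      then have "{u, h} \<in> edges (complete_minus V M)" by (simp only: insert_commute)
      then show ?thesis using u h(1) False by (auto simp: complete_minus_def R_def)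
    qed
  qed (use V e in \<open>auto simp: complete_minus_edge verts_complete_minus\<close>)
qed

lemma planar_complete_minus_K3:
  assumes "distinct [x, y, z]"
  shows "planar (complete_minus {x, y, z} {})"
proof -
  have "edges (complete_minus {x} {}) = {}"
    by (auto simp: complete_minus_def subset_singleton_iff)
  then have "plane_drawing (complete_minus {x} {}) (\<lambda>_. 0) (\<lambda>_ _. 0)"
    by (simp add: plane_drawing_def verts_complete_minus)
  then have 1: "planar (complete_minus {x} {})" by (auto simp: planar_def)
  have 2: "planar (complete_minus {x, y} {})"
  proof (rule complete_minus_add_vertex)
    show "planar (add_vertex (complete_minus {x} {}) y {x})"
      using assms by (intro planar_add_pendant 1 fsg_complete_minus) (auto simp: complete_minus_def)
  qed auto
  show ?thesis
    by (rule planar_complete_minus_parallel[OF 2, of x y z]) (use assms in auto)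
qed

lemma planar_complete_minus_K4:
  assumes "distinct [x, y, a, c]"
  shows "planar (complete_minus {x, y, a, c} {})"
  by (rule planar_complete_minus_triangle[OF planar_complete_minus_K3[of x y a], of x y a c]) (use assms in auto)

text \<open>\<open>c\<close> and \<open>d\<close> lie on opposite sides of the triangle
  \<open>x y a\<close>.\<close>

lemma planar_complete_minus_two_sides:
  assumes "distinct [x, y, a, c, d]"
  shows "planar (complete_minus {x, y, a, c, d} {{c, d}})"
  by (rule planar_complete_minus_triangle[OF planar_complete_minus_K4[of x y a c], of x y a d])
     (use assms in \<open>auto simp: doubleton_eq_iff insert_commute\<close>)

text \<open>\<open>d'\<close> joins \<open>d\<close> on its side of the triangle
  \<open>t t' a\<close>, in the face \<open>d t' a\<close>; hence it sees neither \<open>c\<close>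
  nor \<open>t\<close>.\<close>

lemma planar_complete_minus_two_sides_1_2:
  assumes "distinct [t, t', a, c, d, d']"
  shows "planar (complete_minus {t, t', a, c, d, d'} {{c, d}, {c, d'}, {d', t}})"
proof (rule planar_complete_minus_triangle[OF planar_complete_minus_two_sides[of t t' a c d], of d t' a d'])
  show "\<exists>h\<in>{t, t', a, c, d} - {d, t', a}. \<forall>w\<in>{t, t', a, c, d} - {d, t', a} - {h}. {h, w} \<notin> {{c, d}}"
    using assms by (intro bexI[of _ t]) (auto simp: doubleton_eq_iff)
qed (use assms in \<open>auto simp: doubleton_eq_iff insert_commute\<close>)

text \<open>Both sides of \<open>x y a\<close> receive a second vertex: \<open>d'\<close> in the
  face at \<open>d\<close> that avoids \<open>t\<close>, and \<open>c'\<close> in the face at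
  \<open>c\<close> that avoids \<open>s\<close>. The vertices \<open>s\<close> and \<open>t\<close>
  may coincide.\<close>

lemma planar_complete_minus_two_sides_2_2:
  assumes dist: "distinct [x, y, a, c, c', d, d']" and s: "{s, t} \<subseteq> {x, y}"
  shows "planar (complete_minus {x, y, a, c, c', d, d'} {{c, d}, {c, d'}, {c', d}, {c', d'}, {d', t}, {c', s}})"
proof -
  define s' where "s' = (if s = x then y else x)"
  define t' where "t' = (if t = x then y else x)"
  have xy: "{x, y} = {s, s'}" "{x, y} = {t, t'}" "s \<noteq> s'" "t \<noteq> t'" using s dist by (auto simp: s'_def t'_def)
  have "planar (complete_minus {t, t', a, c, d, d'} {{c, d}, {c, d'}, {d', t}})"
    using dist s xy by (intro planar_complete_minus_two_sides_1_2) (auto simp: doubleton_eq_iff)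
  also have "{t, t', a, c, d, d'} = {s, s', a, c, d, d'}" using xy by auto
  finally have P: "planar (complete_minus {s, s', a, c, d, d'} {{c, d}, {c, d'}, {d', t}})" .
  show ?thesis
  proof (rule planar_complete_minus_triangle[OF P, of c s' a c'])
    show "\<exists>h\<in>{s, s', a, c, d, d'} - {c, s', a}. \<forall>w\<in>{s, s', a, c, d, d'} - {c, s', a} - {h}. {h, w} \<notin> {{c, d}, {c, d'}, {d', t}}"
      using dist s xy by (intro bexI[of _ d]) (auto simp: doubleton_eq_iff)
  qed (use dist s xy in \<open>auto simp: doubleton_eq_iff insert_commute\<close>)
qed

text \<open>Opposite \<open>c\<close> the vertices are nested: \<open>f\<close> in
  \<open>t' t a\<close>, \<open>e\<close> in \<open>f t' a\<close> and \<open>d\<close> in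
  \<open>e f a\<close>. The edges missing between \<open>t, t'\<close> and \<open>d, e, f\<close>
  form the path \<open>t' d t e\<close>.\<close>

lemma planar_complete_minus_path:
  assumes "distinct [t', t, a, c, d, e, f]"
  shows "planar (complete_minus {t', t, a, c, d, e, f} {{c, d}, {c, e}, {c, f}, {t', d}, {d, t}, {t, e}})"
proof -
  have P: "planar (complete_minus {t', t, a, c, e, f} {{c, f}, {e, t}, {e, c}})"
  proof (rule planar_complete_minus_triangle[OF planar_complete_minus_two_sides[of t' t a c f], of f t' a e])
    show "\<exists>h\<in>{t', t, a, c, f} - {f, t', a}. \<forall>w\<in>{t', t, a, c, f} - {f, t', a} - {h}. {h, w} \<notin> {{c, f}}"
      using assms by (intro bexI[of _ t]) (auto simp: doubleton_eq_iff)
  qed (use assms in \<open>auto simp: doubleton_eq_iff insert_commute\<close>)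
  show ?thesis
  proof (rule planar_complete_minus_triangle[OF P, of e f a d])
    show "\<exists>h\<in>{t', t, a, c, e, f} - {e, f, a}. \<forall>w\<in>{t', t, a, c, e, f} - {e, f, a} - {h}. {h, w} \<notin> {{c, f}, {e, t}, {e, c}}"
      using assms by (intro bexI[of _ c]) (auto simp: doubleton_eq_iff)
  qed (use assms in \<open>auto simp: doubleton_eq_iff insert_commute\<close>)
qed

text \<open>Opposite \<open>c\<close>, \<open>d\<close> and \<open>e\<close> lie in two different
  faces at \<open>f\<close>, namely \<open>f t' a\<close> and \<open>f t a\<close>. So
  \<open>d\<close> misses \<open>t\<close>, \<open>e\<close> misses \<open>t'\<close>, and they miss
  each other.\<close>

lemma planar_complete_minus_matching:
  assumes "distinct [t', t, a, c, d, e, f]"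
  shows "planar (complete_minus {t', t, a, c, d, e, f} {{c, d}, {c, e}, {c, f}, {d, e}, {t, d}, {t', e}})"
proof -
  have P: "planar (complete_minus {t', t, a, c, d, f} {{c, f}, {d, t}, {d, c}})"
  proof (rule planar_complete_minus_triangle[OF planar_complete_minus_two_sides[of t' t a c f], of f t' a d])
    show "\<exists>h\<in>{t', t, a, c, f} - {f, t', a}. \<forall>w\<in>{t', t, a, c, f} - {f, t', a} - {h}. {h, w} \<notin> {{c, f}}"
      using assms by (intro bexI[of _ t]) (auto simp: doubleton_eq_iff)
  qed (use assms in \<open>auto simp: doubleton_eq_iff insert_commute\<close>)
  show ?thesis
  proof (rule planar_complete_minus_triangle[OF P, of f t a e])
    show "\<exists>h\<in>{t', t, a, c, d, f} - {f, t, a}. \<forall>w\<in>{t', t, a, c, d, f} - {f, t, a} - {h}. {h, w} \<notin> {{c, f}, {d, t}, {d, c}}"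
      using assms by (intro bexI[of _ t']) (auto simp: doubleton_eq_iff)
  qed (use assms in \<open>auto simp: doubleton_eq_iff insert_commute\<close>)
qed

text \<open>For the configuration with 21 edges. The central triangle is \<open>d e f\<close>, with
  \<open>y\<close> and \<open>a\<close> on opposite sides; \<open>x\<close> is stacked into
  \<open>y e f\<close>, and \<open>c\<close>, left with the neighbours \<open>x\<close> and
  \<open>y\<close>, runs parallel to their edge.\<close>

lemma planar_complete_minus_last:
  assumes "distinct [x, y, a, c, d, e, f]"
  shows "planar (complete_minus {x, y, a, c, d, e, f} {{y, a}, {x, a}, {x, d}, {c, a}, {c, d}, {c, e}, {c, f}})"
proof -
  have P: "planar (complete_minus {x, y, a, d, e, f} {{y, a}, {x, a}, {x, d}})"
  proof (rule planar_complete_minus_triangle[OF planar_complete_minus_two_sides[of d e f y a], of y e f x])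
    show "\<exists>h\<in>{d, e, f, y, a} - {y, e, f}. \<forall>w\<in>{d, e, f, y, a} - {y, e, f} - {h}. {h, w} \<notin> {{y, a}}"
      using assms by (intro bexI[of _ a]) (auto simp: doubleton_eq_iff)
  qed (use assms in \<open>auto simp: doubleton_eq_iff insert_commute\<close>)
  show ?thesis
    by (rule planar_complete_minus_parallel[OF P, of x y c]) (use assms in \<open>auto simp: doubleton_eq_iff insert_commute\<close>)
qed

subsection \<open>A deleted pair that avoids the neighbours\<close>

lemma fsg_delete:
  assumes "finite_simple_graph G"
  shows "finite_simple_graph (delete_vertices G S)"
  using assms fsg_edge[OF assms] unfolding finite_simple_graph_def delete_vertices_def by auto

lemma fsgI:
  assumes "finite (verts G)" "\<And>e. e \<in> edges G \<Longrightarrow> e \<subseteq> verts G \<and> card e = 2"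
  shows "finite_simple_graph G"
  using assms unfolding finite_simple_graph_def by blast

lemma card_3_third:
  assumes "card X = 3" "s \<in> X" "t \<in> X" "s \<noteq> t"
  obtains r where "X = {s, t, r}" "r \<noteq> s" "r \<noteq> t"
proof -
  have "card (X - {s, t}) = 1" using assms by (simp add: card_Diff_subset)
  then obtain r where "X - {s, t} = {r}" by (auto simp: card_1_singleton_iff)
  then show ?thesis using that[of r] assms by blast
qed

lemma card_3_others:
  assumes "card X = 3" "s \<in> X"
  obtains t r where "X = {s, t, r}" "t \<noteq> s" "r \<noteq> s" "r \<noteq> t"
proof -
  have "card (X - {s}) = 2" using assms by simp
  then obtain t r where "X - {s} = {t, r}" "t \<noteq> r" by (auto simp: card_2_iff)
  then show ?thesis using that[of t r] assms by blast
qed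

text \<open>The set \<open>A\<close> is the deleted pair \<open>S\<close>. Besides \<open>v\<close>,
  \<open>X\<close> and \<open>A\<close> at most four of ten vertices remain, and if there are four,
  then \<open>G\<close> has ten vertices and the edge bound applies.\<close>

locale Y_config =
  fixes G :: "'a graph" and v :: 'a and X A W :: "'a set"
  assumes fsg: "finite_simple_graph G"
    and VG: "verts G = insert v (X \<union> A \<union> W)"
    and disj: "v \<notin> X \<union> A \<union> W" "X \<inter> A = {}" "X \<inter> W = {}" "A \<inter> W = {}"
    and cX: "card X = 3" and cA: "card A = 2" and cW: "card W \<le> 4"
    and nv: "\<And>u. {v, u} \<in> edges G \<longleftrightarrow> u \<in> X"
    and cE: "card W = 4 \<Longrightarrow> card (edges G) \<le> 21"
begin

text \<open>For \<open>U = X \<union> W\<close> this is \<open>G' - A\<close>. If \<open>v\<close>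
  is in \<open>U\<close>, both the Y at \<open>v\<close> and the triangle are present, which keeps
  the sides of the triangle available for further vertices.\<close>

definition with_triangle :: "'a set \<Rightarrow> 'a graph" where
  "with_triangle U = \<lparr>verts = U, edges = {e. e \<subseteq> U \<and> card e = 2 \<and> (e \<in> edges G \<or> e \<subseteq> X)}\<rparr>"

abbreviation adj :: "'a \<Rightarrow> 'a \<Rightarrow> bool" where
  "adj u w \<equiv> {u, w} \<in> edges G"

lemma adj_sym: "adj u w \<longleftrightarrow> adj w u"
  by (simp add: insert_commute)

lemma finites: "finite X" "finite A" "finite W" "finite (verts G)"
proof -
  show "finite (verts G)" using fsg by (simp add: finite_simple_graph_def)
  then show "finite X" "finite A" "finite W" using VG by auto
qed

lemma fsg_wt: "finite U \<Longrightarrow> finite_simple_graph (with_triangle U)"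
  by (auto simp: finite_simple_graph_def with_triangle_def)

lemma wt_edge: "{u, w} \<in> edges (with_triangle U) \<longleftrightarrow>
    u \<in> U \<and> w \<in> U \<and> u \<noteq> w \<and> (adj u w \<or> (u \<in> X \<and> w \<in> X))"
  using fsg_pair[OF fsg] by (auto simp: with_triangle_def card_2_iff doubleton_eq_iff)

lemma verts_wt: "verts (with_triangle U) = U"
  by (simp add: with_triangle_def)

lemma planar_wt_insert:
  assumes "planar (add_vertex (with_triangle U) l N)" "finite U" "l \<notin> X"
    and "\<And>q. \<lbrakk>q \<in> U - N; adj l q\<rbrakk> \<Longrightarrow> False"
  shows "planar (with_triangle (insert l U))"
proof (rule planar_subgraph[OF assms(1)])
  show "finite_simple_graph (with_triangle (insert l U))" using assms(2) by (simp add: fsg_wt)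
  show "verts (with_triangle (insert l U)) \<subseteq> verts (add_vertex (with_triangle U) l N)"
    by (simp add: add_vertex_def verts_wt)
  show "edges (with_triangle (insert l U)) \<subseteq> edges (add_vertex (with_triangle U) l N)"
  proof
    fix e assume e: "e \<in> edges (with_triangle (insert l U))"
    then obtain s t where st: "e = {s, t}" by (auto simp: with_triangle_def card_2_iff)
    then have st': "s \<in> insert l U" "t \<in> insert l U" "s \<noteq> t" "adj s t \<or> (s \<in> X \<and> t \<in> X)"
      using e by (auto simp: wt_edge)
    consider "s = l" "t \<in> U" | "t = l" "s \<in> U" | "s \<in> U" "t \<in> U" using st' by auto
    then show "e \<in> edges (add_vertex (with_triangle U) l N)"
    proof cases
      case 1
      then have "adj l t" using st'(4) assms(3) by auto
      then have "t \<in> N" using 1 assms(4)[of t] by blast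
      then show ?thesis using 1 st by (auto simp: add_vertex_def)
    next
      case 2
      then have "adj l s" using st'(4) assms(3) by (auto simp: insert_commute)
      then have "s \<in> N" using 2 assms(4)[of s] by blast
      then show ?thesis using 2 st by (auto simp: add_vertex_def insert_commute)
    next
      case 3
      then have "e \<in> edges (with_triangle U)" using st st' by (simp add: wt_edge)
      then show ?thesis by (simp add: add_vertex_def)
    qed
  qed
qed

lemma two_apexI:
  assumes "planar K" "S \<subseteq> verts G" "card S \<le> 2" "verts G - S \<subseteq> verts K"
    and "\<And>u w. \<lbrakk>adj u w; u \<notin> S; w \<notin> S\<rbrakk> \<Longrightarrow> {u, w} \<in> edges K"
  shows "two_apex G"
proof -
  have "planar (delete_vertices G S)"
  proof (rule planar_subgraph[OF assms(1) fsg_delete[OF fsg]])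
    show "verts (delete_vertices G S) \<subseteq> verts K" using assms(4) by (simp add: delete_vertices_def)
    show "edges (delete_vertices G S) \<subseteq> edges K"
    proof
      fix e assume e: "e \<in> edges (delete_vertices G S)"
      then have e': "e \<in> edges G" "e \<inter> S = {}" by (auto simp: delete_vertices_def)
      then obtain u w where "e = {u, w}" using fsg_edge(2)[OF fsg] by (metis card_2_iff)
      then show "e \<in> edges K" using assms(5)[of u w] e' by auto
    qed
  qed
  then show ?thesis unfolding two_apex_def using assms(2,3) finites(4) finite_subset by blast
qed

text \<open>Here \<open>z\<close> and \<open>b\<close> are deleted. Then \<open>v\<close> has only
  the neighbours \<open>x\<close> and \<open>y\<close> left and is drawn along the edge
  \<open>x y\<close>; therefore this edge must not be in \<open>M\<close>, whether or not
  \<open>G\<close> has it.\<close>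

lemma two_apex_complete_minus:
  assumes X: "X = {x, y, z}" and A: "A = {a, b}"
    and pl: "planar (complete_minus ({x, y, a} \<union> W) M)" and M: "{x, y} \<notin> M" "\<And>e. e \<in> M \<Longrightarrow> e \<notin> edges G"
  shows "two_apex G"
proof -
  have d: "x \<noteq> y" "y \<noteq> z" "x \<noteq> z" "a \<noteq> b" using cX cA unfolding X A by (auto simp: card_insert_if split: if_splits)
  let ?V = "{x, y, a} \<union> W"
  let ?M = "M \<union> (\<lambda>w. {v, w}) ` (?V - {x, y})"
  have "planar (complete_minus (insert v ?V) ?M)"
  proof (rule planar_complete_minus_parallel[OF pl, of x y v])
    show "v \<notin> ?V" using disj X A by auto
  qed (use finites d M in auto)
  then show ?thesis
  proof (rule two_apexI[of _ "{z, b}"])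
    show "{z, b} \<subseteq> verts G" using VG X A by auto
    show "card {z, b} \<le> 2" by (simp add: card_insert_if)
    show "verts G - {z, b} \<subseteq> verts (complete_minus (insert v ?V) ?M)" using VG X A by (auto simp: verts_complete_minus)
    fix u w assume uw: "adj u w" "u \<notin> {z, b}" "w \<notin> {z, b}"
    have V: "u \<in> insert v ?V" "w \<in> insert v ?V" "u \<noteq> w"
      using fsg_pair[OF fsg uw(1)] uw VG X A by auto
    have "{u, w} \<notin> ?M"
    proof
      assume "{u, w} \<in> ?M"
      then obtain q where q: "q \<in> ?V - {x, y}" "{u, w} = {v, q}" using uw(1) M(2) by blast
      then have "q \<in> X" using uw(1) nv by simp
      then show False using q(1) X disj d uw q(2) by (auto simp: doubleton_eq_iff)
    qed
    then show "{u, w} \<in> edges (complete_minus (insert v ?V) ?M)" using V by (simp add: complete_minus_edge)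
  qed
qed

lemma obtain_A: obtains a b where "A = {a, b}" "a \<noteq> b"
  using cA that by (auto simp: card_2_iff)

lemma obtain_X: obtains x y z where "X = {x, y, z}" "distinct [x, y, z]"
proof -
  obtain x y z where "X = {x, y, z}" "x \<noteq> y" "y \<noteq> z" "x \<noteq> z"
    using cX unfolding card_3_iff by blast
  then show ?thesis by (intro that) auto
qed

section \<open>Consequences of the planarity of \<open>G' - A\<close>\<close>

context
  assumes plH: "planar (with_triangle (X \<union> W))"
begin

lemma no_K33:
  assumes "distinct [c, d, e]" "{c, d, e} \<subseteq> W"
    and "\<And>u w. \<lbrakk>u \<in> {c, d, e}; w \<in> X\<rbrakk> \<Longrightarrow> adj u w"
  shows False
proof -
  obtain x y z where X: "X = {x, y, z}" "distinct [x, y, z]" using obtain_X .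
  show False
  proof (rule K33_nonplanar[OF fsg_wt plH, of c d e x y z])
    have "{c, d, e} \<inter> {x, y, z} = {}" using assms(2) disj(3) unfolding X(1) by blast
    then show "distinct [c, d, e, x, y, z]" using X(2) assms(1) by auto
    show "{u, w} \<in> edges (with_triangle (X \<union> W))" if u: "u \<in> {c, d, e}" and w: "w \<in> {x, y, z}" for u w
    proof -
      have "w \<in> X" "u \<in> W" using u w assms(2) unfolding X(1) by blast+
      then show ?thesis using assms(3)[OF u, of w] fsg_pair[OF fsg, of u w] by (simp add: wt_edge)
    qed
    show "finite (X \<union> W)" using finites by simp
  qed
qed

text \<open>The edge from \<open>c3\<close> to \<open>x3\<close> is replaced by a path through
  \<open>m\<close>.\<close>

lemma no_K33_subdivided:
  assumes dist: "distinct [c1, c2, c3, x1, x2, x3, m]" and sub: "{c1, c2, c3, x1, x2, x3, m} \<subseteq> X \<union> W"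
    and "\<And>u w. \<lbrakk>u \<in> {c1, c2, c3}; w \<in> {x1, x2, x3}; \<not> (u = c3 \<and> w = x3)\<rbrakk> \<Longrightarrow> adj u w"
    and "adj c3 m" "adj m x3"
  shows False
proof -
  let ?H = "with_triangle (X \<union> W)"
  have fH: "finite_simple_graph ?H" using finites by (simp add: fsg_wt)
  let ?K = "\<lparr>verts = verts ?H - {m}, edges = insert {c3, x3} {e \<in> edges ?H. m \<notin> e}\<rparr>"
  have "planar ?K"
    using dist sub assms(4,5) by (intro planar_suppress[OF fH plH]) (auto simp: wt_edge)
  moreover have "finite_simple_graph ?K"
  proof (rule fsgI)
    show "finite (verts ?K)" using finites by (simp add: verts_wt)
    fix e assume "e \<in> edges ?K"
    then consider "e = {c3, x3}" | "e \<in> edges ?H" "m \<notin> e" by auto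
    then show "e \<subseteq> verts ?K \<and> card e = 2"
    proof cases
      case 1
      then show ?thesis using dist sub by (auto simp: verts_wt)
    next
      case 2
      then show ?thesis using fsg_edge[OF fH 2(1)] by auto
    qed
  qed
  ultimately show False
  proof (intro K33_nonplanar[of ?K c1 c2 c3 x1 x2 x3])
    show "distinct [c1, c2, c3, x1, x2, x3]" using dist by auto
    show "{u, w} \<in> edges ?K" if "u \<in> {c1, c2, c3}" "w \<in> {x1, x2, x3}" for u w
    proof (cases "u = c3 \<and> w = x3")
      case False
      then have "adj u w" using assms(3) that by blast
      then have "{u, w} \<in> edges ?H" using that sub fsg_pair[OF fsg, of u w] by (auto simp: wt_edge)
      moreover have "m \<notin> {u, w}" using that dist by auto
      ultimately show ?thesis by simp
    qed simp
  qed auto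
qed

lemma no_K5:
  assumes "c \<noteq> d" "{c, d} \<subseteq> W" "adj c d" "\<And>u w. \<lbrakk>u \<in> {c, d}; w \<in> X\<rbrakk> \<Longrightarrow> adj u w"
  shows False
proof -
  obtain x y z where X: "X = {x, y, z}" "distinct [x, y, z]" using obtain_X .
  show False
  proof (rule K5_nonplanar[OF fsg_wt plH, of v c d x y z])
    have "{c, d} \<inter> {x, y, z} = {}" using assms(2) disj(3) unfolding X(1) by blast
    then show "distinct [c, d, x, y, z]" using X(2) assms(1) by auto
    show "v \<notin> verts (with_triangle (X \<union> W))" using disj by (auto simp: verts_wt)
    show "{u, w} \<in> edges (with_triangle (X \<union> W))"
      if "u \<in> {c, d, x, y, z}" "w \<in> {c, d, x, y, z}" "u \<noteq> w" for u w
    proof -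
      have uw: "u \<in> X \<or> u \<in> {c, d}" "w \<in> X \<or> w \<in> {c, d}" using that(1,2) unfolding X(1) by blast+
      have "adj u w \<or> (u \<in> X \<and> w \<in> X)"
      proof (cases "u \<in> X")
        case True
        then show ?thesis using uw(2) assms(4)[of w u] adj_sym[of u w] by blast
      next
        case False
        then have u: "u \<in> {c, d}" using uw(1) by blast
        show ?thesis
        proof (cases "w \<in> X")
          case True
          then show ?thesis using assms(4)[OF u] by blast
        next
          case False
          then have "w \<in> {c, d}" using uw(2) by blast
          then have "{u, w} = {c, d}" using u that(3) by auto
          then show ?thesis using assms(3) by simp
        qed
      qed
      moreover have "u \<in> X \<union> W" "w \<in> X \<union> W" using uw assms(2) by blast+
      ultimately show ?thesis using that(3) by (simp add: wt_edge)
    qed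
    show "finite (X \<union> W)" using finites by simp
  qed
qed

text \<open>The isolated vertices \<open>L\<close> of \<open>W\<close> are removed first, since they
  could occupy both sides of the triangle. Once \<open>v\<close> is in the empty side, they return
  one by one.\<close>

lemma two_apex_flat:
  assumes L: "L = {w \<in> W. \<forall>w'\<in>W. \<not> adj w w'}" and nfull: "\<And>w. w \<in> L \<Longrightarrow> \<exists>u\<in>X. \<not> adj w u"
    and conn: "\<And>B. \<lbrakk>B \<subseteq> W - L; B \<noteq> {}; B \<noteq> W - L\<rbrakk> \<Longrightarrow> \<exists>u\<in>B. \<exists>w\<in>W - L - B. adj u w"
  shows "two_apex G"
proof -
  obtain x y z where X: "X = {x, y, z}" "distinct [x, y, z]" using obtain_X .
  define U where "U = W - L"
  have fU: "finite (X \<union> U)" using finites by (auto simp: U_def)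
  have "planar (with_triangle (X \<union> U))"
  proof (rule planar_subgraph[OF plH fsg_wt[OF fU]])
    show "edges (with_triangle (X \<union> U)) \<subseteq> edges (with_triangle (X \<union> W))"
      by (auto simp: with_triangle_def U_def)
  qed (auto simp: verts_wt U_def)
  note plU = this
  have xX: "x \<in> X" "y \<in> X" "z \<in> X" unfolding X(1) by auto
  have ne: "x \<noteq> y" "y \<noteq> z" "z \<noteq> x" using X(2) by auto
  have vU: "v \<notin> X \<union> U" using disj by (auto simp: U_def)
  have R: "verts (with_triangle (X \<union> U)) - {x, y, z} = U"
    unfolding verts_wt using X(1) disj by (auto simp: U_def)
  have "planar (add_vertex (with_triangle (X \<union> U)) v {x, y, z})"
  proof (rule planar_add_in_triangle[OF fsg_wt[OF fU] plU])
    show "v \<notin> verts (with_triangle (X \<union> U))" using vU by (simp add: verts_wt)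
    show "{x, y} \<in> edges (with_triangle (X \<union> U))" "{y, z} \<in> edges (with_triangle (X \<union> U))"
      "{z, x} \<in> edges (with_triangle (X \<union> U))" using xX ne by (simp_all add: wt_edge)
    fix B assume B: "B \<subseteq> verts (with_triangle (X \<union> U)) - {x, y, z}" "B \<noteq> {}"
      "B \<noteq> verts (with_triangle (X \<union> U)) - {x, y, z}"
    then have BU: "B \<subseteq> U" "B \<noteq> U" unfolding R by auto
    then obtain u w where uw: "u \<in> B" "w \<in> U - B" "adj u w" using conn[of B] B(2) unfolding U_def by blast
    then have "{u, w} \<in> edges (with_triangle (X \<union> U))"
      using BU(1) fsg_pair[OF fsg uw(3)] by (auto simp: wt_edge)
    then show "\<exists>u\<in>B. \<exists>w\<in>verts (with_triangle (X \<union> U)) - {x, y, z} - B. {u, w} \<in> edges (with_triangle (X \<union> U))"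
      unfolding R using uw by blast
  qed
  then have base: "planar (with_triangle (insert v (X \<union> U)))"
  proof (rule planar_wt_insert)
    show False if "q \<in> X \<union> U - {x, y, z}" "adj v q" for q using that nv[of q] X(1) by blast
  qed (use fU vU in auto)
  have "planar (with_triangle (insert v (X \<union> U) \<union> F))" if "finite F" "F \<subseteq> L" for F
    using that
  proof (induction F)
    case empty
    then show ?case using base by simp
  next
    case (insert l F)
    let ?U = "insert v (X \<union> U) \<union> F"
    have l: "l \<in> L" "l \<in> W" "l \<notin> X" "l \<noteq> v" "l \<notin> U" using insert.prems disj L by (auto simp: U_def)
    obtain u where u: "u \<in> X" "\<not> adj l u" using nfull[OF l(1)] by blast
    obtain s t where st: "X = {u, s, t}" "s \<noteq> u" "t \<noteq> u" "t \<noteq> s" using card_3_others[OF cX u(1)] .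
    have stX: "s \<in> X" "t \<in> X" unfolding st(1) by auto
    have fin: "finite ?U" using fU insert by auto
    \<comment> \<open>As \<open>l\<close> misses \<open>u\<close> and has no neighbour in
      \<open>W\<close>, its only possible neighbours in \<open>?U\<close> are \<open>s\<close> and
      \<open>t\<close>, and it can follow their edge.\<close>
    have "planar (add_vertex (with_triangle ?U) l {s, t})"
    proof (rule planar_add_parallel[OF fsg_wt[OF fin]])
      show "planar (with_triangle ?U)" using insert by auto
      show "{s, t} \<in> edges (with_triangle ?U)" using st(4) stX by (simp add: wt_edge)
      show "l \<notin> verts (with_triangle ?U)" using l insert by (auto simp: verts_wt)
    qed
    moreover have False if q: "q \<in> ?U - {s, t}" "adj l q" for q
    proof -
      have "q \<noteq> u" using q u by auto
      moreover have "q \<noteq> v" using q nv[of l] l by (auto simp: insert_commute)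
      ultimately have "q \<in> W" using q(1) st(1) insert.prems L by (auto simp: U_def)
      then show False using q(2) l(1) L by auto
    qed
    ultimately have "planar (with_triangle (insert l ?U))" using fin l(3) by (intro planar_wt_insert)
    then show ?case by simp
  qed
  from this[of L] have "planar (with_triangle (insert v (X \<union> U) \<union> L))" using finites L by auto
  moreover have "insert v (X \<union> U) \<union> L = insert v (X \<union> W)" using L by (auto simp: U_def)
  ultimately have "planar (with_triangle (insert v (X \<union> W)))" by simp
  then show ?thesis
  proof (rule two_apexI[of _ A])
    show "{u, w} \<in> edges (with_triangle (insert v (X \<union> W)))" if "adj u w" "u \<notin> A" "w \<notin> A" for u w
      using that fsg_pair[OF fsg that(1)] VG by (auto simp: wt_edge)
  qed (use VG cA in \<open>auto simp: verts_wt\<close>)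
qed

text \<open>Each pair misses a vertex of \<open>X\<close>, as otherwise it would form K5 with the
  triangle. With the four missing edges between the pairs this makes the six that a triangulation on
  seven vertices lacks.\<close>

lemma two_apex_two_pairs:
  assumes W: "W = {c, c', d, d'}" and dist: "distinct [c, c', d, d']"
    and e: "adj c c'" "adj d d'" and ne: "\<And>u w. \<lbrakk>u \<in> {c, c'}; w \<in> {d, d'}\<rbrakk> \<Longrightarrow> \<not> adj u w"
  shows "two_apex G"
proof -
  obtain s k where s: "s \<in> X" "k \<in> {c, c'}" "\<not> adj k s"
    using no_K5[of c c'] dist W e by auto
  obtain t l where t: "t \<in> X" "l \<in> {d, d'}" "\<not> adj l t"
    using no_K5[of d d'] dist W e by auto
  obtain k' where k': "{c, c'} = {k', k}" "k' \<noteq> k" using s(2) dist by auto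
  obtain l' where l': "{d, d'} = {l', l}" "l' \<noteq> l" using t(2) dist by auto
  \<comment> \<open>The two vertices of \<open>X\<close> that are kept must include \<open>s\<close>
    and \<open>t\<close>, where the missing edges end.\<close>
  obtain x y where xy: "x \<in> X" "y \<in> X" "x \<noteq> y" "{s, t} \<subseteq> {x, y}"
  proof (cases "s = t")
    case True
    then show ?thesis using card_3_others[OF cX s(1)] that[of s] s(1)
      by (metis insertI1 insert_absorb2 insert_commute insert_subset empty_subsetI)
  qed (use s t that[of s t] in auto)
  obtain z where X: "X = {x, y, z}" "z \<noteq> x" "z \<noteq> y" using card_3_third[OF cX xy(1-3)] .
  obtain a b where A: "A = {a, b}" "a \<noteq> b" using obtain_A .
  have W': "W = {k', k, l', l}" using W k' l' by auto
  have D: "distinct [k', k, l', l]" using dist k' l' by (auto simp: doubleton_eq_iff)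
  have D': "distinct [x, y, a, k', k, l', l]" using D xy(3) disj X A W' by auto
  show ?thesis
  proof (rule two_apex_complete_minus[OF X(1) A(1)])
    show "planar (complete_minus ({x, y, a} \<union> W) {{k', l'}, {k', l}, {k, l'}, {k, l}, {l, t}, {k, s}})"
    proof -
      have "{x, y, a} \<union> W = {x, y, a, k', k, l', l}" unfolding W' by auto
      then show ?thesis using planar_complete_minus_two_sides_2_2[OF D' xy(4)] by (simp only:)
    qed
    show "{x, y} \<notin> {{k', l'}, {k', l}, {k, l'}, {k, l}, {l, t}, {k, s}}" using D' by (auto simp: doubleton_eq_iff)
    have "k \<in> {c, c'}" "k' \<in> {c, c'}" "l \<in> {d, d'}" "l' \<in> {d, d'}" using k' l' by auto
    then show "e \<notin> edges G" if "e \<in> {{k', l'}, {k', l}, {k, l'}, {k, l}, {l, t}, {k, s}}" for e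
      using that ne s(3) t(3) by blast
  qed
qed

text \<open>After deleting \<open>u\<close> and \<open>b\<close>, the vertex \<open>a\<close> takes
  the place of \<open>u\<close> in the drawing of \<open>G' - A\<close>: its edges to
  \<open>W\<close> are covered by \<open>sub\<close>, those to \<open>s\<close> and \<open>t\<close>
  by the triangle. Then \<open>v\<close> follows the edge \<open>s t\<close>.\<close>

lemma two_apex_swap:
  assumes u: "u \<in> X" and a: "a \<in> A" and sub: "\<And>w. \<lbrakk>w \<in> W; adj a w\<rbrakk> \<Longrightarrow> adj u w"
  shows "two_apex G"
proof -
  obtain s t where X: "X = {u, s, t}" "s \<noteq> u" "t \<noteq> u" "t \<noteq> s" using card_3_others[OF cX u] .
  have stX: "s \<in> X" "t \<in> X" unfolding X(1) by auto
  obtain b where A: "A = {a, b}" "b \<noteq> a" using a cA by (auto simp: card_2_iff)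
  let ?H = "with_triangle (X \<union> W)"
  define f where "f = (\<lambda>w. w)(u := a)"
  have aXW: "a \<notin> X \<union> W" "v \<noteq> a" using a disj by auto
  have f: "f u = a" "\<And>w. w \<noteq> u \<Longrightarrow> f w = w" by (auto simp: f_def)
  have inj: "inj_on f (X \<union> W)" using aXW by (auto simp: inj_on_def f_def)
  have fH: "finite_simple_graph ?H" using finites by (simp add: fsg_wt)
  let ?K = "\<lparr>verts = f ` verts ?H, edges = (`) f ` edges ?H\<rparr>"
  have K: "planar ?K" using planar_relabel[OF fH plH] inj by (simp add: verts_wt)
  have uW: "u \<notin> W" using u disj by auto
  have "f ` verts ?H = {a, s, t} \<union> f ` W" unfolding verts_wt using X f by auto
  moreover have "f ` W = W" using f uW by force
  ultimately have VK: "verts ?K = {a, s, t} \<union> W" by simp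
  have fsgK: "finite_simple_graph ?K"
  proof (rule fsgI)
    show "finite (verts ?K)" using finites by (simp add: verts_wt)
    fix e assume "e \<in> edges ?K"
    then obtain e0 where e0: "e0 \<in> edges ?H" "e = f ` e0" by auto
    then show "e \<subseteq> verts ?K \<and> card e = 2"
      using fsg_edge[OF fH e0(1)] inj card_image[of f e0] inj_on_subset[of f "X \<union> W" e0] by (auto simp: verts_wt)
  qed
  have EK: "{f p, f q} \<in> edges ?K" if "{p, q} \<in> edges ?H" for p q
    using that by (force simp: image_iff intro: bexI[of _ "{p, q}"])
  have "planar (add_vertex ?K v {s, t})"
  proof (rule planar_add_parallel[OF fsgK K])
    have "{s, t} \<in> edges ?H" using X(4) stX by (simp add: wt_edge)
    then show "{s, t} \<in> edges ?K" using EK[of s t] X f by auto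
    show "v \<notin> verts ?K" using VK disj aXW X(1) by auto
  qed
  then show ?thesis
  proof (rule two_apexI[of _ "{u, b}"])
    show "{u, b} \<subseteq> verts G" using VG u A by auto
    show "card {u, b} \<le> 2" by (simp add: card_insert_if)
    show "verts G - {u, b} \<subseteq> verts (add_vertex ?K v {s, t})" using VG VK X A by (auto simp: add_vertex_def)
    fix p q assume pq: "adj p q" "p \<notin> {u, b}" "q \<notin> {u, b}"
    \<comment> \<open>Since \<open>v\<close> and \<open>a\<close> are not adjacent, each edge has an
      end \<open>q\<close> different from both.\<close>
    have half: "{p, q} \<in> edges (add_vertex ?K v {s, t})"
      if pq: "adj p q" "p \<notin> {u, b}" "q \<notin> {u, b}" and c: "q \<noteq> v" "q \<noteq> a" for p q
    proof -
      have "p \<in> insert v ({s, t, a} \<union> W)" "q \<in> {s, t} \<union> W" "p \<noteq> q"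
        using fsg_pair[OF fsg pq(1)] pq c VG X A by auto
      then consider "p = v" | "p = a" "q \<in> {s, t} \<union> W" | "p \<in> {s, t} \<union> W" "q \<in> {s, t} \<union> W" by auto
      then show ?thesis
      proof cases
        case 1
        then have "q \<in> {s, t}" using nv[of q] pq X by auto
        then show ?thesis using 1 by (auto simp: add_vertex_def)
      next
        case 2
        then have "{u, q} \<in> edges ?H" using sub[of q] pq(1,3) stX u by (auto simp: wt_edge)
        then have "{f u, f q} \<in> edges ?K" by (rule EK)
        then show ?thesis using 2 f pq by (simp add: add_vertex_def)
      next
        case 3
        then have "{p, q} \<in> edges ?H" using pq \<open>p \<noteq> q\<close> stX by (auto simp: wt_edge)
        then have "{f p, f q} \<in> edges ?K" by (rule EK)
        then show ?thesis using f pq by (simp add: add_vertex_def)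
      qed
    qed
    show "{p, q} \<in> edges (add_vertex ?K v {s, t})"
    proof (cases "q \<noteq> v \<and> q \<noteq> a")
      case True
      then show ?thesis using half pq by blast
    next
      case False
      have "\<not> adj v a" using nv[of a] aXW by auto
      then have "p \<noteq> v \<and> p \<noteq> a"
        using False pq(1) fsg_pair[OF fsg pq(1)] adj_sym by metis
      then have "{q, p} \<in> edges (add_vertex ?K v {s, t})" using half[of q p] pq adj_sym by blast
      then show ?thesis by (simp add: insert_commute)
    qed
  qed
qed

end

end

subsection \<open>An isolated vertex that sees the whole triangle\<close>

context Y_config
begin

context
  assumes plH: "planar (with_triangle (X \<union> W))"
  fixes c :: 'a
  assumes cW': "c \<in> W" and full: "\<And>u. u \<in> X \<Longrightarrow> adj c u" and iso: "\<And>w. w \<in> W \<Longrightarrow> \<not> adj c w"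
begin

lemma two_apex_complete_minusI:
  assumes xy: "x \<in> X" "y \<in> X" "x \<noteq> y" and A: "A = {a, b}"
    and V: "V = {x, y, a} \<union> W" and pl: "planar (complete_minus V M)"
    and M: "{x, y} \<notin> M" "\<And>e. e \<in> M \<Longrightarrow> e \<notin> edges G"
  shows "two_apex G"
proof -
  obtain z where "X = {x, y, z}" using card_3_third[OF cX xy] .
  then show ?thesis using two_apex_complete_minus[OF _ A pl[unfolded V] M] by blast
qed

text \<open>The missing edges at \<open>c\<close> suffice unless \<open>W\<close> has three
  vertices. In that case the exclusion of K33 yields one more, from \<open>k\<close> to
  \<open>t\<close>, and \<open>k\<close> is stacked above \<open>k'\<close> on the side opposite
  \<open>c\<close>.\<close>

lemma two_apex_isolated_small:
  assumes "card W \<le> 3"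
  shows "two_apex G"
proof -
  obtain x y z where X: "X = {x, y, z}" "distinct [x, y, z]" using obtain_X .
  have xX: "x \<in> X" "y \<in> X" "x \<noteq> y" using X by auto
  obtain a b where A: "A = {a, b}" "a \<noteq> b" using obtain_A .
  have aA: "a \<in> A" using A by simp
  have cD: "card (W - {c}) \<le> 2" using assms cW' finites by simp
  have fD: "finite (W - {c})" using finites by simp
  consider "W - {c} = {}" | d where "W - {c} = {d}" | d e where "W - {c} = {d, e}" "d \<noteq> e"
  proof -
    have "card (W - {c}) = 0 \<or> card (W - {c}) = 1 \<or> card (W - {c}) = 2" using cD by linarith
    then show ?thesis using that fD by (metis card_0_eq card_1_singletonE card_2_iff)
  qed
  then show ?thesis
  proof cases
    case 1
    then have W: "W = {c}" using cW' by blast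
    have "distinct [x, y, a, c]" using xX aA cW' disj by auto
    from planar_complete_minus_K4[OF this] show ?thesis
      by (rule two_apex_complete_minusI[OF xX A(1), rotated]) (auto simp: W)
  next
    case 2
    then have W: "W = {c, d}" "c \<noteq> d" using cW' by auto
    have "distinct [x, y, a, c, d]" using xX aA W disj by auto
    from planar_complete_minus_two_sides[OF this] show ?thesis
      by (rule two_apex_complete_minusI[OF xX A(1), rotated]) (use W iso xX disj in \<open>auto simp: doubleton_eq_iff\<close>)
  next
    case 3
    then have W: "W = {c, d, e}" "distinct [c, d, e]" using cW' by auto
    have "\<exists>t\<in>X. \<exists>k\<in>{d, e}. \<not> adj k t"
    proof (rule ccontr)
      assume "\<not> ?thesis"
      then show False using no_K33[OF plH W(2)] W(1) full by blast
    qed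
    then obtain t k where t: "t \<in> X" "k \<in> {d, e}" "\<not> adj k t" by blast
    obtain k' where k': "{d, e} = {k', k}" "k' \<noteq> k" using t(2) 3(2) by auto
    have Wk: "W = {c, k', k}" "distinct [c, k', k]" using W k' by (auto simp: doubleton_eq_iff)
    obtain t' where t': "t' \<in> X" "t \<noteq> t'" using card_3_others[OF cX t(1)] by blast
    have D: "distinct [t, t', a, c, k', k]" using t(1) t' aA Wk disj by auto
    from planar_complete_minus_two_sides_1_2[OF D] show ?thesis
    proof (rule two_apex_complete_minusI[OF t(1) t' A(1), rotated])
      show "{t, t', a, c, k', k} = {t, t', a} \<union> W" using Wk by auto
      show "{t, t'} \<notin> {{c, k'}, {c, k}, {k, t}}" using D by (auto simp: doubleton_eq_iff)
      show "g \<notin> edges G" if "g \<in> {{c, k'}, {c, k}, {k, t}}" for g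
        using that iso[of k'] iso[of k] t(3) Wk(1) by auto
    qed
  qed
qed

lemma path_two_apex:
  assumes W: "W = {c, d, e, f}" "distinct [c, d, e, f]" and t: "t \<in> X" "t' \<in> X" "t \<noteq> t'"
    and n: "\<not> adj t' d" "\<not> adj t d" "\<not> adj t e"
  shows "two_apex G"
proof -
  obtain a b where A: "A = {a, b}" "a \<noteq> b" using obtain_A .
  have aA: "a \<in> A" using A by simp
  have D: "distinct [t', t, a, c, d, e, f]" using t aA W disj by auto
  from planar_complete_minus_path[OF D] show ?thesis
  proof (rule two_apex_complete_minusI[OF t(2,1) t(3)[symmetric] A(1), rotated])
    show "{t', t, a, c, d, e, f} = {t', t, a} \<union> W" using W by auto
    show "{t', t} \<notin> {{c, d}, {c, e}, {c, f}, {t', d}, {d, t}, {t, e}}" using D by (auto simp: doubleton_eq_iff)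
    show "g \<notin> edges G" if "g \<in> {{c, d}, {c, e}, {c, f}, {t', d}, {d, t}, {t, e}}" for g
      using that iso[of d] iso[of e] iso[of f] n adj_sym[of d t] W(1) by blast
  qed
qed

lemma matching_two_apex:
  assumes W: "W = {c, d, e, f}" "distinct [c, d, e, f]" and t: "t \<in> X" "t' \<in> X" "t \<noteq> t'"
    and n: "\<not> adj d e" "\<not> adj t d" "\<not> adj t' e"
  shows "two_apex G"
proof -
  obtain a b where A: "A = {a, b}" "a \<noteq> b" using obtain_A .
  have aA: "a \<in> A" using A by simp
  have D: "distinct [t', t, a, c, d, e, f]" using t aA W disj by auto
  from planar_complete_minus_matching[OF D] show ?thesis
  proof (rule two_apex_complete_minusI[OF t(2,1) t(3)[symmetric] A(1), rotated])
    show "{t', t, a, c, d, e, f} = {t', t, a} \<union> W" using W by auto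
    show "{t', t} \<notin> {{c, d}, {c, e}, {c, f}, {d, e}, {t, d}, {t', e}}" using D by (auto simp: doubleton_eq_iff)
    show "g \<notin> edges G" if "g \<in> {{c, d}, {c, e}, {c, f}, {d, e}, {t, d}, {t', e}}" for g
      using that iso[of d] iso[of e] iso[of f] n W(1) by blast
  qed
qed

text \<open>The edges known so far number 3 at \<open>v\<close>, 3 at \<open>c\<close>, 3 in the
  triangle \<open>d e f\<close>, 6 from \<open>a, b\<close> to it and 6 from \<open>X\<close> to it.
  These are 21, so there are no others.\<close>

lemma all_edges:
  assumes W: "W = {c, d, e, f}" and A: "A = {a, b}" and X: "X = {x, y, z}"
    and D: "distinct [v, x, y, z, a, b, c, d, e, f]"
    and E: "adj d e" "adj d f" "adj e f" "adj a d" "adj a e" "adj a f" "adj b d" "adj b e" "adj b f"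
      "adj x e" "adj x f" "adj y d" "adj y f" "adj z d" "adj z e"
  shows "\<not> adj y a \<and> \<not> adj x a \<and> \<not> adj c a"
proof -
  let ?E = "{{v, x}, {v, y}, {v, z}, {c, x}, {c, y}, {c, z}, {d, e}, {d, f}, {e, f}, {a, d}, {a, e}, {a, f},
    {b, d}, {b, e}, {b, f}, {x, e}, {x, f}, {y, d}, {y, f}, {z, d}, {z, e}}"
  have sub: "?E \<subseteq> edges G" using E nv full unfolding X by auto
  \<comment> \<open>The reversed list gives the simplifier the same inequalities with their sides
    exchanged.\<close>
  have D': "distinct [f, e, d, c, b, a, z, y, x, v]"
    using D distinct_rev[of "[v, x, y, z, a, b, c, d, e, f]"] by simp
  have "card ?E = 21" using D D' by (simp add: doubleton_eq_iff)
  moreover have "card W = 4" unfolding W using D by simp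
  ultimately have "edges G = ?E"
    using card_seteq[OF fsg_finite_edges[OF fsg] sub] cE by simp
  then show ?thesis using D D' by (simp add: doubleton_eq_iff)
qed

text \<open>In a counterexample each vertex of \<open>X\<close> misses a vertex of \<open>D\<close>,
  and no vertex of \<open>D\<close> is missed twice. So the absent edges between \<open>X\<close>
  and \<open>D\<close> form a perfect matching; all other edges at \<open>D\<close> except those to
  \<open>c\<close> and \<open>v\<close> are then forced, and the edge count settles the
  rest.\<close>

lemma two_apex_isolated_large:
  assumes "card W = 4"
  shows "two_apex G"
proof (rule ccontr)
  assume not: "\<not> two_apex G"
  have "card (W - {c}) = 3" using assms cW' by simp
  define D where "D = W - {c}"
  have cD: "card D = 3" using \<open>card (W - {c}) = 3\<close> by (simp add: D_def)
  have W4: "W = {c, d, e, f} \<and> distinct [c, d, e, f]" if "D = {d, e, f}" "d \<noteq> e" "d \<noteq> f" "e \<noteq> f" for d e f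
    using that cW' by (auto simp: D_def)
  have third: "\<exists>f. D = {d, e, f} \<and> d \<noteq> f \<and> e \<noteq> f" if "d \<in> D" "e \<in> D" "d \<noteq> e" for d e
    using card_3_third[OF cD that] by metis
  have P1: False if "t \<in> X" "t' \<in> X" "t \<noteq> t'" "d \<in> D" "e \<in> D" "d \<noteq> e" "\<not> adj t' d" "\<not> adj t d" "\<not> adj t e"
    for t t' d e
  proof -
    obtain f where "D = {d, e, f}" "d \<noteq> f" "e \<noteq> f" using third \<open>d \<in> D\<close> \<open>e \<in> D\<close> \<open>d \<noteq> e\<close> by blast
    then show False using path_two_apex[of d e f t t'] W4[of d e f] that not by blast
  qed
  have P3: "adj d e" if "t \<in> X" "t' \<in> X" "t \<noteq> t'" "d \<in> D" "e \<in> D" "d \<noteq> e" "\<not> adj t d" "\<not> adj t' e"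
    for t t' d e
  proof -
    obtain f where "D = {d, e, f}" "d \<noteq> f" "e \<noteq> f" using third \<open>d \<in> D\<close> \<open>e \<in> D\<close> \<open>d \<noteq> e\<close> by blast
    then show ?thesis using matching_two_apex[of d e f t t'] W4[of d e f] that not by blast
  qed
  \<comment> \<open>The contrapositive of \<open>two_apex_swap\<close>; its witness is not
    \<open>c\<close>, because \<open>c\<close> sees all of \<open>X\<close>.\<close>
  have SW: "\<exists>w\<in>D. \<not> adj u w \<and> adj a w" if ua: "u \<in> X" "a \<in> A" for u a
  proof -
    obtain w where "w \<in> W" "adj a w" "\<not> adj u w" using two_apex_swap[OF plH ua] not by blast
    moreover have "w \<noteq> c" using \<open>\<not> adj u w\<close> full[OF ua(1)] adj_sym by auto
    ultimately show ?thesis by (auto simp: D_def)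
  qed
  obtain a b where A: "A = {a, b}" "a \<noteq> b" using obtain_A .
  have B: "\<exists>w\<in>D. \<not> adj u w" if "u \<in> X" for u using SW[OF that, of a] A by auto
  have common: False if t: "t \<in> X" "t' \<in> X" "t \<noteq> t'" and d: "d \<in> D" "\<not> adj t d" "\<not> adj t' d" for t t' d
  proof -
    have only: "adj t w" "adj t' w" if "w \<in> D" "w \<noteq> d" for w
      using P1[OF t d(1) that(1) _ d(3,2)] P1[OF t(2,1) t(3)[symmetric] d(1) that(1) _ d(2,3)] that(2) by blast+
    obtain s where s: "X = {t, t', s}" "s \<noteq> t" "s \<noteq> t'" using card_3_third[OF cX t] .
    have sX: "s \<in> X" unfolding s(1) by simp
    show False
    proof (cases "adj s d")
      \<comment> \<open>If \<open>s\<close> misses \<open>d\<close> too, then \<open>P1\<close>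
        makes \<open>d\<close> the only missed vertex, and \<open>c\<close>, \<open>e\<close>,
        \<open>f\<close> form K33 with \<open>X\<close>.\<close>
      case False
      obtain e f where D': "D = {d, e, f}" "e \<noteq> d" "f \<noteq> d" "f \<noteq> e" using card_3_others[OF cD d(1)] .
      have ef: "e \<in> D" "f \<in> D" using D' by auto
      have only_s: "adj s w" if "w \<in> D" "w \<noteq> d" for w
        using P1[OF sX t(1) s(2) d(1) that(1) _ d(2) False] that(2) by blast
      have "adj u w" if "u \<in> {c, e, f}" "w \<in> X" for u w
        using that only only_s ef D'(2,3) full s(1) adj_sym[of u w] by blast
      moreover have "distinct [c, e, f]" "{c, e, f} \<subseteq> W" using D' W4[of d e f] by auto
      ultimately show False using no_K33[OF plH] by blast
    next
      case True
      obtain e where e: "e \<in> D" "\<not> adj s e" using B[OF sX] by blast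
      then have ed: "e \<noteq> d" using True by auto
      have de: "adj d e" using P3[OF t(1) sX s(2)[symmetric] d(1) e(1) ed[symmetric] d(2) e(2)] .
      obtain f where f: "D = {d, e, f}" "d \<noteq> f" "e \<noteq> f" using third[OF d(1) e(1)] ed by blast
      then have fD: "f \<in> D" by auto
      have W': "W = {c, d, e, f}" "distinct [c, d, e, f]" using W4[OF f(1)] ed f by auto
      have dst: "distinct [c, f, e, t, t', s, d]" using W' t s sX disj by auto
      have et: "adj e t" "adj e t'" "adj f t" "adj f t'"
        using only[OF e(1) ed] only[OF fD] f(2) adj_sym by auto
      have ct: "adj c t" "adj c t'" "adj c s" using full t sX by auto
      show False
      proof (cases "adj s f")
        \<comment> \<open>K33 with parts \<open>c, f, e\<close> and \<open>t, t', s\<close>, where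
          \<open>e\<close> reaches \<open>s\<close> through \<open>d\<close>.\<close>
        case True
        then have fs: "adj f s" using adj_sym by blast
        show False
        proof (rule no_K33_subdivided[OF plH, of c f e t t' s d])
          show "distinct [c, f, e, t, t', s, d]" by (rule dst)
          show "{c, f, e, t, t', s, d} \<subseteq> X \<union> W" using W' t sX by auto
          show "adj e d" "adj d s" using de \<open>adj s d\<close> adj_sym by blast+
          show "adj u w" if "u \<in> {c, f, e}" "w \<in> {t, t', s}" "\<not> (u = e \<and> w = s)" for u w
            using that et ct fs by auto
        qed
      next
        \<comment> \<open>Now \<open>s\<close> misses \<open>e\<close> and \<open>f\<close>, but
          \<open>d\<close> sees both. This gives K33 with parts \<open>e, f, c\<close> and
          \<open>t, t', d\<close>, where \<open>c\<close> reaches \<open>d\<close> through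
          \<open>s\<close>.\<close>
        case False
        have df: "adj d f" using P3[OF t(1) sX s(2)[symmetric] d(1) fD f(2) d(2) False] .
        show False
        proof (rule no_K33_subdivided[OF plH, of e f c t t' d s])
          show "distinct [e, f, c, t, t', d, s]" using dst by auto
          show "{e, f, c, t, t', d, s} \<subseteq> X \<union> W" using W' t sX by auto
          show "adj c s" "adj s d" by (fact ct, fact \<open>adj s d\<close>)
          show "adj u w" if "u \<in> {e, f, c}" "w \<in> {t, t', d}" "\<not> (u = c \<and> w = d)" for u w
            using that et ct df de adj_sym by auto
        qed
      qed
    qed
  qed
  obtain x y z where X: "X = {x, y, z}" "distinct [x, y, z]" using obtain_X .
  have xX: "x \<in> X" "y \<in> X" "z \<in> X" "x \<noteq> y" "x \<noteq> z" "y \<noteq> z" using X by auto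
  obtain d where d: "d \<in> D" "\<not> adj x d" using B xX by blast
  obtain e where e: "e \<in> D" "\<not> adj y e" using B xX by blast
  obtain f where f: "f \<in> D" "\<not> adj z f" using B xX by blast
  have ne: "d \<noteq> e" "d \<noteq> f" "e \<noteq> f"
    using common[OF xX(1,2,4) d] common[OF xX(1,3,5) d] common[OF xX(2,3,6) e] e f by blast+
  have "{d, e, f} = D"
    using cD d e f ne finites by (intro card_subset_eq) (auto simp: D_def)
  then have D': "D = {d, e, f}" by simp
  have W': "W = {c, d, e, f}" "distinct [c, d, e, f]" using W4[OF D' ne] by auto
  have X1: "adj x e" "adj x f" using common[OF xX(1,2,4) e(1)] common[OF xX(1,3,5) f(1)] e f by blast+
  have Y1: "adj y d" "adj y f" using common[OF xX(1,2,4) d] common[OF xX(2,3,6) f(1)] f by blast+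
  have Z1: "adj z d" "adj z e" using common[OF xX(1,3,5) d] common[OF xX(2,3,6) e] by blast+
  \<comment> \<open>The only vertex of \<open>D\<close> that \<open>x\<close> misses is
    \<open>d\<close>, so \<open>SW\<close> forces every \<open>q\<close> in \<open>A\<close> to see
    it; \<open>y\<close> and \<open>z\<close> do the same for \<open>e\<close> and
    \<open>f\<close>.\<close>
  have Aall: "adj q d" "adj q e" "adj q f" if "q \<in> A" for q
    using SW[OF xX(1) that] SW[OF xX(2) that] SW[OF xX(3) that] X1 Y1 Z1 unfolding D' by blast+
  have tri: "adj d e" "adj d f" "adj e f"
    using P3[OF xX(1,2,4) d(1) e(1) ne(1) d(2) e(2)] P3[OF xX(1,3,5) d(1) f(1) ne(2) d(2) f(2)]
      P3[OF xX(2,3,6) e(1) f(1) ne(3) e(2) f(2)] by blast+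
  have ab: "a \<in> A" "b \<in> A" using A by auto
  have dst: "distinct [v, x, y, z, a, b, c, d, e, f]" using W' X(2) A(2) xX ab disj by auto
  have n: "\<not> adj y a \<and> \<not> adj x a \<and> \<not> adj c a"
    by (rule all_edges[OF W'(1) A(1) X(1) dst tri Aall[OF ab(1)] Aall[OF ab(2)] X1 Y1 Z1])
  have D7: "distinct [x, y, a, c, d, e, f]" using dst by auto
  from planar_complete_minus_last[OF D7] have "two_apex G"
  proof (rule two_apex_complete_minusI[OF xX(1,2,4) A(1), rotated])
    show "{x, y, a, c, d, e, f} = {x, y, a} \<union> W" using W' by auto
    show "{x, y} \<notin> {{y, a}, {x, a}, {x, d}, {c, a}, {c, d}, {c, e}, {c, f}}" using D7 by (auto simp: doubleton_eq_iff)
    show "g \<notin> edges G" if "g \<in> {{y, a}, {x, a}, {x, d}, {c, a}, {c, d}, {c, e}, {c, f}}" for g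
      using that iso[of d] iso[of e] iso[of f] n d(2) W'(1) by blast
  qed
  with not show False by blast
qed

end

text \<open>A vertex of \<open>W - L\<close> has a neighbour in \<open>W - L\<close>. So if
  \<open>W - L\<close> is disconnected, both parts have at least two vertices, and the bound of four
  leaves exactly two disjoint edges and an empty \<open>L\<close>.\<close>

lemma two_apex_of_planar:
  assumes plH: "planar (with_triangle (X \<union> W))"
  shows "two_apex G"
proof -
  define L where "L = {w \<in> W. \<forall>w'\<in>W. \<not> adj w w'}"
  show ?thesis
  proof (cases "\<exists>c\<in>L. \<forall>u\<in>X. adj c u")
    case True
    then obtain c where c: "c \<in> W" "\<And>u. u \<in> X \<Longrightarrow> adj c u" "\<And>w. w \<in> W \<Longrightarrow> \<not> adj c w" by (auto simp: L_def)
    show ?thesis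
      using two_apex_isolated_small[OF plH c] two_apex_isolated_large[OF plH c] cW by linarith
  next
    case False
    then have nfull: "\<And>w. w \<in> L \<Longrightarrow> \<exists>u\<in>X. \<not> adj w u" by blast
    show ?thesis
    proof (cases "\<exists>B. B \<subseteq> W - L \<and> B \<noteq> {} \<and> B \<noteq> W - L \<and> (\<forall>u\<in>B. \<forall>w\<in>W - L - B. \<not> adj u w)")
      case False
      then show ?thesis by (intro two_apex_flat[OF plH L_def nfull]) blast+
    next
      case True
      then obtain B where B: "B \<subseteq> W - L" "B \<noteq> {}" "B \<noteq> W - L" "\<And>u w. \<lbrakk>u \<in> B; w \<in> W - L - B\<rbrakk> \<Longrightarrow> \<not> adj u w" by blast
      define C where "C = W - L - B"
      have C: "C \<noteq> {}" "C \<subseteq> W - L" "B \<inter> C = {}" "B \<union> C = W - L" using B by (auto simp: C_def)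
      have cross: "\<not> adj u w" "\<not> adj w u" if "u \<in> B" "w \<in> C" for u w
        using B(4)[of u w] that adj_sym by (auto simp: C_def)
      have nb: "\<exists>w'\<in>W - L. adj w w'" if w: "w \<in> W - L" for w
      proof -
        obtain w' where w': "w' \<in> W" "adj w w'" using w by (auto simp: L_def)
        then have "w' \<notin> L" using w adj_sym[of w w'] by (auto simp: L_def)
        then show ?thesis using w' by blast
      qed
      have nbB: "\<exists>w'\<in>B. adj w w' \<and> w' \<noteq> w" if "w \<in> B" for w
        using nb[of w] cross(1)[OF that] C(4) that B(1) fsg_pair(1)[OF fsg] by (metis Un_iff subsetD)
      have nbC: "\<exists>w'\<in>C. adj w w' \<and> w' \<noteq> w" if "w \<in> C" for w
        using nb[of w] cross(2)[OF _ that] C(4) that C(2) fsg_pair(1)[OF fsg] by (metis Un_iff subsetD)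
      have two: "card Q \<ge> 2" if Q: "Q \<noteq> {}" "\<And>w. w \<in> Q \<Longrightarrow> \<exists>w'\<in>Q. adj w w' \<and> w' \<noteq> w" "finite Q" for Q
      proof -
        obtain w w' where "w \<in> Q" "w' \<in> Q" "w' \<noteq> w" using Q by blast
        then have "card {w, w'} \<le> card Q" using Q(3) by (intro card_mono) auto
        then show ?thesis using \<open>w' \<noteq> w\<close> by simp
      qed
      have fin: "finite B" "finite C" using finites B(1) C(2) finite_subset by blast+
      have cB: "card B \<ge> 2" using two[OF B(2) nbB fin(1)] .
      have cC: "card C \<ge> 2" using two[OF C(1) nbC fin(2)] .
      have sum: "card (B \<union> C) = card B + card C" using card_Un_disjoint[OF fin C(3)] .
      have le: "card (B \<union> C) \<le> card W" using C(4) finites by (intro card_mono) auto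
      have "card B = 2" "card C = 2" "card (B \<union> C) = card W" using cB cC sum le cW by linarith+
      moreover have "B \<union> C = W" using calculation(3) C(4) finites by (intro card_subset_eq) auto
      ultimately obtain p p' q q' where pq: "B = {p, p'}" "p \<noteq> p'" "C = {q, q'}" "q \<noteq> q'" "W = {p, p', q, q'}"
        by (metis card_2_iff insert_is_Un sup_assoc)
      show ?thesis
      proof (rule two_apex_two_pairs[OF plH pq(5)])
        show "distinct [p, p', q, q']" using pq C(3) by auto
        show "adj p p'" using nbB[of p] pq(1) by auto
        show "adj q q'" using nbC[of q] pq(3) by auto
        show "\<not> adj u w" if "u \<in> {p, p'}" "w \<in> {q, q'}" for u w using that cross pq by blast
      qed
    qed
  qed
qed

end

section \<open>Deleted sets that meet the neighbours, and the theorem\<close>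

lemma two_apex_meeting:
  assumes fsg: "finite_simple_graph G" and S: "S \<subseteq> verts G - {v}" "card S \<le> 2"
    and X: "X = neighbors G v" "card X = 3" "S \<inter> X \<noteq> {}"
    and pl: "planar (delete_vertices (Y_nabla_at G v) S)"
  shows "two_apex G"
proof -
  let ?H = "delete_vertices (Y_nabla_at G v) S"
  have finS: "finite S" using S fsg finite_subset by (auto simp: finite_simple_graph_def)
  have Xv: "X \<subseteq> verts G - {v}" using fsg_pair[OF fsg] unfolding X(1) neighbors_def by auto
  have finX: "finite X" using X(2) by (simp add: card_ge_0_finite)
  have edgesH: "e \<in> edges ?H \<longleftrightarrow> e \<inter> S = {} \<and> ((e \<in> edges G \<and> v \<notin> e) \<or> (\<exists>x y. e = {x, y} \<and> x \<in> X \<and> y \<in> X \<and> x \<noteq> y))" for e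
    unfolding delete_vertices_def Y_nabla_at_def X(1) by auto
  have vH: "verts ?H = verts G - {v} - S" by (simp add: delete_vertices_def Y_nabla_at_def)
  have fH: "finite_simple_graph ?H"
  proof (rule fsgI)
    show "finite (verts ?H)" using fsg unfolding vH by (simp add: finite_simple_graph_def)
    fix e assume e: "e \<in> edges ?H"
    then consider "e \<in> edges G" "v \<notin> e" | x y where "e = {x, y}" "x \<in> X" "y \<in> X" "x \<noteq> y" unfolding edgesH by blast
    then show "e \<subseteq> verts ?H \<and> card e = 2"
    proof cases
      case 1
      then show ?thesis using fsg_edge[OF fsg 1(1)] e unfolding edgesH vH by blast
    next
      case 2
      then show ?thesis using Xv e unfolding edgesH vH by auto
    qed
  qed
  have vn: "v \<notin> verts ?H" unfolding vH by simp
  have "card (X - S) = 3 - card (X \<inter> S)" using X(2) finX by (simp add: card_Diff_subset_Int)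
  moreover have "card (X \<inter> S) \<ge> 1" using X(3) finX by (metis Int_commute card_0_eq finite_Int less_one not_less)
  moreover have "card (X \<inter> S) \<le> 2" using S(2) finS card_mono[OF finS, of "X \<inter> S"] by auto
  \<comment> \<open>One remaining neighbour makes \<open>v\<close> pendant; two are still joined by
    an edge of the triangle, which \<open>v\<close> can follow.\<close>
  ultimately have "card (X - S) = 1 \<or> card (X - S) = 2" by linarith
  then have "planar (add_vertex ?H v (X - S))"
  proof
    assume "card (X - S) = 1"
    then obtain u where u: "X - S = {u}" by (auto simp: card_1_singleton_iff)
    have "u \<in> verts ?H" using u Xv unfolding vH by blast
    then show ?thesis unfolding u using planar_add_pendant[OF fH pl _ vn] by blast
  next
    assume "card (X - S) = 2"
    then obtain s t where st: "X - S = {s, t}" "s \<noteq> t" by (auto simp: card_2_iff)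
    then have "s \<in> X" "t \<in> X" "s \<notin> S" "t \<notin> S" by blast+
    then have "{s, t} \<in> edges ?H" using st(2) unfolding edgesH by blast
    then show ?thesis unfolding st(1) using planar_add_parallel[OF fH pl _ vn] by blast
  qed
  then have "planar (delete_vertices G S)"
  proof (rule planar_subgraph[OF _ fsg_delete[OF fsg]])
    show "verts (delete_vertices G S) \<subseteq> verts (add_vertex ?H v (X - S))"
      unfolding add_vertex_def by (auto simp: delete_vertices_def Y_nabla_at_def)
    show "edges (delete_vertices G S) \<subseteq> edges (add_vertex ?H v (X - S))"
    proof
      fix e assume "e \<in> edges (delete_vertices G S)"
      then have e: "e \<in> edges G" "e \<inter> S = {}" by (auto simp: delete_vertices_def)
      show "e \<in> edges (add_vertex ?H v (X - S))"
      proof (cases "v \<in> e")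
        case True
        obtain w where w: "e = {v, w}" using fsg_edge_obtain[OF fsg e(1) True] .
        then have "w \<in> X - S" using e X(1) by (auto simp: neighbors_def)
        then show ?thesis using w by (simp add: add_vertex_def)
      next
        case False
        then have "e \<in> edges ?H" using e unfolding edgesH by blast
        then show ?thesis by (simp add: add_vertex_def)
      qed
    qed
  qed
  then show ?thesis unfolding two_apex_def using S finS by blast
qed

theorem proposition1p4:
  fixes G G' :: "'a graph"
  assumes "finite_simple_graph G"
    and "card (verts G) \<le> 8 \<or> (card (verts G) \<le> 10 \<and> card (edges G) \<le> 21)"
    and "N2A G"
    and "Y_nabla_move G G'"
  shows "N2A G'"
proof (rule ccontr)
  note fsg = assms(1)
  obtain v where v: "v \<in> verts G" "degree G v = 3" and G': "G' = Y_nabla_at G v"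
    using assms(4) by (auto simp: Y_nabla_move_def)
  assume "\<not> N2A G'"
  then obtain S where S: "S \<subseteq> verts G'" "card S \<le> 2" "planar (delete_vertices G' S)"
    by (auto simp: N2A_def two_apex_def)
  have fin: "finite (verts G)" using fsg by (simp add: finite_simple_graph_def)
  have Sv: "S \<subseteq> verts G - {v}" using S(1) by (simp add: G' Y_nabla_at_def)
  have finS: "finite S" using Sv fin finite_subset by blast
  define X where "X = neighbors G v"
  have Xv: "X \<subseteq> verts G - {v}" using fsg_pair[OF fsg] unfolding X_def neighbors_def by auto
  \<comment> \<open>\<open>degree\<close> counts edges, so the number of neighbours is obtained from
    a bijection.\<close>
  have "{e \<in> edges G. v \<in> e} = (\<lambda>u. {v, u}) ` X"
  proof
    show "{e \<in> edges G. v \<in> e} \<subseteq> (\<lambda>u. {v, u}) ` X"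
    proof
      fix e assume "e \<in> {e \<in> edges G. v \<in> e}"
      then have e: "e \<in> edges G" "v \<in> e" by auto
      obtain w where "e = {v, w}" using fsg_edge_obtain[OF fsg e] .
      then show "e \<in> (\<lambda>u. {v, u}) ` X" using e by (auto simp: X_def neighbors_def)
    qed
  qed (auto simp: X_def neighbors_def)
  moreover have "inj_on (\<lambda>u. {v, u}) X" by (auto simp: inj_on_def doubleton_eq_iff)
  ultimately have cX: "card X = 3" using v(2) by (simp add: degree_def card_image)
  have meeting: False if "T \<subseteq> verts G - {v}" "card T \<le> 2" "T \<inter> X \<noteq> {}" "planar (delete_vertices G' T)" for T
    using two_apex_meeting[OF fsg that(1,2) X_def cX that(3)] that(4) assms(3) by (simp add: G' N2A_def)
  have fG': "finite_simple_graph G'"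
  proof (rule fsgI)
    show "finite (verts G')" using fin by (simp add: G' Y_nabla_at_def)
    fix e assume "e \<in> edges G'"
    then consider "e \<in> edges G" "v \<notin> e" | x y where "e = {x, y}" "x \<in> X" "y \<in> X" "x \<noteq> y"
      unfolding G' Y_nabla_at_def delete_vertices_def X_def by auto
    then show "e \<subseteq> verts G' \<and> card e = 2"
    proof cases
      case 1
      then show ?thesis using fsg_edge[OF fsg 1(1)] by (auto simp: G' Y_nabla_at_def)
    next
      case 2
      then show ?thesis using Xv by (auto simp: G' Y_nabla_at_def)
    qed
  qed
  show False
  proof (cases "S \<inter> X = {} \<and> card S = 2")
    case False
    obtain x where x: "x \<in> X" using cX by fastforce
    show False
    proof (cases "S \<inter> X = {}")
      case True
      \<comment> \<open>With at most one vertex deleted there is room for a vertex of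
        \<open>X\<close>, which leads back to sets that meet \<open>X\<close>.\<close>
      then have "card (insert x S) \<le> 2" using False S(2) finS by (simp add: card_insert_if)
      moreover have "planar (delete_vertices G' (insert x S))"
        by (rule planar_subgraph[OF S(3) fsg_delete[OF fG']]) (auto simp: delete_vertices_def)
      ultimately show False using meeting[of "insert x S"] x Sv Xv by blast
    qed (use meeting[of S] Sv S in blast)
  next
    case True
    define W where "W = verts G - insert v (X \<union> S)"
    have VG: "verts G = insert v (X \<union> S \<union> W)" using v(1) Xv Sv by (auto simp: W_def)
    have finX: "finite X" using Xv fin finite_subset by blast
    have finW: "finite W" using fin by (simp add: W_def)
    have "card (insert v (X \<union> S)) = 6"
      using True cX finX finS Xv Sv by (subst card_insert_disjoint) (auto simp: card_Un_disjoint Int_commute)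
    moreover have "card W = card (verts G) - card (insert v (X \<union> S))"
      unfolding W_def using finX finS v(1) Xv Sv by (intro card_Diff_subset) auto
    moreover have "card (insert v (X \<union> S)) \<le> card (verts G)" using VG fin by (intro card_mono) auto
    ultimately have cW: "card (verts G) = card W + 6" by linarith
    interpret Y_config G v X S W
    proof
      show "card W \<le> 4" "card W = 4 \<Longrightarrow> card (edges G) \<le> 21" using assms(2) cW by auto
      show "({v, u} \<in> edges G) = (u \<in> X)" for u by (simp add: X_def neighbors_def)
    qed (use fsg VG True cX Xv Sv in \<open>auto simp: W_def\<close>)
    have "planar (with_triangle (X \<union> W))"
    proof (rule planar_subgraph[OF S(3) fsg_wt])
      show "finite (X \<union> W)" using finX finW by simp
      show "verts (with_triangle (X \<union> W)) \<subseteq> verts (delete_vertices G' S)"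
        unfolding verts_wt using Xv True by (auto simp: G' Y_nabla_at_def delete_vertices_def W_def)
      show "edges (with_triangle (X \<union> W)) \<subseteq> edges (delete_vertices G' S)"
      proof
        fix e assume e: "e \<in> edges (with_triangle (X \<union> W))"
        then obtain p q where pq: "e = {p, q}" by (auto simp: with_triangle_def card_2_iff)
        then have pq': "p \<in> X \<union> W" "q \<in> X \<union> W" "p \<noteq> q" "adj p q \<or> (p \<in> X \<and> q \<in> X)"
          using e by (auto simp: wt_edge)
        have "e \<inter> S = {}" "v \<notin> e" using pq pq'(1,2) True Xv by (auto simp: W_def)
        moreover have "e \<in> edges G'"
          using pq pq' \<open>v \<notin> e\<close> unfolding G' Y_nabla_at_def delete_vertices_def X_def by auto
        ultimately show "e \<in> edges (delete_vertices G' S)" by (simp add: delete_vertices_def)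
      qed
    qed
    then have "two_apex G" by (rule two_apex_of_planar)
    then show False using assms(3) by (simp add: N2A_def)
  qed
qed

end
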